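(* Let $N\in\mathbb{N}$, $T>0$, let $a_2,a_{1,1},\dots,a_{1,N},a_0\in C([0,T];\mathbb{C})$ and let $$P=D_t-a_2(t)\Delta_x+\sum_{j=1}^N a_{1,j}(t)D_{x_j}+a_0(t),\qquad \widetilde P=D_t-ic_2(t)\Delta_x+\sum_{j=1}^N i\,c_{1,j}(t)D_{x_j},$$ where $c_2=\operatorname{Im}a_2$ and $c_{1,j}=\operatorname{Im}a_{1,j}$. Consider the Cauchy problems, for $t\in[0,T]$, $x\in\mathbb{T}^N$, $$(\mathrm{CP})\quad Pu=f,\ u(0,x)=g(x);\qquad (\widetilde{\mathrm{CP}})\quad \widetilde Pu=\alpha,\ u(0,x)=\beta(x).$$ Then (CP) is well-posed in $C^\infty$ (respectively in $G^s$, for any $s\ge1$) if and only if $(\widetilde{\mathrm{CP}})$ is well-posed in $C^\infty$ (respectively in $G^s$). Moreover, if there exists $\delta\ge0$ such that (CP) is well-posed in $H^r$ with loss of $\delta$ derivatives, then $(\widetilde{\mathrm{CP}})$ is well-posed in $H^r$ with loss of $(4+\delta)$ derivatives.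
   Context: $\mathbb{T}^N=\mathbb{R}^N/2\pi\mathbb{Z}^N$, $D_t=\frac1i\partial_t$, $D_{x_j}=\frac1i\partial_{x_j}$, $\Delta_x=\sum_j\partial_{x_j}^2$. Spaces. For a distribution $u$ on $\mathbb{T}^N$ its Fourier coefficients are $\widehat u(\xi)=\langle u,e^{-ix\xi}\rangle$, $\xi\in\mathbb{Z}^N$, normalized so that $u=\sum_\xi\widehat u(\xi)e^{ix\xi}$. For $r\in\mathbb{R}$, $H^r(\mathbb{T}^N)$ is the set of distributions with $\|u\|_{H^r}^2=\sum_{\xi}|\widehat u(\xi)|^2(1+|\xi|)^{2r}<\infty$. $C^\infty(\mathbb{T}^N)=\bigcap_r H^r(\mathbb{T}^N)$ carries the projective limit topology. For $s\ge1$, $G^s(\mathbb{T}^N)$ is the set of $f\in C^\infty(\mathbb{T}^N)$ for which there are $C,h>0$ with $|D^\alpha f(x)|\le Ch^{|\alpha|}|\alpha|!^s$ for all multi-indices $\alpha$ and all $x$. With $\|f\|_{h,s}=\sup_\alpha \|D^\alpha f\|_\infty/(h^{|\alpha|}|\alpha|!^s)$ and $G^s_h(\mathbb{T}^N)=\{f:\|f\|_{h,s}<\infty\}$, $G^s(\mathbb{T}^N)$ carries the (locally convex) inductive limit topology of the Banach spaces $G^s_h(\mathbb{T}^N)$, $h\to\infty$. $C([0,T];X)$ denotes the continuous maps $[0,T]\to X$. Solutions. $u\in C([0,T];H^\rho(\mathbb{T}^N))$ (some $\rho\in\mathbb{R}$) solves the Cauchy problem $Pu=f$, $u(0)=g$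 if the initial condition holds and the equation holds with $D_tu$ understood as the weak derivative in $t$ on $(0,T)$: $\langle D_tu,\varphi\rangle=\int_0^T u(t)(-D_t\varphi(t))\,dt$ for $\varphi\in C_c^\infty((0,T))$ (same for $\widetilde P$). Well-posedness. Given $\delta\ge0$, a Cauchy problem with data $f,g$ is well-posed in $H^r$ with loss of $\delta$ derivatives if for every $r\in\mathbb{R}$, $f\in C([0,T];H^r(\mathbb{T}^N))$ and $g\in H^r(\mathbb{T}^N)$ there is a unique solution $u\in C([0,T];H^{r-\delta}(\mathbb{T}^N))$. It is well-posed in $C^\infty$ (resp. in $G^s$, for a fixed $s\ge1$) if for every $f\in C([0,T];X)$ and $g\in X$ there is a unique solution $u\in C([0,T];X)$, where $X=C^\infty(\mathbb{T}^N)$ (resp. $X=G^s(\mathbb{T}^N)$). *)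

theory Defs
  imports "HOL-Analysis.Analysis"
begin

text \<open>
  The torus has dimension \<open>N = CARD('n)\<close>. Functions on it are \<open>2 * pi\<close>-periodic functions on
  \<open>real ^ 'n\<close>. A multi-index is encoded as a list \<open>js\<close> of coordinate directions, of length
  \<open>|alpha|\<close>; for smooth functions the order of the list is immaterial, so that ranging over all
  lists is the same as ranging over all multi-indices.
\<close>

subsection \<open>Test functions\<close>

definition partial :: "'n::finite \<Rightarrow> (real ^ 'n \<Rightarrow> complex) \<Rightarrow> real ^ 'n \<Rightarrow> complex" where
  "partial j F x = vector_derivative (\<lambda>h::real. F (x + h *\<^sub>R axis j 1)) (at 0)"

definition Dx_fun :: "'n::finite \<Rightarrow> (real ^ 'n \<Rightarrow> complex) \<Rightarrow> real ^ 'n \<Rightarrow> complex" where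
  "Dx_fun j F x = 1 / \<i> * partial j F x"

definition D_fun :: "'n::finite list \<Rightarrow> (real ^ 'n \<Rightarrow> complex) \<Rightarrow> real ^ 'n \<Rightarrow> complex" where
  "D_fun js F = foldr Dx_fun js F"

definition test_functions :: "(real ^ 'n::finite \<Rightarrow> complex) set" where
  "test_functions = {F. (\<forall>js x. D_fun js F differentiable (at x)) \<and>
                        (\<forall>j x. F (x + axis j (2 * pi)) = F x)}"

definition sup_norm :: "(real ^ 'n::finite \<Rightarrow> complex) \<Rightarrow> real" where
  "sup_norm F = (SUP x. norm (F x))"

definition C_seminorm :: "nat \<Rightarrow> (real ^ 'n::finite \<Rightarrow> complex) \<Rightarrow> real" where
  "C_seminorm k F = (SUP js\<in>{js. length js \<le> k}. sup_norm (D_fun js F))"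

subsection \<open>Distributions\<close>

text \<open>
  Distributions are total functions; they are made to vanish off the test functions so that
  equality of distributions is equality in HOL and sums and multiples are pointwise.
\<close>

type_synonym 'n functional = "(real ^ 'n \<Rightarrow> complex) \<Rightarrow> complex"

definition distributions :: "'n::finite functional set" where
  "distributions = {u.
     (\<forall>\<phi>. \<phi> \<notin> test_functions \<longrightarrow> u \<phi> = 0) \<and>
     (\<forall>\<phi>\<in>test_functions. \<forall>\<psi>\<in>test_functions. u (\<lambda>x. \<phi> x + \<psi> x) = u \<phi> + u \<psi>) \<and>
     (\<forall>c. \<forall>\<phi>\<in>test_functions. u (\<lambda>x. c * \<phi> x) = c * u \<phi>) \<and>
     (\<exists>C k. \<forall>\<phi>\<in>test_functions. norm (u \<phi>) \<le> C * C_seminorm k \<phi>)}"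

definition partial_distr :: "'n::finite \<Rightarrow> 'n functional \<Rightarrow> 'n functional" where
  "partial_distr j u = (\<lambda>\<phi>. if \<phi> \<in> test_functions then - u (partial j \<phi>) else 0)"

definition Dx :: "'n::finite \<Rightarrow> 'n functional \<Rightarrow> 'n functional" where
  "Dx j u = (\<lambda>\<phi>. 1 / \<i> * partial_distr j u \<phi>)"

definition laplacian :: "'n::finite functional \<Rightarrow> 'n functional" where
  "laplacian u = (\<lambda>\<phi>. \<Sum>j\<in>UNIV. partial_distr j (partial_distr j u) \<phi>)"

definition diff_distr :: "'n functional \<Rightarrow> 'n functional \<Rightarrow> 'n functional" where
  "diff_distr u v = (\<lambda>\<phi>. u \<phi> - v \<phi>)"

definition freq :: "int ^ 'n::finite \<Rightarrow> real ^ 'n" where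
  "freq \<xi> = (\<chi> j. of_int (\<xi> $ j))"

definition fourier_coeff :: "'n::finite functional \<Rightarrow> int ^ 'n \<Rightarrow> complex" where
  "fourier_coeff u \<xi> = u (\<lambda>x. exp (- \<i> * of_real (x \<bullet> freq \<xi>)))"

subsection \<open>Sobolev spaces and smooth functions\<close>

definition sobolev :: "real \<Rightarrow> 'n::finite functional set" where
  "sobolev r = {u \<in> distributions.
     (\<lambda>\<xi>. (norm (fourier_coeff u \<xi>))\<^sup>2 * (1 + norm (freq \<xi>)) powr (2 * r)) summable_on UNIV}"

definition sobolev_norm :: "real \<Rightarrow> 'n::finite functional \<Rightarrow> real" where
  "sobolev_norm r u =
     sqrt (\<Sum>\<^sub>\<infinity>\<xi>. (norm (fourier_coeff u \<xi>))\<^sup>2 * (1 + norm (freq \<xi>)) powr (2 * r))"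

definition sobolev_topology :: "real \<Rightarrow> 'n::finite functional topology" where
  "sobolev_topology r =
     Metric_space.mtopology (sobolev r) (\<lambda>u v. sobolev_norm r (diff_distr u v))"

definition smooth :: "'n::finite functional set" where
  "smooth = (\<Inter>r. sobolev r)"

text \<open>The projective limit topology: the coarsest one making all inclusions into the Sobolev
  spaces continuous.\<close>

definition smooth_topology :: "'n::finite functional topology" where
  "smooth_topology = topology_generated_by {U \<inter> smooth | U. \<exists>r. openin (sobolev_topology r) U}"

subsection \<open>Gevrey classes\<close>

text \<open>The function represented by an element of \<^const>\<open>smooth\<close> is the sum of its Fourier series,
  which converges absolutely together with all derivatives.\<close>

definition fun_of :: "'n::finite functional \<Rightarrow> real ^ 'n \<Rightarrow> complex" where
  "fun_of u x = (\<Sum>\<^sub>\<infinity>\<xi>. fourier_coeff u \<xi> * exp (\<i> * of_real (x \<bullet> freq \<xi>)))"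

definition gevrey :: "real \<Rightarrow> 'n::finite functional set" where
  "gevrey s = {f \<in> smooth. \<exists>C>0. \<exists>h>0. \<forall>js x.
     norm (D_fun js (fun_of f) x) \<le> C * h ^ length js * fact (length js) powr s}"

definition gevrey_quotient :: "real \<Rightarrow> real \<Rightarrow> 'n::finite functional \<Rightarrow> 'n list \<Rightarrow> real" where
  "gevrey_quotient h s f js =
     sup_norm (D_fun js (fun_of f)) / (h ^ length js * fact (length js) powr s)"

text \<open>\<^term>\<open>bdd_above\<close> expresses finiteness of the supremum defining \<open>gevrey_norm\<close>.\<close>

definition gevrey_step :: "real \<Rightarrow> real \<Rightarrow> 'n::finite functional set" where
  "gevrey_step h s = {f \<in> smooth. bdd_above (range (gevrey_quotient h s f))}"

definition gevrey_norm :: "real \<Rightarrow> real \<Rightarrow> 'n::finite functional \<Rightarrow> real" where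
  "gevrey_norm h s f = (SUP js. gevrey_quotient h s f js)"

text \<open>The locally convex inductive limit topology: the absolutely convex sets that meet each
  Banach space of the scale in a neighbourhood of zero form a base of neighbourhoods of zero.\<close>

definition absolutely_convex :: "'n functional set \<Rightarrow> bool" where
  "absolutely_convex V \<longleftrightarrow> (\<forall>u\<in>V. \<forall>v\<in>V. \<forall>a b :: complex. norm a + norm b \<le> 1 \<longrightarrow>
     (\<lambda>\<phi>. a * u \<phi> + b * v \<phi>) \<in> V)"

definition gevrey_zero_base :: "real \<Rightarrow> 'n::finite functional set set" where
  "gevrey_zero_base s = {V. V \<subseteq> gevrey s \<and> absolutely_convex V \<and>
     (\<forall>h>0. \<exists>e>0. \<forall>v\<in>gevrey_step h s. gevrey_norm h s v < e \<longrightarrow> v \<in> V)}"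

definition gevrey_topology :: "real \<Rightarrow> 'n::finite functional topology" where
  "gevrey_topology s = topology (\<lambda>U. U \<subseteq> gevrey s \<and>
     (\<forall>u\<in>U. \<exists>V\<in>gevrey_zero_base s. \<forall>v\<in>V. (\<lambda>\<phi>. u \<phi> + v \<phi>) \<in> U))"

lemma gevrey_zero_base_Int:
  assumes "V \<in> gevrey_zero_base s" "W \<in> gevrey_zero_base s"
  shows "V \<inter> W \<in> gevrey_zero_base s"
proof -
  have "\<exists>e>0. \<forall>v\<in>gevrey_step h s. gevrey_norm h s v < e \<longrightarrow> v \<in> V \<inter> W" if "h > 0" for h
  proof -
    obtain d e where "d > 0" "\<forall>v\<in>gevrey_step h s. gevrey_norm h s v < d \<longrightarrow> v \<in> V"
      and "e > 0" "\<forall>v\<in>gevrey_step h s. gevrey_norm h s v < e \<longrightarrow> v \<in> W"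
      using assms \<open>h > 0\<close> unfolding gevrey_zero_base_def by blast
    then show ?thesis by (intro exI[of _ "min d e"]) auto
  qed
  moreover have "absolutely_convex (V \<inter> W)"
    using assms unfolding gevrey_zero_base_def absolutely_convex_def by blast
  ultimately show ?thesis
    using assms unfolding gevrey_zero_base_def by blast
qed

lemma openin_gevrey_topology:
  "openin (gevrey_topology s) U \<longleftrightarrow> U \<subseteq> gevrey s \<and>
     (\<forall>u\<in>U. \<exists>V\<in>gevrey_zero_base s. \<forall>v\<in>V. (\<lambda>\<phi>. u \<phi> + v \<phi>) \<in> U)"
proof -
  have "istopology (\<lambda>U. U \<subseteq> gevrey s \<and>
     (\<forall>u\<in>U. \<exists>V\<in>gevrey_zero_base s. \<forall>v\<in>V. (\<lambda>\<phi>. u \<phi> + v \<phi>) \<in> U))" (is "istopology ?P")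
    unfolding istopology_def
  proof (intro conjI allI impI)
    fix A B assume A: "?P A" and B: "?P B"
    have "\<exists>V\<in>gevrey_zero_base s. \<forall>v\<in>V. (\<lambda>\<phi>. u \<phi> + v \<phi>) \<in> A \<inter> B" if u: "u \<in> A \<inter> B" for u
    proof -
      obtain V W where "V \<in> gevrey_zero_base s" "\<forall>v\<in>V. (\<lambda>\<phi>. u \<phi> + v \<phi>) \<in> A"
        and "W \<in> gevrey_zero_base s" "\<forall>v\<in>W. (\<lambda>\<phi>. u \<phi> + v \<phi>) \<in> B"
        using A B u by blast
      then show ?thesis by (intro bexI[of _ "V \<inter> W"] gevrey_zero_base_Int) auto
    qed
    then show "A \<inter> B \<subseteq> gevrey s"
      and "\<forall>u\<in>A \<inter> B. \<exists>V\<in>gevrey_zero_base s. \<forall>v\<in>V. (\<lambda>\<phi>. u \<phi> + v \<phi>) \<in> A \<inter> B"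
      using A by blast+
  next
    fix \<K> assume K: "\<forall>K\<in>\<K>. ?P K"
    then show "\<Union>\<K> \<subseteq> gevrey s" by blast
    show "\<forall>u\<in>\<Union>\<K>. \<exists>V\<in>gevrey_zero_base s. \<forall>v\<in>V. (\<lambda>\<phi>. u \<phi> + v \<phi>) \<in> \<Union>\<K>"
      using K by (meson Union_iff)
  qed
  then show ?thesis
    unfolding gevrey_topology_def by (subst topology_inverse') (assumption, rule refl)
qed

subsection \<open>The Cauchy problem\<close>

definition continuous_into :: "real \<Rightarrow> 'a topology \<Rightarrow> (real \<Rightarrow> 'a) \<Rightarrow> bool" where
  "continuous_into T X u \<longleftrightarrow> continuous_map (top_of_set {0..T}) X u"

definition Dt_fun :: "(real \<Rightarrow> complex) \<Rightarrow> real \<Rightarrow> complex" where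
  "Dt_fun \<theta> t = 1 / \<i> * vector_derivative \<theta> (at t)"

definition time_test_functions :: "real \<Rightarrow> (real \<Rightarrow> complex) set" where
  "time_test_functions T = {\<theta>. (\<forall>k t. (Dt_fun ^^ k) \<theta> differentiable (at t)) \<and>
     (\<exists>K. compact K \<and> K \<subseteq> {0<..<T} \<and> (\<forall>t. t \<notin> K \<longrightarrow> \<theta> t = 0))}"

text \<open>Integrals of distribution-valued functions are weak integrals, that is, they are taken after
  evaluation at each test function on the torus.\<close>

definition distr_integral :: "real \<Rightarrow> (real \<Rightarrow> 'n::finite functional) \<Rightarrow> 'n functional" where
  "distr_integral T w = (\<lambda>\<phi>. integral {0..T} (\<lambda>t. w t \<phi>))"

definition weak_Dt :: "real \<Rightarrow> (real \<Rightarrow> 'n::finite functional) \<Rightarrow> (real \<Rightarrow> complex) \<Rightarrow> 'n functional" where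
  "weak_Dt T u \<theta> = distr_integral T (\<lambda>t \<phi>. u t \<phi> * (- Dt_fun \<theta> t))"

definition time_pairing :: "real \<Rightarrow> (real \<Rightarrow> 'n::finite functional) \<Rightarrow> (real \<Rightarrow> complex) \<Rightarrow> 'n functional" where
  "time_pairing T w \<theta> = distr_integral T (\<lambda>t \<phi>. w t \<phi> * \<theta> t)"

definition spatial_op ::
  "(real \<Rightarrow> complex) \<Rightarrow> ('n::finite \<Rightarrow> real \<Rightarrow> complex) \<Rightarrow> (real \<Rightarrow> complex) \<Rightarrow>
   real \<Rightarrow> 'n functional \<Rightarrow> 'n functional" where
  "spatial_op a2 a1 a0 t v =
     (\<lambda>\<phi>. - a2 t * laplacian v \<phi> + (\<Sum>j\<in>UNIV. a1 j t * Dx j v \<phi>) + a0 t * v \<phi>)"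

text \<open>In the following, \<open>A\<close> is the spatial part of the operator \<open>D_t + A(t)\<close>.\<close>

definition solves ::
  "real \<Rightarrow> (real \<Rightarrow> 'n::finite functional \<Rightarrow> 'n functional) \<Rightarrow>
   (real \<Rightarrow> 'n functional) \<Rightarrow> 'n functional \<Rightarrow> (real \<Rightarrow> 'n functional) \<Rightarrow> bool" where
  "solves T A f g u \<longleftrightarrow>
     (\<exists>\<rho>. continuous_into T (sobolev_topology \<rho>) u) \<and>
     u 0 = g \<and>
     (\<forall>\<theta>\<in>time_test_functions T. \<forall>\<phi>\<in>test_functions.
        weak_Dt T u \<theta> \<phi> + time_pairing T (\<lambda>t. A t (u t)) \<theta> \<phi> = time_pairing T f \<theta> \<phi>)"

text \<open>Data in \<open>X\<close>, solutions in \<open>Y\<close>. Curves are compared on \<open>{0..T}\<close> only, as their values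
  elsewhere are arbitrary.\<close>

definition well_posed ::
  "real \<Rightarrow> (real \<Rightarrow> 'n::finite functional \<Rightarrow> 'n functional) \<Rightarrow>
   'n functional topology \<Rightarrow> 'n functional topology \<Rightarrow> bool" where
  "well_posed T A X Y \<longleftrightarrow>
     (\<forall>f g. continuous_into T X f \<and> g \<in> topspace X \<longrightarrow>
        (\<exists>u. continuous_into T Y u \<and> solves T A f g u) \<and>
        (\<forall>u v. continuous_into T Y u \<and> solves T A f g u \<and> continuous_into T Y v \<and> solves T A f g v
           \<longrightarrow> (\<forall>t\<in>{0..T}. u t = v t)))"

definition well_posed_sobolev ::
  "real \<Rightarrow> (real \<Rightarrow> 'n::finite functional \<Rightarrow> 'n functional) \<Rightarrow> real \<Rightarrow> bool" where
  "well_posed_sobolev T A \<delta> \<longleftrightarrow>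
     (\<forall>r. well_posed T A (sobolev_topology r) (sobolev_topology (r - \<delta>)))"

definition well_posed_smooth ::
  "real \<Rightarrow> (real \<Rightarrow> 'n::finite functional \<Rightarrow> 'n functional) \<Rightarrow> bool" where
  "well_posed_smooth T A \<longleftrightarrow> well_posed T A smooth_topology smooth_topology"

definition well_posed_gevrey ::
  "real \<Rightarrow> (real \<Rightarrow> 'n::finite functional \<Rightarrow> 'n functional) \<Rightarrow> real \<Rightarrow> bool" where
  "well_posed_gevrey T A s \<longleftrightarrow> well_posed T A (gevrey_topology s) (gevrey_topology s)"

end

theory Submission
  imports Defs
begin

text \<open>
  On the Fourier side the equation decouples into the scalar equations
  \<open>D\<^sub>t y + p(t, \<xi>) y = f\<close>, which with the integrating factor \<open>E(t, \<xi>) = exp (i \<integral>\<^sub>0\<^sup>t p)\<close> read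
  \<open>E y = y(0) + i \<integral>\<^sub>0\<^sup>t E f\<close>. In particular solutions are unique, whatever the data. The
  symbols of the two operators have the same imaginary part up to a term independent of \<open>\<xi>\<close>, hence the
  quotient of their integrating factors is a bounded Fourier multiplier, and it conjugates one Cauchy
  problem into the other. Its Lipschitz constant in \<open>t\<close> grows like \<open>(1 + |\<xi>|)\<^sup>2\<close>, so it maps continuous
  curves in the Sobolev space of index \<open>r\<close> to continuous curves in that of index \<open>r - 2\<close>; it is applied
  once to the data and once to the solution, which accounts for the loss of four derivatives.
\<close>

text \<open>A solution is tested only against products of a function of t and a test function on the
  torus, so the decoupling has to be earned twice. In x, functionals must be shown to be determined
  by their values on plane waves; this rests on Fourier inversion for test functions with
  convergence in every \<open>C_seminorm\<close>, because a distribution is controlled by a seminorm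
  of unknown order. In t, the weak equation of a single mode must become an integral equation; this
  is the lemma of du Bois-Reymond, for which smooth bump functions are built. For fixed t the
  conjugating multiplier loses no derivatives; the two lost at each application only buy continuity
  in t, 2 being the order of the difference of the symbols. The smooth and Gevrey classes absorb a
  finite loss, hence the equivalence there; in the Gevrey scale it costs a factor 2^s in h. The
  delicate point is the locally convex inductive limit: a continuous curve is not treated inside a
  single step. Its continuity is expressed by absolutely convex neighbourhoods of zero, and the
  multipliers are shown to be equicontinuous on them.\<close>

definition wave :: "int ^ 'n::finite \<Rightarrow> real ^ 'n \<Rightarrow> complex" where
  "wave \<xi> x = exp (\<i> * of_real (x \<bullet> freq \<xi>))"

text \<open>The symbol of \<open>D_fun js\<close>, with the same encoding of multi-indices as lists
  of directions.\<close>

definition freq_power :: "'n::finite list \<Rightarrow> int ^ 'n \<Rightarrow> complex" where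
  "freq_power js \<xi> = prod_list (map (\<lambda>j. of_int (\<xi> $ j)) js)"

definition bracket :: "int ^ 'n::finite \<Rightarrow> real" where
  "bracket \<xi> = 1 + norm (freq \<xi>)"

definition periodic :: "(real ^ 'n::finite \<Rightarrow> 'a) \<Rightarrow> bool" where
  "periodic F \<longleftrightarrow> (\<forall>j x. F (x + axis j (2 * pi)) = F x)"

text \<open>A relational companion of \<open>partial\<close>: \<open>vector_derivative\<close> is an
  arbitrary value where no derivative exists, so existence has to travel together with the
  value.\<close>

definition has_partial :: "'n::finite \<Rightarrow> (real ^ 'n \<Rightarrow> complex) \<Rightarrow> (real ^ 'n \<Rightarrow> complex) \<Rightarrow> bool" where
  "has_partial j F G \<longleftrightarrow>
     (\<forall>x. ((\<lambda>h. F (x + h *\<^sub>R axis j 1)) has_vector_derivative G x) (at 0))"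

subsection \<open>Plane waves and test functions\<close>

lemma freq_nth [simp]: "freq \<xi> $ j = of_int (\<xi> $ j)"
  by (simp add: freq_def)

lemma freq_minus [simp]: "freq (- \<xi>) = - freq \<xi>"
  by (simp add: vec_eq_iff)

lemma freq_add: "freq (\<xi> + \<eta>) = freq \<xi> + freq \<eta>"
  by (simp add: vec_eq_iff)

lemma freq_0 [simp]: "freq 0 = 0"
  by (simp add: vec_eq_iff)

lemma bracket_ge_1: "1 \<le> bracket \<xi>" and bracket_pos [simp]: "0 < bracket \<xi>"
  and bracket_nonneg [simp]: "0 \<le> bracket \<xi>" and bracket_nonzero [simp]: "bracket \<xi> \<noteq> 0"
proof -
  show "1 \<le> bracket \<xi>" by (simp add: bracket_def)
  then show "0 < bracket \<xi>" "0 \<le> bracket \<xi>" "bracket \<xi> \<noteq> 0" by auto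
qed

lemma bracket_minus [simp]: "bracket (- \<xi>) = bracket \<xi>"
  by (simp add: bracket_def)

lemma freq_power_Nil [simp]: "freq_power [] \<xi> = 1"
  and freq_power_Cons [simp]: "freq_power (j # js) \<xi> = of_int (\<xi> $ j) * freq_power js \<xi>"
  by (simp_all add: freq_power_def)

lemma freq_power_replicate [simp]: "freq_power (replicate k j) \<xi> = of_int (\<xi> $ j) ^ k"
  by (induction k) auto

lemma wave_add: "wave (\<xi> + \<eta>) x = wave \<xi> x * wave \<eta> x"
  by (simp add: wave_def freq_add inner_add_right distrib_left exp_add)

lemma wave_0 [simp]: "wave 0 x = 1"
  by (simp add: wave_def)

lemma wave_minus_eq: "wave (- \<xi>) x = exp (- \<i> * of_real (x \<bullet> freq \<xi>))"
  by (simp add: wave_def)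

lemma norm_wave [simp]: "norm (wave \<xi> x) = 1"
  by (simp add: wave_def)

lemma wave_shift: "wave \<xi> (x + y) = wave \<xi> x * wave \<xi> y"
  by (simp add: wave_def inner_add_left distrib_left exp_add)

lemma wave_axis: "wave \<xi> (axis j h) = exp (\<i> * of_real (h * of_int (\<xi> $ j)))"
  by (simp add: wave_def inner_axis')

lemma periodic_wave: "periodic (wave \<xi>)"
proof -
  have "wave \<xi> (axis j (2 * pi)) = 1" for j
    unfolding wave_axis exp_eq_1 by (auto intro: exI[of _ "\<xi> $ j"])
  then show ?thesis by (simp add: periodic_def wave_shift)
qed

lemma continuous_wave: "continuous_on X (wave \<xi>)"
  unfolding wave_def by (intro continuous_intros)

lemma scaleR_axis: "h *\<^sub>R axis j 1 = axis j (h::real)"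
  by (simp add: vec_eq_iff axis_def)

lemma has_partial_partial: "has_partial j F G \<Longrightarrow> partial j F = G"
  unfolding has_partial_def partial_def by (auto intro!: ext vector_derivative_at)

text \<open>Moving the base point along the axis turns a derivative at 0 into one at any h. This
  form is what differentiation under the integral asks for.\<close>

lemma has_partial_shift:
  assumes "has_partial j F G"
  shows "((\<lambda>h. F (x + h *\<^sub>R axis j 1)) has_vector_derivative G (x + h *\<^sub>R axis j 1)) (at h within X)"
proof -
  have "((\<lambda>k. F ((x + h *\<^sub>R axis j 1) + k *\<^sub>R axis j 1)) has_vector_derivative G (x + h *\<^sub>R axis j 1)) (at (0 :: real))"
    using assms unfolding has_partial_def by blast
  then have "((\<lambda>k. F ((x + h *\<^sub>R axis j 1) + k *\<^sub>R axis j 1)) \<circ> (\<lambda>k. k - h) has_vector_derivative (1::real) *\<^sub>R G (x + h *\<^sub>R axis j 1)) (at h)"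
    by (intro vector_diff_chain_at) (auto intro!: derivative_eq_intros)
  moreover have "(\<lambda>k. F ((x + h *\<^sub>R axis j 1) + k *\<^sub>R axis j 1)) \<circ> (\<lambda>k. k - h) = (\<lambda>h. F (x + h *\<^sub>R axis j 1))"
    by (auto simp: fun_eq_iff algebra_simps)
  ultimately show ?thesis
    by (auto intro: has_vector_derivative_at_within)
qed

lemma has_partial_differentiable:
  assumes "\<And>x. F differentiable (at x)"
  shows "has_partial j F (partial j F)"
proof -
  have "(\<lambda>h. F (x + h *\<^sub>R axis j 1)) differentiable (at (0::real))" for x
  proof -
    have "F \<circ> (\<lambda>h. x + h *\<^sub>R axis j 1) differentiable (at (0::real))"
      by (intro differentiable_chain_at derivative_intros) (use assms in auto)
    then show ?thesis by (simp add: o_def)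
  qed
  then show ?thesis
    unfolding has_partial_def partial_def by (simp add: vector_derivative_works[symmetric])
qed

lemma has_partial_add: "has_partial j F F' \<Longrightarrow> has_partial j G G' \<Longrightarrow>
    has_partial j (\<lambda>x. F x + G x) (\<lambda>x. F' x + G' x)"
  and has_partial_mult: "has_partial j F F' \<Longrightarrow> has_partial j G G' \<Longrightarrow>
    has_partial j (\<lambda>x. F x * G x) (\<lambda>x. F x * G' x + F' x * G x)"
  and has_partial_cmult: "has_partial j F F' \<Longrightarrow> has_partial j (\<lambda>x. c * F x) (\<lambda>x. c * F' x)"
  unfolding has_partial_def by (auto intro!: derivative_eq_intros)

lemma has_partial_wave: "has_partial j (wave \<xi>) (\<lambda>x. \<i> * of_int (\<xi> $ j) * wave \<xi> x)"
proof -
  have "((\<lambda>h::real. wave \<xi> (x + h *\<^sub>R axis j 1)) has_vector_derivative \<i> * of_int (\<xi> $ j) * wave \<xi> x) (at 0)" for x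
    unfolding wave_def inner_add_left inner_scaleR_left inner_axis' freq_nth
    by (rule has_vector_derivative_real_field derivative_eq_intros refl | simp)+
  then show ?thesis by (simp add: has_partial_def)
qed

lemma Dx_fun_eq: "Dx_fun j F = (\<lambda>x. 1 / \<i> * partial j F x)"
  by (auto simp: Dx_fun_def)

lemma Dx_fun_wave: "Dx_fun j (\<lambda>x. c * wave \<xi> x) = (\<lambda>x. of_int (\<xi> $ j) * c * wave \<xi> x)"
  unfolding Dx_fun_eq has_partial_partial[OF has_partial_cmult[OF has_partial_wave]]
  by (auto simp: field_simps)

lemma D_fun_Nil [simp]: "D_fun [] F = F"
  and D_fun_Cons [simp]: "D_fun (j # js) F = Dx_fun j (D_fun js F)"
  and D_fun_append: "D_fun (js @ ks) F = D_fun js (D_fun ks F)"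
  by (simp_all add: D_fun_def)

lemma D_fun_wave: "D_fun js (\<lambda>x. c * wave \<xi> x) = (\<lambda>x. freq_power js \<xi> * c * wave \<xi> x)"
  by (induction js) (auto simp: Dx_fun_wave)

lemma differentiable_wave: "wave \<xi> differentiable (at x)"
proof -
  have "((\<lambda>x. \<i> * complex_of_real (x \<bullet> freq \<xi>)) has_derivative (\<lambda>h. \<i> * complex_of_real (h \<bullet> freq \<xi>))) (at x)"
    by (auto intro!: derivative_eq_intros)
  moreover have "(exp has_derivative (*) (exp (\<i> * complex_of_real (x \<bullet> freq \<xi>)))) (at (\<i> * complex_of_real (x \<bullet> freq \<xi>)))"
    using DERIV_exp has_field_derivative_def by blast
  ultimately show ?thesis
    using diff_chain_at[of "\<lambda>x. \<i> * complex_of_real (x \<bullet> freq \<xi>)" _ x exp]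
    unfolding wave_def[abs_def] o_def by (auto simp: differentiable_def)
qed

lemma wave_test [simp]: "wave \<xi> \<in> test_functions"
  using periodic_wave[of \<xi>] D_fun_wave[of _ 1 \<xi>] 
  by (auto simp: test_functions_def periodic_def intro!: derivative_intros differentiable_wave)

lemma test_differentiable: "\<phi> \<in> test_functions \<Longrightarrow> D_fun js \<phi> differentiable (at x)"
  by (auto simp: test_functions_def)

lemma test_continuous: "\<phi> \<in> test_functions \<Longrightarrow> continuous_on X (D_fun js \<phi>)"
  using differentiable_imp_continuous_within[OF test_differentiable]
  by (intro continuous_at_imp_continuous_on) auto

lemma test_has_partial:
  assumes "\<phi> \<in> test_functions"
  shows "has_partial j (D_fun js \<phi>) (partial j (D_fun js \<phi>))"
  by (intro has_partial_differentiable test_differentiable assms)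

lemma periodic_Dx_fun:
  assumes "periodic F"
  shows "periodic (Dx_fun j F)"
proof -
  have "F (x + axis k (2 * pi) + h *\<^sub>R axis j 1) = F (x + h *\<^sub>R axis j 1)" for x k h
    using assms unfolding periodic_def by (metis (no_types) add.assoc add.commute)
  then show ?thesis
    by (simp add: periodic_def Dx_fun_def partial_def)
qed

lemma test_periodic:
  assumes "\<phi> \<in> test_functions"
  shows "periodic (D_fun js \<phi>)"
proof (induction js)
  case Nil
  then show ?case using assms by (simp add: test_functions_def periodic_def)
qed (auto intro: periodic_Dx_fun)

lemma D_fun_test [simp]:
  assumes "\<phi> \<in> test_functions"
  shows "D_fun js \<phi> \<in> test_functions"
  using test_differentiable[OF assms, of "_ @ js"] test_periodic[OF assms, of js]
  by (auto simp: test_functions_def D_fun_append periodic_def)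

lemma Dx_fun_add:
  assumes "has_partial j F F'" "has_partial j G G'"
  shows "Dx_fun j (\<lambda>x. F x + G x) = (\<lambda>x. Dx_fun j F x + Dx_fun j G x)"
  unfolding Dx_fun_eq has_partial_partial[OF has_partial_add[OF assms]]
    assms[THEN has_partial_partial] by (simp add: distrib_left)

lemma Dx_fun_cmult:
  assumes "has_partial j F F'"
  shows "Dx_fun j (\<lambda>x. c * F x) = (\<lambda>x. c * Dx_fun j F x)"
  unfolding Dx_fun_eq has_partial_partial[OF has_partial_cmult[OF assms]]
    assms[THEN has_partial_partial] by (simp add: mult.left_commute)

lemma D_fun_add:
  assumes "\<phi> \<in> test_functions" "\<psi> \<in> test_functions"
  shows "D_fun js (\<lambda>x. \<phi> x + \<psi> x) = (\<lambda>x. D_fun js \<phi> x + D_fun js \<psi> x)"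
  by (induction js) (auto simp: Dx_fun_add[OF assms[THEN test_has_partial]])

lemma D_fun_cmult:
  assumes "\<phi> \<in> test_functions"
  shows "D_fun js (\<lambda>x. c * \<phi> x) = (\<lambda>x. c * D_fun js \<phi> x)"
  by (induction js) (auto simp: Dx_fun_cmult[OF test_has_partial[OF assms]])

lemma test_add [simp]:
  assumes "\<phi> \<in> test_functions" "\<psi> \<in> test_functions"
  shows "(\<lambda>x. \<phi> x + \<psi> x) \<in> test_functions"
proof -
  have "D_fun js (\<lambda>x. \<phi> x + \<psi> x) differentiable (at x)" for js x
    unfolding D_fun_add[OF assms] by (intro derivative_intros test_differentiable assms)
  then show ?thesis using assms by (simp add: test_functions_def)
qed

lemma test_cmult [simp]:
  assumes "\<phi> \<in> test_functions"
  shows "(\<lambda>x. c * \<phi> x) \<in> test_functions"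
proof -
  have "D_fun js (\<lambda>x. c * \<phi> x) differentiable (at x)" for js x
    unfolding D_fun_cmult[OF assms] by (intro derivative_intros test_differentiable assms)
  then show ?thesis using assms by (simp add: test_functions_def)
qed

lemma test_partial [simp]:
  assumes "\<phi> \<in> test_functions"
  shows "partial j \<phi> \<in> test_functions"
proof -
  have "partial j \<phi> = (\<lambda>x. \<i> * D_fun [j] \<phi> x)"
    by (auto simp: Dx_fun_eq)
  then show ?thesis
    using test_cmult[OF D_fun_test[OF assms, of "[j]"]] by metis
qed

lemma test_zero [simp]: "(\<lambda>x. 0) \<in> test_functions"
  using test_cmult[OF wave_test, of 0 0] by simp

lemma test_sum:
  assumes "finite I" "\<And>i. i \<in> I \<Longrightarrow> \<phi> i \<in> test_functions"
  shows "(\<lambda>x. \<Sum>i\<in>I. \<phi> i x) \<in> test_functions"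
  using assms by (induction I rule: finite_induct) auto

lemma D_fun_sum:
  assumes "finite I" "\<And>i. i \<in> I \<Longrightarrow> \<phi> i \<in> test_functions"
  shows "D_fun js (\<lambda>x. \<Sum>i\<in>I. \<phi> i x) = (\<lambda>x. \<Sum>i\<in>I. D_fun js (\<phi> i) x)"
  using assms
proof (induction I rule: finite_induct)
  case empty
  show ?case using D_fun_cmult[OF test_zero, of js 0] by simp
next
  case (insert i I)
  then show ?case
    using D_fun_add[of "\<phi> i" "\<lambda>x. \<Sum>i\<in>I. \<phi> i x" js] test_sum[of I \<phi>] by simp
qed

subsection \<open>Periodic functions\<close>

lemma periodic_freq:
  assumes "periodic F"
  shows "F (x + (2 * pi) *\<^sub>R freq k) = F x"
proof -
  have step: "F (x + axis j (2 * pi * of_int n)) = F x" for x j n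
  proof -
    have nat: "F (x + axis j (2 * pi * of_nat m)) = F x" for x m
    proof (induction m)
      case (Suc m)
      have eq: "x + axis j (2 * pi * of_nat (Suc m)) = (x + axis j (2 * pi * of_nat m)) + axis j (2 * pi)"
        by (simp add: vec_eq_iff axis_def algebra_simps)
      show ?case unfolding eq using assms Suc unfolding periodic_def by simp
    qed (simp add: axis_def vec_eq_iff zero_vec_def[symmetric])
    show ?thesis
    proof (cases "n \<ge> 0")
      case True
      then show ?thesis using nat[of x "nat n"] by simp
    next
      case False
      have eq: "x + axis j (2 * pi * of_int n) + axis j (2 * pi * of_nat (nat (-n))) = x"
        using False by (simp add: vec_eq_iff axis_def)
      show ?thesis using nat[of "x + axis j (2 * pi * of_int n)" "nat (-n)"] unfolding eq by (rule sym)
    qed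
  qed
  have "F (x + (\<Sum>j\<in>J. axis j (2 * pi * of_int (k $ j)))) = F x" if "finite J" for J
    using that
  proof (induction J rule: finite_induct)
    case (insert j J)
    have eq: "x + (\<Sum>j\<in>insert j J. axis j (2 * pi * of_int (k $ j))) =
        (x + (\<Sum>j\<in>J. axis j (2 * pi * of_int (k $ j)))) + axis j (2 * pi * of_int (k $ j))"
      using insert by (simp add: algebra_simps)
    show ?case unfolding eq step by (rule insert.IH)
  qed simp
  from this[of UNIV] have "F (x + (\<Sum>j\<in>UNIV. axis j (2 * pi * of_int (k $ j)))) = F x" by simp
  moreover have "(\<Sum>j\<in>UNIV. axis j (2 * pi * of_int (k $ j))) = (2 * pi) *\<^sub>R freq k"
    by (simp add: vec_eq_iff axis_def)
  ultimately show ?thesis by simp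
qed

text \<open>A closed fundamental domain: compact and a \<open>cbox\<close>. Opposite faces are
  identified on the torus, but for integrals this overlap has measure zero.\<close>

definition cube :: "(real ^ 'n::finite) set" where
  "cube = cbox (\<chi> j. - pi) (\<chi> j. pi)"

lemma mem_cube: "x \<in> cube \<longleftrightarrow> (\<forall>j. \<bar>x $ j\<bar> \<le> pi)"
  by (auto simp: cube_def mem_box_cart abs_le_iff minus_le_iff)

lemma periodic_cube:
  fixes F :: "real ^ 'n::finite \<Rightarrow> 'a"
  assumes "periodic F"
  obtains y where "y \<in> cube" "F x = F y"
proof -
  define k :: "int ^ 'n" where "k = (\<chi> j. - \<lfloor>(x $ j + pi) / (2 * pi)\<rfloor>)"
  define y where "y = x + (2 * pi) *\<^sub>R freq k"
  have "\<bar>y $ j\<bar> \<le> pi" for j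
  proof -
    define q where "q = (x $ j + pi) / (2 * pi)"
    have "y $ j = 2 * pi * (q - of_int \<lfloor>q\<rfloor>) - pi"
      by (simp add: y_def k_def q_def field_simps)
    moreover have "0 \<le> q - of_int \<lfloor>q\<rfloor>" "q - of_int \<lfloor>q\<rfloor> \<le> 1" by linarith+
    ultimately show ?thesis
      using mult_left_mono[of "q - of_int \<lfloor>q\<rfloor>" 1 "2 * pi"] mult_nonneg_nonneg[of "2 * pi" "q - of_int \<lfloor>q\<rfloor>"]
      by (auto simp: abs_le_iff)
  qed
  moreover have "F x = F y" using periodic_freq[OF assms, of x k] by (simp add: y_def)
  ultimately show thesis using that by (auto simp: mem_cube)
qed

lemma periodic_bounded:
  fixes F :: "real ^ 'n::finite \<Rightarrow> complex"
  assumes "periodic F" "continuous_on UNIV F"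
  shows "bdd_above (range (\<lambda>x. norm (F x)))"
proof -
  have "compact (F ` cube)"
    by (intro compact_continuous_image continuous_on_subset[OF assms(2)]) (auto simp: cube_def)
  then obtain B where "\<And>x. x \<in> cube \<Longrightarrow> norm (F x) \<le> B"
    by (meson bounded_iff compact_imp_bounded imageI)
  then show ?thesis
    by (intro bdd_aboveI[of _ B]) (metis assms(1) periodic_cube rangeE)
qed

lemma norm_le_sup_norm: "bdd_above (range (\<lambda>x. norm (F x))) \<Longrightarrow> norm (F x) \<le> sup_norm F"
  unfolding sup_norm_def by (rule cSUP_upper) auto

lemma sup_norm_le: "(\<And>x. norm (F x) \<le> B) \<Longrightarrow> sup_norm F \<le> B"
  unfolding sup_norm_def by (rule cSUP_least) auto

lemma test_bounded: "\<phi> \<in> test_functions \<Longrightarrow> bdd_above (range (\<lambda>x. norm (D_fun js \<phi> x)))"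
  by (intro periodic_bounded test_periodic test_continuous)

lemma finite_short_lists: "finite {js :: 'n::finite list. length js \<le> k}"
  using finite_lists_length_le[of "UNIV :: 'n set" k] by simp

lemma norm_le_C_seminorm:
  assumes "\<phi> \<in> test_functions" "length js \<le> k"
  shows "norm (D_fun js \<phi> x) \<le> C_seminorm k \<phi>"
proof -
  have "sup_norm (D_fun js \<phi>) \<le> C_seminorm k \<phi>"
    unfolding C_seminorm_def using assms by (intro cSUP_upper bdd_above_finite finite_imageI finite_short_lists) auto
  then show ?thesis using norm_le_sup_norm[OF test_bounded[OF assms(1)], of js x] by linarith
qed

lemma C_seminorm_le:
  fixes \<phi> :: "real ^ 'n::finite \<Rightarrow> complex"
  assumes "\<And>js x. length js \<le> k \<Longrightarrow> norm (D_fun js \<phi> x) \<le> B"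
  shows "C_seminorm k \<phi> \<le> B"
proof -
  have "{js :: 'n list. length js \<le> k} \<noteq> {}" by (metis (mono_tags) empty_iff le0 list.size(3) mem_Collect_eq)
  then show ?thesis
    unfolding C_seminorm_def using assms by (intro cSUP_least sup_norm_le) auto
qed

lemma C_seminorm_nonneg: "\<phi> \<in> test_functions \<Longrightarrow> 0 \<le> C_seminorm k \<phi>"
  using order_trans[OF norm_ge_zero norm_le_C_seminorm[of \<phi> "[]" k 0]] by simp

subsection \<open>Powers of frequencies\<close>

lemma abs_nth_le_bracket: "\<bar>of_int (\<xi> $ j)\<bar> + 1 \<le> bracket \<xi>"
  using component_le_norm_cart[of "freq \<xi>" j] by (simp add: bracket_def)

lemma norm_freq_power_le: "norm (freq_power js \<xi>) \<le> bracket \<xi> ^ length js"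
proof (induction js)
  case (Cons j js)
  have "\<bar>of_int (\<xi> $ j)\<bar> \<le> bracket \<xi>" using abs_nth_le_bracket[of \<xi> j] by simp
  then show ?case using Cons by (auto simp: norm_mult intro!: mult_mono)
qed simp

text \<open>The tool that trades powers of \<open>bracket\<close> for derivatives. If \<xi> is not
  0, a coordinate of largest modulus m satisfies m \<ge> 1, since frequencies are integers, so
  \<open>bracket \<xi>\<close> is at most (1 + N) m, and every monomial is dominated by the pure
  power of that coordinate.\<close>

lemma bracket_power_freq_power:
  fixes \<xi> :: "int ^ 'n::finite"
  shows "\<exists>ks. length ks \<in> {length js, length js + p} \<and>
    bracket \<xi> ^ p * norm (freq_power js \<xi>) \<le> (1 + real CARD('n)) ^ p * norm (freq_power ks \<xi>)"
proof (cases "\<xi> = 0")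
  case True
  then have "bracket \<xi> = 1" by (simp add: bracket_def)
  moreover have "1 * norm (freq_power js \<xi>) \<le> (1 + real CARD('n)) ^ p * norm (freq_power js \<xi>)"
    by (intro mult_right_mono) auto
  ultimately show ?thesis by (auto intro!: exI[of _ js])
next
  case False
  define m where "m = Max (range (\<lambda>j. \<bar>\<xi> $ j\<bar>))"
  have "m \<in> range (\<lambda>j. \<bar>\<xi> $ j\<bar>)" unfolding m_def by (rule Max_in) auto
  then obtain i where i: "\<bar>\<xi> $ i\<bar> = m" by auto
  have le: "\<bar>\<xi> $ j\<bar> \<le> m" for j unfolding m_def by (rule Max_ge) auto
  from False obtain j0 where "\<xi> $ j0 \<noteq> 0" by (auto simp: vec_eq_iff)
  then have "m \<ge> 1" using le[of j0] by linarith
  have "norm (freq \<xi>) \<le> (\<Sum>j\<in>UNIV. \<bar>freq \<xi> $ j\<bar>)" by (rule norm_le_l1_cart)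
  also have "\<dots> \<le> (\<Sum>j\<in>(UNIV::'n set). of_int m)"
    using le by (intro sum_mono) (metis freq_nth of_int_abs of_int_le_iff)
  finally have "bracket \<xi> \<le> (1 + real CARD('n)) * of_int m"
    using \<open>m \<ge> 1\<close> by (simp add: bracket_def algebra_simps)
  then have A: "bracket \<xi> ^ p \<le> (1 + real CARD('n)) ^ p * of_int m ^ p"
    by (metis bracket_nonneg power_mono power_mult_distrib)
  have B: "norm (freq_power js \<xi>) \<le> of_int m ^ length js"
  proof (induction js)
    case (Cons j js)
    have "\<bar>real_of_int (\<xi> $ j)\<bar> \<le> of_int m" using le[of j] by linarith
    then show ?case using Cons \<open>m \<ge> 1\<close> by (auto simp: norm_mult intro!: mult_mono)
  qed simp
  have "bracket \<xi> ^ p * norm (freq_power js \<xi>) \<le> ((1 + real CARD('n)) ^ p * of_int m ^ p) * of_int m ^ length js"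
    using \<open>m \<ge> 1\<close> by (intro mult_mono A B) auto
  also have "\<dots> = (1 + real CARD('n)) ^ p * norm (freq_power (replicate (length js + p) i) \<xi>)"
    using i by (simp add: norm_mult norm_power power_add i[symmetric])
  finally show ?thesis by (intro exI[of _ "replicate (length js + p) i"]) auto
qed

text \<open>The exponent 2N gives two powers to each of the N coordinates:
  \<open>bracket \<xi>\<close> dominates every 1 + |\<xi>_j|, so the term is at most a product of
  one-dimensional terms 1 / (1 + |n|)^2, and the sum over a box factorises.\<close>

lemma summable_bracket:
  "(\<lambda>\<xi>::int^'n::finite. 1 / bracket \<xi> ^ (2 * CARD('n))) summable_on UNIV"
proof -
  define w :: "int \<Rightarrow> real" where "w n = 1 / (1 + \<bar>of_int n\<bar>)\<^sup>2" for n
  have w0: "0 \<le> w n" for n by (simp add: w_def)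
  obtain W where W: "\<And>R::nat. (\<Sum>n=-int R..int R. w n) \<le> W"
  proof -
    have S: "summable (\<lambda>n. 1 / (1 + real n)\<^sup>2)"
      using summable_Suc_iff[of "\<lambda>n. 1 / (real n)\<^sup>2"] inverse_power_summable[of 2, where 'a=real]
      by (simp add: inverse_eq_divide add.commute)
    have "(\<Sum>n=-int R..int R. w n) \<le> 2 * (\<Sum>n. 1 / (1 + real n)\<^sup>2)" for R :: nat
    proof -
      have "{-int R..int R} \<subseteq> int ` {..R} \<union> (\<lambda>n. - int n) ` {..R}"
      proof
        fix n assume "n \<in> {-int R..int R}"
        then have "n = int (nat n) \<and> nat n \<le> R \<or> n = - int (nat (-n)) \<and> nat (-n) \<le> R" by auto
        then show "n \<in> int ` {..R} \<union> (\<lambda>n. - int n) ` {..R}" by blast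
      qed
      then have "(\<Sum>n=-int R..int R. w n) \<le> sum w (int ` {..R} \<union> (\<lambda>n. - int n) ` {..R})"
        by (intro sum_mono2) (auto simp: w0)
      also have "\<dots> \<le> sum w (int ` {..R}) + sum w ((\<lambda>n. - int n) ` {..R})"
        by (subst sum_Un) (auto simp: w0 intro!: sum_nonneg)
      also have "\<dots> = 2 * (\<Sum>n\<le>R. 1 / (1 + real n)\<^sup>2)"
        by (subst (1 2) sum.reindex) (auto simp: inj_on_def w_def)
      also have "\<dots> \<le> 2 * (\<Sum>n. 1 / (1 + real n)\<^sup>2)"
        using S by (intro mult_left_mono sum_le_suminf) auto
      finally show ?thesis .
    qed
    then show thesis using that by blast
  qed
  have bd: "1 / bracket \<xi> ^ (2 * CARD('n)) \<le> (\<Prod>j\<in>UNIV. w (\<xi> $ j))" for \<xi> :: "int^'n"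
  proof -
    have "(\<Prod>j\<in>UNIV. (1 + \<bar>real_of_int (\<xi> $ j)\<bar>)\<^sup>2) \<le> (\<Prod>j\<in>(UNIV::'n set). bracket \<xi> ^ 2)"
      using abs_nth_le_bracket[of \<xi>] by (intro prod_mono) (auto intro!: power_mono simp: add.commute)
    also have "\<dots> = bracket \<xi> ^ (2 * CARD('n))" by (simp add: power_mult)
    finally have "1 / bracket \<xi> ^ (2 * CARD('n)) \<le> 1 / (\<Prod>j\<in>UNIV. (1 + \<bar>real_of_int (\<xi> $ j)\<bar>)\<^sup>2)"
      by (intro divide_left_mono mult_pos_pos prod_pos) (auto simp: add_pos_nonneg zero_less_power)
    then show ?thesis by (simp add: w_def prod_dividef)
  qed
  show ?thesis
  proof (rule nonneg_bdd_above_summable_on)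
    show "bdd_above (sum (\<lambda>\<xi>::int^'n. 1 / bracket \<xi> ^ (2 * CARD('n))) ` {F. F \<subseteq> UNIV \<and> finite F})"
    proof (intro bdd_aboveI[of _ "W ^ CARD('n)"], safe)
      fix F :: "(int^'n) set" assume F: "finite F"
      \<comment> \<open>Half the side of a box containing the finite set F; inserting 0 keeps
        \<open>Max\<close> meaningful for empty F.\<close>
      define R where "R = Max (insert 0 ((\<lambda>(\<xi>,j). nat \<bar>\<xi> $ j\<bar>) ` (F \<times> UNIV)))"
      have R: "nat \<bar>\<xi> $ j\<bar> \<le> R" if "\<xi> \<in> F" for \<xi> j
        unfolding R_def using F that by (intro Max_ge) auto
      have sub: "F \<subseteq> vec_lambda ` (PiE UNIV (\<lambda>_. {-int R..int R}))"
      proof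
        fix \<xi> assume "\<xi> \<in> F"
        have "\<xi> $ j \<in> {-int R..int R}" for j using R[OF \<open>\<xi> \<in> F\<close>, of j] by auto
        then have "vec_nth \<xi> \<in> PiE UNIV (\<lambda>_. {-int R..int R})" by auto
        then show "\<xi> \<in> vec_lambda ` (PiE UNIV (\<lambda>_. {-int R..int R}))"
          by (metis image_eqI vec_nth_inverse)
      qed
      have fin: "finite (PiE (UNIV::'n set) (\<lambda>_. {-int R..int R}))"
        by (intro finite_PiE) auto
      have "(\<Sum>\<xi>\<in>F. 1 / bracket \<xi> ^ (2 * CARD('n))) \<le> (\<Sum>\<xi>\<in>F. \<Prod>j\<in>UNIV. w (\<xi> $ j))"
        by (intro sum_mono bd)
      also have "\<dots> \<le> (\<Sum>\<xi>\<in>vec_lambda ` (PiE UNIV (\<lambda>_. {-int R..int R})). \<Prod>j\<in>(UNIV::'n set). w (\<xi> $ j))"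
        by (intro sum_mono2 finite_imageI fin sub prod_nonneg) (auto simp: w0)
      also have "\<dots> = (\<Sum>g\<in>PiE UNIV (\<lambda>_. {-int R..int R}). \<Prod>j\<in>(UNIV::'n set). w (g j))"
        by (subst sum.reindex) (auto simp: inj_on_def vec_lambda_inject)
      also have "\<dots> = (\<Prod>j\<in>(UNIV::'n set). \<Sum>n=-int R..int R. w n)"
        by (subst prod_sum_PiE) auto
      also have "\<dots> \<le> (\<Prod>j\<in>(UNIV::'n set). W)"
        by (intro prod_mono) (auto intro!: W sum_nonneg w0)
      finally show "(\<Sum>\<xi>\<in>F. 1 / bracket \<xi> ^ (2 * CARD('n))) \<le> W ^ CARD('n)" by simp
    qed
  qed auto
qed

subsection \<open>Fourier coefficients of periodic functions\<close>

definition torus_coeff :: "(real ^ 'n::finite \<Rightarrow> complex) \<Rightarrow> int ^ 'n \<Rightarrow> complex" where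
  "torus_coeff F \<xi> = integral cube (\<lambda>x. F x * wave (- \<xi>) x) / (2 * pi) ^ CARD('n)"

lemma cube_nonempty: "cube \<noteq> {}"
  using mem_cube[of 0] by auto

lemma content_cube: "measure lborel (cube :: (real ^ 'n::finite) set) = (2 * pi) ^ CARD('n)"
proof -
  have "(cube :: (real ^ 'n) set) \<noteq> {}" by (rule cube_nonempty)
  from content_cbox_cart[OF this[unfolded cube_def]]
  have "measure lborel (cube :: (real ^ 'n) set) = (\<Prod>i\<in>(UNIV :: 'n set). (\<chi> j. pi) $ i - (\<chi> j. - pi) $ i)"
    unfolding cube_def .
  also have "\<dots> = (2 * pi) ^ CARD('n)" by simp
  finally show ?thesis .
qed

lemma integrable_cube: "continuous_on UNIV F \<Longrightarrow> F integrable_on cube"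
  for F :: "real ^ 'n::finite \<Rightarrow> 'a::banach"
  unfolding cube_def by (rule integrable_continuous[OF continuous_on_subset]) auto

lemma integral_cube_bound:
  fixes F :: "real ^ 'n::finite \<Rightarrow> complex"
  assumes "continuous_on UNIV F" "\<And>x. norm (F x) \<le> B"
  shows "norm (integral cube F) \<le> B * (2 * pi) ^ CARD('n)"
proof -
  have "0 \<le> B" using order_trans[OF norm_ge_zero assms(2)[of 0]] .
  have "norm (integral cube F) \<le> B * measure lborel (cube :: (real ^ 'n) set)"
    unfolding cube_def by (rule has_integral_bound[OF \<open>0 \<le> B\<close> integrable_integral])
      (use assms integrable_cube[OF assms(1)] in \<open>auto simp: cube_def\<close>)
  then show ?thesis by (simp add: content_cube)
qed

text \<open>Cut the cube at x_j = -pi + h and the shifted cube at x_j = pi. They share one piece,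
  and the two remaining slabs are translates of each other by a period.\<close>

lemma integral_cube_shift_axis:
  fixes F :: "real ^ 'n::finite \<Rightarrow> complex"
  assumes F: "continuous_on UNIV F" "periodic F" and h: "0 \<le> h" "h \<le> 2 * pi"
  shows "integral cube (\<lambda>x. F (x + axis j h)) = integral cube F"
proof -
  define a b a' b' :: "real ^ 'n" where "a = (\<chi> i. - pi)" and "b = (\<chi> i. pi)"
    and "a' = (\<chi> i. if i = j then - pi + h else - pi)" and "b' = (\<chi> i. if i = j then - pi + h else pi)"
  have int: "F integrable_on cbox u v" for u v
    by (intro integrable_continuous continuous_on_subset[OF F(1)]) auto
  have ax: "axis j 1 \<in> (Basis :: (real ^ 'n) set)" by (auto simp: Basis_vec_def)
  have shift: "integral (cbox u v) (\<lambda>x. F (x + c)) = integral (cbox (u + c) (v + c)) F" for u v c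
    using integral_shift_cbox[of "u + c" c "v + c" F] by simp
  have axis_nth: "axis j c $ i = (if i = j then c else 0)" for i and c :: real by (simp add: axis_def)
  have mem: "x \<in> cbox u v \<longleftrightarrow> (u $ j \<le> x $ j \<and> x $ j \<le> v $ j) \<and> (\<forall>i. i \<noteq> j \<longrightarrow> u $ i \<le> x $ i \<and> x $ i \<le> v $ i)"
    for x u v :: "real ^ 'n"
    unfolding mem_box_cart by metis
  have 1: "integral (cbox a b) F = integral (cbox a b') F + integral (cbox a' b) F"
  proof -
    have "cbox a b \<inter> {x. x \<bullet> axis j 1 \<le> - pi + h} = cbox a b'"
      using h by (intro set_eqI) (auto simp: mem a_def b_def b'_def inner_axis)
    moreover have "cbox a b \<inter> {x. x \<bullet> axis j 1 \<ge> - pi + h} = cbox a' b"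
      using h by (intro set_eqI) (auto simp: mem a_def b_def a'_def inner_axis)
    ultimately show ?thesis using integral_split[OF int ax, of a b "- pi + h"] by simp
  qed
  have 2: "integral (cbox (a + axis j h) (b + axis j h)) F =
      integral (cbox a' b) F + integral (cbox (a + axis j (2 * pi)) (b' + axis j (2 * pi))) F"
  proof -
    have "cbox (a + axis j h) (b + axis j h) \<inter> {x. x \<bullet> axis j 1 \<le> pi} = cbox a' b"
      using h by (intro set_eqI) (auto simp: mem a_def b_def a'_def inner_axis axis_nth)
    moreover have "cbox (a + axis j h) (b + axis j h) \<inter> {x. x \<bullet> axis j 1 \<ge> pi} =
        cbox (a + axis j (2 * pi)) (b' + axis j (2 * pi))"
      using h by (intro set_eqI) (auto simp: mem a_def b_def b'_def inner_axis axis_nth)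
    ultimately show ?thesis
      using integral_split[OF int ax, of "a + axis j h" "b + axis j h" pi] by simp
  qed
  have "integral (cbox (a + axis j (2 * pi)) (b' + axis j (2 * pi))) F = integral (cbox a b') F"
    using F(2) by (subst shift[symmetric]) (simp add: periodic_def)
  then show ?thesis
    unfolding cube_def a_def[symmetric] b_def[symmetric] shift 1 2 by simp
qed

lemma periodic_translate: "periodic F \<Longrightarrow> periodic (\<lambda>x. F (x + y))"
  unfolding periodic_def by (metis (no_types) add.assoc add.commute)

lemma continuous_translate: "continuous_on UNIV F \<Longrightarrow> continuous_on UNIV (\<lambda>x. F (x + y))"
  for F :: "real ^ 'n::finite \<Rightarrow> 'a::topological_space"
  by (rule continuous_on_compose2[of UNIV F]) (auto intro!: continuous_intros)

text \<open>Modulo periods the translation has coordinates in [0, 2 pi], and it is then carried out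
  one axis at a time.\<close>

lemma integral_cube_translate:
  fixes F :: "real ^ 'n::finite \<Rightarrow> complex"
  assumes F: "continuous_on UNIV F" "periodic F"
  shows "integral cube (\<lambda>x. F (x + y)) = integral cube F"
proof -
  define k :: "int ^ 'n" where "k = (\<chi> j. - \<lfloor>y $ j / (2 * pi)\<rfloor>)"
  define z where "z = y + (2 * pi) *\<^sub>R freq k"
  have z: "0 \<le> z $ j \<and> z $ j \<le> 2 * pi" for j
  proof -
    have "z $ j = 2 * pi * (y $ j / (2 * pi) - of_int \<lfloor>y $ j / (2 * pi)\<rfloor>)"
      by (simp add: z_def k_def field_simps)
    moreover have "0 \<le> y $ j / (2 * pi) - of_int \<lfloor>y $ j / (2 * pi)\<rfloor>" "y $ j / (2 * pi) - of_int \<lfloor>y $ j / (2 * pi)\<rfloor> \<le> 1"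
      by linarith+
    ultimately show ?thesis
      by (metis mult_left_mono mult.right_neutral mult_nonneg_nonneg pi_ge_zero zero_le_numeral)
  qed
  have "F (x + y) = F (x + z)" for x
    using periodic_freq[OF F(2), of "x + y" k] by (simp add: z_def add.assoc)
  moreover have "integral cube (\<lambda>x. F (x + (\<Sum>j\<in>J. axis j (z $ j)))) = integral cube F" if "finite J" for J
    using that
  proof (induction J rule: finite_induct)
    case (insert j J)
    define w where "w = (\<Sum>j\<in>J. axis j (z $ j))"
    have eq: "x + (\<Sum>j\<in>insert j J. axis j (z $ j)) = (x + axis j (z $ j)) + w" for x
      using insert by (simp add: w_def add.assoc)
    show ?case unfolding eq
      using integral_cube_shift_axis[OF continuous_translate[OF F(1), of w] periodic_translate[OF F(2), of w], of "z $ j" j]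
        z[of j] insert.IH unfolding w_def by simp
  qed simp
  from this[of UNIV] have "integral cube (\<lambda>x. F (x + z)) = integral cube F"
  proof -
    have "(\<Sum>j\<in>UNIV. axis j (z $ j)) = z" by (simp add: vec_eq_iff axis_def)
    then show ?thesis using \<open>finite UNIV \<Longrightarrow> _\<close> by simp
  qed
  ultimately show ?thesis by simp
qed

text \<open>Integration by parts on the torus has no boundary terms: the integral of the translate
  of F along an axis is constant in the translation parameter, and its derivative at 0 is the
  integral of G.\<close>

lemma integral_cube_partial:
  fixes F :: "real ^ 'n::finite \<Rightarrow> complex"
  assumes F: "continuous_on UNIV F" "periodic F" and G: "has_partial j F G" "continuous_on UNIV G"
  shows "integral cube G = 0"
proof -
  have "((\<lambda>h. integral cube (\<lambda>x. F (x + h *\<^sub>R axis j 1))) has_vector_derivative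
      integral cube (\<lambda>x. G (x + 0 *\<^sub>R axis j 1))) (at 0 within (UNIV :: real set))"
    unfolding cube_def
  proof (rule leibniz_rule_vector_derivative)
    show "(\<lambda>x. F (x + h *\<^sub>R axis j 1)) integrable_on cbox (\<chi> j. - pi) (\<chi> j. pi)" for h
      using integrable_cube[OF continuous_translate[OF F(1)]] by (simp add: cube_def)
    show "continuous_on (UNIV \<times> cbox (\<chi> j. - pi) (\<chi> j. pi)) (\<lambda>(h, x). G (x + h *\<^sub>R axis j 1))"
      unfolding split_def by (rule continuous_on_compose2[OF G(2)]) (auto intro!: continuous_intros)
  qed (auto intro: has_partial_shift[OF G(1)])
  moreover have "(\<lambda>h. integral cube (\<lambda>x. F (x + h *\<^sub>R axis j 1))) = (\<lambda>h. integral cube F)"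
    using integral_cube_translate[OF F] by simp
  ultimately have "((\<lambda>h. integral cube F) has_vector_derivative integral cube G) (at (0::real))"
    by simp
  then show ?thesis by (metis has_vector_derivative_const vector_derivative_at)
qed

lemma periodic_mult: "periodic F \<Longrightarrow> periodic G \<Longrightarrow> periodic (\<lambda>x. F x * G x)"
  by (auto simp: periodic_def)

lemma torus_coeff_Dx_fun:
  assumes F: "continuous_on UNIV F" "periodic F" and G: "has_partial j F G" "continuous_on UNIV G"
  shows "torus_coeff (Dx_fun j F) \<xi> = of_int (\<xi> $ j) * torus_coeff F \<xi>"
proof -
  have "integral cube (\<lambda>x. F x * (\<i> * of_int ((- \<xi>) $ j) * wave (- \<xi>) x) + G x * wave (- \<xi>) x) = 0"
    by (rule integral_cube_partial[OF _ _ has_partial_mult[OF G(1) has_partial_wave]])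
      (intro F G periodic_mult periodic_wave continuous_intros continuous_wave)+
  moreover have "integral cube (\<lambda>x. F x * (\<i> * of_int ((- \<xi>) $ j) * wave (- \<xi>) x) + G x * wave (- \<xi>) x) =
     integral cube (\<lambda>x. (\<i> * of_int ((- \<xi>) $ j)) * (F x * wave (- \<xi>) x)) + integral cube (\<lambda>x. G x * wave (- \<xi>) x)"
    by (subst integral_add[symmetric]) (auto intro!: integrable_cube continuous_intros F G continuous_wave simp: mult_ac)
  ultimately have "integral cube (\<lambda>x. G x * wave (- \<xi>) x) = \<i> * of_int (\<xi> $ j) * integral cube (\<lambda>x. F x * wave (- \<xi>) x)"
    by (simp add: eq_neg_iff_add_eq_0 add.commute)
  moreover have "integral cube (\<lambda>x. Dx_fun j F x * wave (- \<xi>) x) = 1 / \<i> * integral cube (\<lambda>x. G x * wave (- \<xi>) x)"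
    unfolding Dx_fun_eq has_partial_partial[OF G(1)] by (subst integral_mult_right[symmetric]) (simp add: mult_ac)
  ultimately have "integral cube (\<lambda>x. Dx_fun j F x * wave (- \<xi>) x) = of_int (\<xi> $ j) * integral cube (\<lambda>x. F x * wave (- \<xi>) x)"
    by (simp add: mult.assoc[symmetric])
  then show ?thesis unfolding torus_coeff_def by simp
qed

lemma torus_coeff_D_fun:
  assumes "\<phi> \<in> test_functions"
  shows "torus_coeff (D_fun js \<phi>) \<xi> = freq_power js \<xi> * torus_coeff \<phi> \<xi>"
proof (induction js)
  case (Cons j js)
  have "torus_coeff (D_fun (j # js) \<phi>) \<xi> = of_int (\<xi> $ j) * torus_coeff (D_fun js \<phi>) \<xi>"
    unfolding D_fun_Cons
    by (rule torus_coeff_Dx_fun[OF test_continuous[OF assms] test_periodic[OF assms] test_has_partial[OF assms]])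
      (use test_continuous[OF test_partial[OF D_fun_test[OF assms]], of _ "[]"] in auto)
  then show ?case using Cons by simp
qed simp

lemma norm_torus_coeff_le:
  assumes "continuous_on UNIV F" "\<And>x. norm (F x) \<le> B"
  shows "norm (torus_coeff F \<xi>) \<le> B"
  unfolding torus_coeff_def norm_divide
  using integral_cube_bound[of "\<lambda>x. F x * wave (- \<xi>) x" B] assms continuous_wave[of UNIV "- \<xi>"]
  by (simp add: norm_mult continuous_on_mult divide_le_eq norm_power)

lemma torus_coeff_add:
  assumes "continuous_on UNIV F" "continuous_on UNIV G"
  shows "torus_coeff (\<lambda>x. F x + G x) \<xi> = torus_coeff F \<xi> + torus_coeff G \<xi>"
proof -
  have "integral cube (\<lambda>x. (F x + G x) * wave (- \<xi>) x) =
      integral cube (\<lambda>x. F x * wave (- \<xi>) x) + integral cube (\<lambda>x. G x * wave (- \<xi>) x)"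
    by (subst integral_add[symmetric])
      (auto intro!: integrable_cube continuous_intros assms continuous_wave simp: distrib_right)
  then show ?thesis by (simp add: torus_coeff_def add_divide_distrib)
qed

lemma torus_coeff_cmult: "torus_coeff (\<lambda>x. c * F x) \<xi> = c * torus_coeff F \<xi>"
  by (simp add: torus_coeff_def mult.assoc)

text \<open>Orthogonality without evaluating an integral: D_j multiplies the wave by \<xi>_j and its
  coefficient at \<eta> by \<eta>_j, so the coefficient vanishes as soon as these differ.\<close>

lemma torus_coeff_wave: "torus_coeff (wave \<xi>) \<eta> = (if \<xi> = \<eta> then 1 else 0)"
proof (cases "\<xi> = \<eta>")
  case True
  have "(\<lambda>x. wave \<eta> x * wave (- \<eta>) x) = (\<lambda>x. 1)"
    by (simp add: wave_add[symmetric])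
  then show ?thesis using True by (simp add: torus_coeff_def content_cube[unfolded cube_def] cube_def scaleR_conv_of_real)
next
  case False
  then obtain j where j: "\<xi> $ j \<noteq> \<eta> $ j" by (auto simp: vec_eq_iff)
  have "of_int (\<xi> $ j) * torus_coeff (wave \<xi>) \<eta> = of_int (\<eta> $ j) * torus_coeff (wave \<xi>) \<eta>"
    using torus_coeff_D_fun[of "wave \<xi>" "[j]" \<eta>] D_fun_wave[of "[j]" 1 \<xi>]
    by (simp add: torus_coeff_cmult)
  then show ?thesis using j False by simp
qed

text \<open>Decay of order k costs k derivatives: the powers of \<open>bracket\<close> become a
  monomial, hence the coefficient of a derivative, which is bounded by its supremum.\<close>

lemma bracket_torus_coeff_le:
  fixes \<phi> :: "real ^ 'n::finite \<Rightarrow> complex"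
  assumes "\<phi> \<in> test_functions"
  shows "bracket \<xi> ^ k * norm (torus_coeff \<phi> \<xi>) \<le> (1 + real CARD('n)) ^ k * C_seminorm k \<phi>"
proof -
  from bracket_power_freq_power[of "[]" k \<xi>] obtain ks where "length ks \<in> {length ([] :: 'n list), length ([] :: 'n list) + k}"
    and le: "bracket \<xi> ^ k * norm (freq_power [] \<xi>) \<le> (1 + real CARD('n)) ^ k * norm (freq_power ks \<xi>)"
    by (elim exE conjE)
  then have ks: "length ks \<le> k" by auto
  have "bracket \<xi> ^ k * norm (torus_coeff \<phi> \<xi>) \<le>
      (1 + real CARD('n)) ^ k * norm (freq_power ks \<xi>) * norm (torus_coeff \<phi> \<xi>)"
    using le by (intro mult_right_mono) auto
  also have "\<dots> = (1 + real CARD('n)) ^ k * norm (torus_coeff (D_fun ks \<phi>) \<xi>)"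
    by (simp add: torus_coeff_D_fun[OF assms] norm_mult)
  also have "\<dots> \<le> (1 + real CARD('n)) ^ k * C_seminorm k \<phi>"
    by (intro mult_left_mono norm_torus_coeff_le test_continuous norm_le_C_seminorm assms ks) auto
  finally show ?thesis .
qed

subsection \<open>Fourier inversion\<close>

text \<open>The kernel \<open>\<Prod>j. ((1 + cos x\<^sub>j) / 2) ^ M\<close> is a trigonometric polynomial, so it integrates
  to zero against \<open>F\<close>, while it concentrates at the origin as \<open>M\<close> grows.\<close>

lemma torus_coeff_zero_kernel:
  fixes F :: "real ^ 'n::finite \<Rightarrow> complex"
  assumes F: "continuous_on UNIV F" "\<And>\<xi>. torus_coeff F \<xi> = 0"
  shows "integral cube (\<lambda>x. F x * of_real (\<Prod>j\<in>UNIV. (1 + cos (x $ j)) / 2) ^ M) = 0"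
proof -
  \<comment> \<open>Multiplication by a wave only shifts the coefficients, so Z is stable under
    multiplication by every factor of the kernel, each being a combination of three waves.\<close>
  define Z where "Z = {G :: real ^ 'n \<Rightarrow> complex. continuous_on UNIV G \<and> (\<forall>\<xi>. torus_coeff G \<xi> = 0)}"
  have cos: "(\<lambda>x. G x * of_real ((1 + cos (x $ j)) / 2)) \<in> Z" if "G \<in> Z" for G j
  proof -
    have c: "continuous_on UNIV (\<lambda>x. G x * wave \<eta> x)" for \<eta>
      using that continuous_wave by (intro continuous_intros) (auto simp: Z_def)
    have 0: "torus_coeff (\<lambda>x. G x * wave \<eta> x) \<xi> = 0" for \<xi> \<eta>
    proof -
      have "torus_coeff (\<lambda>x. G x * wave \<eta> x) \<xi> = torus_coeff G (\<xi> - \<eta>)"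
        by (simp add: torus_coeff_def mult.assoc wave_add[symmetric])
      then show ?thesis using that by (simp add: Z_def)
    qed
    define e :: "int ^ 'n" where "e = axis j 1"
    have "x \<bullet> freq e = x $ j" for x
      using inner_axis[of x j 1] by (simp add: e_def freq_def axis_def if_distrib[of of_int] cong: if_cong)
    then have eq: "G x * of_real ((1 + cos (x $ j)) / 2) =
        1 / 2 * (G x * wave 0 x) + (1 / 4 * (G x * wave e x) + 1 / 4 * (G x * wave (- e) x))" for x
      by (simp add: wave_def cos_of_real[symmetric] cos_exp_eq field_simps)
    have c1: "continuous_on UNIV (\<lambda>x. k * (G x * wave \<eta> x))" for k \<eta>
      by (intro continuous_intros c)
    have c2: "continuous_on UNIV (\<lambda>x. k * (G x * wave \<eta> x) + k' * (G x * wave \<eta>' x))" for k \<eta> k' \<eta>'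
      by (intro continuous_intros c)
    have c3: "continuous_on UNIV (\<lambda>x. k * (G x * wave \<eta> x) + (k' * (G x * wave \<eta>' x) + k'' * (G x * wave \<eta>'' x)))" for k \<eta> k' \<eta>' k'' \<eta>''
      by (intro continuous_intros c)
    have "torus_coeff (\<lambda>x. 1 / 2 * (G x * wave 0 x) + (1 / 4 * (G x * wave e x) + 1 / 4 * (G x * wave (- e) x))) \<xi> = 0" for \<xi>
      unfolding torus_coeff_add[OF c1 c2] torus_coeff_add[OF c1 c1] torus_coeff_cmult 0 by simp
    with c3 show ?thesis unfolding Z_def eq by blast
  qed
  have prod: "(\<lambda>x. G x * of_real (\<Prod>j\<in>J. (1 + cos (x $ j)) / 2)) \<in> Z" if "finite J" "G \<in> Z" for G J
    using that
  proof (induction J rule: finite_induct)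
    case (insert j J)
    then show ?case using cos[of "\<lambda>x. G x * of_real (\<Prod>j\<in>J. (1 + cos (x $ j)) / 2)" j]
      by (simp add: mult_ac)
  qed simp
  have "(\<lambda>x. F x * of_real (\<Prod>j\<in>UNIV. (1 + cos (x $ j)) / 2) ^ M) \<in> Z"
  proof (induction M)
    case 0
    then show ?case using F by (simp add: Z_def)
  next
    case (Suc M)
    then show ?case using prod[OF finite Suc] by (simp add: mult_ac)
  qed
  then have "torus_coeff (\<lambda>x. F x * of_real (\<Prod>j\<in>UNIV. (1 + cos (x $ j)) / 2) ^ M) 0 = 0"
    by (simp add: Z_def)
  then show ?thesis by (simp add: torus_coeff_def)
qed

text \<open>If F 0 were not 0, then after multiplication by its conjugate the real part would be at
  least c near the origin. The kernel is at most q outside the small cube of half-side d and at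
  least q' > q on a smaller cube V. Since the weighted integral is 0, c |V| is bounded by a multiple
  of (q / q')^M, which tends to 0.\<close>

lemma torus_coeff_zero_at_0:
  fixes F :: "real ^ 'n::finite \<Rightarrow> complex"
  assumes F: "continuous_on UNIV F" "periodic F" "\<And>\<xi>. torus_coeff F \<xi> = 0"
  shows "F 0 = 0"
proof (rule ccontr)
  assume "F 0 \<noteq> 0"
  define G where "G x = cnj (F 0) * F x" for x
  have contG: "continuous_on UNIV G" unfolding G_def by (intro continuous_intros F)
  define c where "c = (norm (F 0))\<^sup>2 / 2"
  have "c > 0" using \<open>F 0 \<noteq> 0\<close> by (simp add: c_def)
  have G0: "Re (G 0) = 2 * c" by (simp add: G_def c_def complex_norm_square[symmetric] mult.commute[of "cnj _"] flip: of_real_power)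
  obtain B where B: "\<And>x. norm (G x) \<le> B"
    using norm_le_sup_norm[OF periodic_bounded[of G]] contG F(2) by (auto simp: G_def periodic_def)
  define \<kappa> :: "real ^ 'n \<Rightarrow> real" where "\<kappa> x = (\<Prod>j\<in>UNIV. (1 + cos (x $ j)) / 2)" for x
  have cont\<kappa>: "continuous_on UNIV \<kappa>"
    unfolding \<kappa>_def by (intro continuous_intros) auto
  have "0 \<le> (1 + cos t) / 2" for t :: real
    using cos_ge_minus_one[of t] by (intro divide_nonneg_nonneg) linarith+
  moreover have "(1 + cos t) / 2 \<le> 1" for t :: real
    using cos_le_one[of t] by (subst divide_le_eq_1_pos) auto
  ultimately have factor: "0 \<le> (1 + cos t) / 2" "(1 + cos t) / 2 \<le> 1" for t :: real by blast+
  have \<kappa>: "0 \<le> \<kappa> x" "\<kappa> x \<le> 1" for x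
    unfolding \<kappa>_def by (intro prod_nonneg prod_le_1 ballI; use factor in auto)+
  have "\<kappa> 0 = 1" by (simp add: \<kappa>_def)
  have small: "\<exists>d>0. d \<le> 1 \<and> (\<forall>x. (\<forall>j. \<bar>x $ j\<bar> \<le> d) \<longrightarrow> \<bar>f x - f 0\<bar> < e)"
    if fc: "continuous_on UNIV f" and e: "e > 0" for f :: "real ^ 'n \<Rightarrow> real" and e
  proof -
    obtain d where d: "d > 0" "\<And>x. dist x 0 < d \<Longrightarrow> dist (f x) (f 0) < e"
      using fc[unfolded continuous_on_iff, rule_format, of 0 e] e by auto
    define d' where "d' = min 1 (d / (2 * CARD('n)))"
    have "norm x < d" if "\<forall>j. \<bar>x $ j\<bar> \<le> d'" for x :: "real ^ 'n"
    proof -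
      have "norm x \<le> (\<Sum>j\<in>UNIV. \<bar>x $ j\<bar>)" by (rule norm_le_l1_cart)
      also have "\<dots> \<le> (\<Sum>j\<in>(UNIV::'n set). d / (2 * CARD('n)))"
        using that by (intro sum_mono) (simp add: d'_def)
      also have "\<dots> < d" using d(1) by simp
      finally show ?thesis .
    qed
    moreover have "d' > 0" "d' \<le> 1" using d(1) by (auto simp: d'_def)
    ultimately show ?thesis using d(2) by (intro exI[of _ d']) (auto simp: dist_norm)
  qed
  obtain d where d: "d > 0" "d \<le> 1" "\<And>x. (\<forall>j. \<bar>x $ j\<bar> \<le> d) \<Longrightarrow> \<bar>Re (G x) - Re (G 0)\<bar> < c"
    using small[of "\<lambda>x. Re (G x)" c] contG \<open>c > 0\<close> continuous_on_Re by blast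
  \<comment> \<open>If some |x_j| exceeds d, that factor of the kernel is at most q and the others
    are at most 1.\<close>
  define q where "q = (1 + cos d) / 2"
  have "cos d < 1" using cos_monotone_0_pi[of 0 d] d pi_gt3 by auto
  moreover have "cos d > 0" using cos_gt_zero_pi[of d] d pi_gt3 by auto
  ultimately have q: "0 < q" "q < 1" by (auto simp: q_def)
  obtain d' where d': "d' > 0" "d' \<le> 1" "\<And>x. (\<forall>j. \<bar>x $ j\<bar> \<le> d') \<Longrightarrow> \<bar>\<kappa> x - \<kappa> 0\<bar> < (1 - q) / 2"
    using small[OF cont\<kappa>, of "(1 - q) / 2"] q by auto
  define q' where "q' = (1 + q) / 2"
  have q': "q < q'" "0 < q'" using q by (auto simp: q'_def)
  define r where "r = min d d'"
  have r: "r > 0" "r \<le> 1" using d d' by (auto simp: r_def)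
  define V :: "(real ^ 'n) set" where "V = cbox (\<chi> j. - r) (\<chi> j. r)"
  have memV: "x \<in> V \<longleftrightarrow> (\<forall>j. \<bar>x $ j\<bar> \<le> r)" for x
    by (auto simp: V_def mem_box_cart abs_le_iff minus_le_iff)
  have "0 \<in> V" using r by (simp add: memV)
  then have contentV: "measure lborel V > 0"
    unfolding V_def using r by (subst content_cbox_cart) (auto intro!: prod_pos)
  have "V \<subseteq> cube" 
  proof
    fix x assume "x \<in> V"
    then have "\<bar>x $ j\<bar> \<le> r" for j by (simp add: memV)
    moreover have "r \<le> pi" using r pi_gt3 by linarith
    ultimately show "x \<in> cube" unfolding mem_cube by (meson order_trans)
  qed
  have key: "c * measure lborel V \<le> B * (2 * pi) ^ CARD('n) * (q / q') ^ M" for M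
  proof -
    \<comment> \<open>The added constant makes the integrand nonnegative on the whole cube,
      including the region where \<open>Re (G x)\<close> may be negative, so that its integral
      dominates the integral over V.\<close>
    define f where "f x = Re (G x) * \<kappa> x ^ M + B * q ^ M" for x
    have contf: "continuous_on X f" for X
      unfolding f_def by (intro continuous_intros continuous_on_subset[OF contG] continuous_on_subset[OF cont\<kappa>]) auto
    have "0 \<le> B" using order_trans[OF norm_ge_zero B[of 0]] .
    have f0: "0 \<le> f x" if "x \<in> cube" for x
    proof (cases "\<forall>j. \<bar>x $ j\<bar> \<le> d")
      case True
      then show ?thesis using d(3)[OF True] G0 \<open>0 \<le> B\<close> \<kappa>(1)[of x] q \<open>c > 0\<close>
        by (auto simp: f_def intro!: add_nonneg_nonneg mult_nonneg_nonneg)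
    next
      case False
      then obtain j where "\<not> \<bar>x $ j\<bar> \<le> d" by blast
      then have j: "d < \<bar>x $ j\<bar>" by (rule not_le_imp_less)
      have "\<bar>x $ j\<bar> \<le> pi" using that by (simp add: mem_cube)
      then have "cos \<bar>x $ j\<bar> \<le> cos d" using j d by (intro cos_monotone_0_pi_le) auto
      then have le_q: "(1 + cos (x $ j)) / 2 \<le> q" by (simp add: q_def)
      have "\<kappa> x = (1 + cos (x $ j)) / 2 * (\<Prod>j\<in>UNIV - {j}. (1 + cos (x $ j)) / 2)"
        unfolding \<kappa>_def by (rule prod.remove) auto
      also have "\<dots> \<le> (1 + cos (x $ j)) / 2"
        by (intro mult_left_le factor(1) prod_le_1) (use factor in blast)
      also note le_q
      finally have "\<kappa> x \<le> q" .
      then have "\<kappa> x ^ M \<le> q ^ M" using \<kappa>(1) by (intro power_mono) auto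
      moreover have "- Re (G x) \<le> B" using abs_Re_le_cmod[of "G x"] B[of x] by linarith
      ultimately have "- Re (G x) * \<kappa> x ^ M \<le> B * q ^ M"
        using \<open>0 \<le> B\<close> \<kappa>(1)[of x] by (intro mult_mono) auto
      then show ?thesis by (simp add: f_def)
    qed
    have fV: "c * q' ^ M \<le> f x" if "x \<in> V" for x
    proof -
      have "\<forall>j. \<bar>x $ j\<bar> \<le> d" "\<forall>j. \<bar>x $ j\<bar> \<le> d'" using that by (auto simp: memV r_def)
      then have "\<bar>Re (G x) - 2 * c\<bar> < c" "\<bar>\<kappa> x - 1\<bar> < (1 - q) / 2"
        using d(3)[of x] d'(3)[of x] G0 \<open>\<kappa> 0 = 1\<close> by simp_all
      then have "c \<le> Re (G x)" "(1 + q) / 2 \<le> \<kappa> x"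
        by (simp_all only: abs_less_iff) argo+
      then have "c \<le> Re (G x)" "q' \<le> \<kappa> x" by (simp_all only: q'_def)
      then have "c * q' ^ M \<le> Re (G x) * \<kappa> x ^ M"
        using \<open>c > 0\<close> q' by (intro mult_mono power_mono) auto
      then show ?thesis using \<open>0 \<le> B\<close> q by (simp add: f_def add_increasing2)
    qed
    have "c * q' ^ M * measure lborel V = integral V (\<lambda>x. c * q' ^ M)" by (simp add: V_def mult.commute)
    also have "\<dots> \<le> integral V f"
      unfolding V_def by (intro integral_le integrable_continuous contf fV[unfolded V_def]) auto
    also have "\<dots> \<le> integral cube f"
      using \<open>V \<subseteq> cube\<close> f0 integrable_cube[OF contf]
      by (intro integral_subset_le) (auto simp: V_def intro!: integrable_continuous contf)
    also have "integral cube f = integral cube (\<lambda>x. Re (G x) * \<kappa> x ^ M) + integral cube (\<lambda>x :: real ^ 'n. B * q ^ M)"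
      unfolding f_def
      by (intro integral_add integrable_cube continuous_intros contG cont\<kappa>)
    also have "integral cube (\<lambda>x. Re (G x) * \<kappa> x ^ M) = Re (integral cube (\<lambda>x. G x * of_real (\<kappa> x) ^ M))"
    proof -
      have "(\<lambda>x. G x * of_real (\<kappa> x) ^ M) integrable_on cube"
        by (intro integrable_cube continuous_intros contG cont\<kappa>)
      from integral_linear[OF this bounded_linear_Re] show ?thesis
        by (simp add: o_def flip: of_real_power)
    qed
    also have "integral cube (\<lambda>x. G x * of_real (\<kappa> x) ^ M) = cnj (F 0) * integral cube (\<lambda>x. F x * of_real (\<kappa> x) ^ M)"
      by (simp add: G_def mult.assoc)
    also have "\<dots> = 0" using torus_coeff_zero_kernel[OF F(1,3), of M] by (simp add: \<kappa>_def)
    also have "integral cube (\<lambda>x :: real ^ 'n. B * q ^ M) = B * q ^ M * (2 * pi) ^ CARD('n)"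
      using content_cube[where 'n = 'n] by (simp add: cube_def)
    finally have "c * q' ^ M * measure lborel V \<le> B * q ^ M * (2 * pi) ^ CARD('n)" by simp
    then show ?thesis using q' by (simp add: power_divide field_simps)
  qed
  define K where "K = B * (2 * pi) ^ CARD('n)"
  have "(\<lambda>M. K * (q / q') ^ M) \<longlonglongrightarrow> K * 0"
    using q q' by (intro tendsto_intros LIMSEQ_realpow_zero) auto
  then have "c * measure lborel V \<le> K * 0"
    by (rule LIMSEQ_le_const) (use key in \<open>auto simp: K_def\<close>)
  then show False using \<open>c > 0\<close> contentV by (simp add: mult_le_0_iff)
qed

text \<open>Translation by y multiplies each coefficient by \<open>wave \<xi> y\<close>, so y can be
  moved to the origin.\<close>

lemma torus_coeff_zero_imp_zero:
  assumes F: "continuous_on UNIV F" "periodic F" "\<And>\<xi>. torus_coeff F \<xi> = 0"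
  shows "F y = 0"
proof -
  have "torus_coeff (\<lambda>x. F (x + y)) \<xi> = 0" for \<xi>
  proof -
    have eq: "F (x + y) * wave (- \<xi>) x = wave \<xi> y * (F (x + y) * wave (- \<xi>) (x + y))" for x
    proof -
      have "wave \<xi> y * wave (- \<xi>) y = 1" using wave_add[of \<xi> "- \<xi>" y] by simp
      then show ?thesis by (simp add: wave_shift)
    qed
    have "integral cube (\<lambda>x. F (x + y) * wave (- \<xi>) (x + y)) = integral cube (\<lambda>x. F x * wave (- \<xi>) x)"
      by (intro integral_cube_translate[of "\<lambda>x. F x * wave (- \<xi>) x"] continuous_intros F continuous_wave periodic_mult periodic_wave)
    also have "\<dots> = 0" using F(3)[of \<xi>] by (simp add: torus_coeff_def)
    finally show ?thesis unfolding torus_coeff_def eq by simp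
  qed
  from torus_coeff_zero_at_0[OF continuous_translate[OF F(1)] periodic_translate[OF F(2)] this]
  show ?thesis by simp
qed

section \<open>Absolutely convergent Fourier series\<close>

lemma bracket_summableI:
  fixes a :: "int ^ 'n::finite \<Rightarrow> 'a::real_normed_vector"
  assumes "\<And>\<xi>. bracket \<xi> ^ (2 * CARD('n)) * norm (a \<xi>) \<le> C"
  shows "(\<lambda>\<xi>. norm (a \<xi>)) summable_on UNIV"
    and "(\<Sum>\<^sub>\<infinity>\<xi>. norm (a \<xi>)) \<le> C * (\<Sum>\<^sub>\<infinity>\<xi>::int^'n. 1 / bracket \<xi> ^ (2 * CARD('n)))"
proof -
  have le: "norm (a \<xi>) \<le> C * (1 / bracket \<xi> ^ (2 * CARD('n)))" for \<xi>
    using assms[of \<xi>] by (simp add: field_simps)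
  have s: "(\<lambda>\<xi>::int^'n. C * (1 / bracket \<xi> ^ (2 * CARD('n)))) summable_on UNIV"
    by (intro summable_on_cmult_right summable_bracket)
  show 1: "(\<lambda>\<xi>. norm (a \<xi>)) summable_on UNIV"
    by (rule summable_on_comparison_test[OF s]) (use le in auto)
  have "(\<Sum>\<^sub>\<infinity>\<xi>. norm (a \<xi>)) \<le> (\<Sum>\<^sub>\<infinity>\<xi>::int^'n. C * (1 / bracket \<xi> ^ (2 * CARD('n))))"
    by (intro infsum_mono 1 s le)
  then show "(\<Sum>\<^sub>\<infinity>\<xi>. norm (a \<xi>)) \<le> C * (\<Sum>\<^sub>\<infinity>\<xi>::int^'n. 1 / bracket \<xi> ^ (2 * CARD('n)))"
    by (simp only: infsum_cmult_right')
qed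

text \<open>The bound involves only the majorant g, hence is uniform in any parameter on which f
  depends. Below, this parameter is a point of the torus.\<close>

lemma infsum_tail_bound:
  fixes f :: "'a \<Rightarrow> complex"
  assumes g: "g summable_on UNIV" and le: "\<And>x. norm (f x) \<le> g x" and F: "finite F"
  shows "norm (infsum f UNIV - sum f F) \<le> infsum g UNIV - sum g F"
proof -
  have nf: "(\<lambda>x. norm (f x)) summable_on A" for A
    by (rule summable_on_comparison_test[OF summable_on_subset_banach[OF g]]) (use le in auto)
  have f: "f summable_on UNIV" by (rule abs_summable_summable[OF nf])
  have "infsum f UNIV - sum f F = infsum f (UNIV - F)"
    using infsum_Diff[OF f, of F] F by simp
  also have "norm \<dots> \<le> infsum (\<lambda>x. norm (f x)) (UNIV - F)"
    by (rule norm_infsum_bound[OF nf])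
  also have "\<dots> \<le> infsum g (UNIV - F)"
    by (intro infsum_mono nf summable_on_subset_banach[OF g] le) auto
  also have "\<dots> = infsum g UNIV - sum g F"
    using infsum_Diff[OF g, of F] F by simp
  finally show ?thesis .
qed

text \<open>By the Weierstrass test the partial sums converge uniformly. A coefficient is bounded by
  the sup norm, so the coefficients of the partial sums, known by orthogonality, converge to that of
  the limit.\<close>

lemma fourier_sum:
  fixes a :: "int ^ 'n::finite \<Rightarrow> complex"
  assumes a: "(\<lambda>\<xi>. norm (a \<xi>)) summable_on UNIV"
  defines "F \<equiv> \<lambda>x. \<Sum>\<^sub>\<infinity>\<xi>. a \<xi> * wave \<xi> x"
  shows "continuous_on UNIV F" "periodic F" "torus_coeff F \<eta> = a \<eta>"
proof -
  have u: "uniform_limit UNIV (\<lambda>X x. \<Sum>\<xi>\<in>X. a \<xi> * wave \<xi> x) F (finite_subsets_at_top UNIV)"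
    unfolding F_def by (rule Weierstrass_m_test_general[OF _ a]) (simp add: norm_mult)
  have cont: "continuous_on UNIV (\<lambda>x. \<Sum>\<xi>\<in>X. a \<xi> * wave \<xi> x)" for X
    by (intro continuous_intros continuous_wave)
  show contF: "continuous_on UNIV F"
    by (rule uniform_limit_theorem[OF _ u]) (simp_all add: cont)
  show "periodic F"
    using periodic_wave unfolding F_def periodic_def by (simp add: periodic_wave[unfolded periodic_def, rule_format])
  have tail: "norm (F x + (-1) * (\<Sum>\<xi>\<in>X. a \<xi> * wave \<xi> x)) \<le> (\<Sum>\<^sub>\<infinity>\<xi>. norm (a \<xi>)) - (\<Sum>\<xi>\<in>X. norm (a \<xi>))"
    if "finite X" for X x
    using infsum_tail_bound[OF a _ that, of "\<lambda>\<xi>. a \<xi> * wave \<xi> x"] by (simp add: F_def norm_mult)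
  have sum: "torus_coeff (\<lambda>x. \<Sum>\<xi>\<in>X. a \<xi> * wave \<xi> x) \<eta> = (\<Sum>\<xi>\<in>X. if \<xi> = \<eta> then a \<xi> else 0)" if "finite X" for X
    using that
  proof (induction X rule: finite_induct)
    case empty
    show ?case using torus_coeff_cmult[of 0 "\<lambda>x. 0" \<eta>] by simp
  next
    case (insert \<xi> X)
    have "torus_coeff (\<lambda>x. a \<xi> * wave \<xi> x + (\<Sum>\<xi>\<in>X. a \<xi> * wave \<xi> x)) \<eta> =
       torus_coeff (\<lambda>x. a \<xi> * wave \<xi> x) \<eta> + torus_coeff (\<lambda>x. \<Sum>\<xi>\<in>X. a \<xi> * wave \<xi> x) \<eta>"
      by (intro torus_coeff_add continuous_intros continuous_wave)
    then show ?case using insert by (auto simp: torus_coeff_cmult torus_coeff_wave)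
  qed
  have "norm (torus_coeff F \<eta> - (\<Sum>\<xi>\<in>X. if \<xi> = \<eta> then a \<xi> else 0)) \<le> (\<Sum>\<^sub>\<infinity>\<xi>. norm (a \<xi>)) - (\<Sum>\<xi>\<in>X. norm (a \<xi>))"
    if "finite X" for X
  proof -
    have "torus_coeff (\<lambda>x. F x + (-1) * (\<Sum>\<xi>\<in>X. a \<xi> * wave \<xi> x)) \<eta> = torus_coeff F \<eta> + (-1) * torus_coeff (\<lambda>x. \<Sum>\<xi>\<in>X. a \<xi> * wave \<xi> x) \<eta>"
      unfolding torus_coeff_cmult[symmetric] by (intro torus_coeff_add contF continuous_intros cont)
    moreover have "norm (torus_coeff (\<lambda>x. F x + (-1) * (\<Sum>\<xi>\<in>X. a \<xi> * wave \<xi> x)) \<eta>) \<le> (\<Sum>\<^sub>\<infinity>\<xi>. norm (a \<xi>)) - (\<Sum>\<xi>\<in>X. norm (a \<xi>))"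
      by (intro norm_torus_coeff_le continuous_intros contF cont tail that)
    ultimately show ?thesis using sum[OF that] by simp
  qed
  then have "\<forall>\<^sub>F X in finite_subsets_at_top UNIV. norm (torus_coeff F \<eta> - a \<eta>) \<le> (\<Sum>\<^sub>\<infinity>\<xi>. norm (a \<xi>)) - (\<Sum>\<xi>\<in>X. norm (a \<xi>))"
    unfolding eventually_finite_subsets_at_top
    by (intro exI[of _ "{\<eta>}"]) (fastforce simp: sum.delta')
  moreover have "((\<lambda>X. (\<Sum>\<^sub>\<infinity>\<xi>. norm (a \<xi>)) - (\<Sum>\<xi>\<in>X. norm (a \<xi>))) \<longlongrightarrow> (\<Sum>\<^sub>\<infinity>\<xi>. norm (a \<xi>)) - (\<Sum>\<^sub>\<infinity>\<xi>. norm (a \<xi>))) (finite_subsets_at_top UNIV)"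
    by (intro tendsto_intros infsum_tendsto a)
  ultimately have "norm (torus_coeff F \<eta> - a \<eta>) \<le> (\<Sum>\<^sub>\<infinity>\<xi>. norm (a \<xi>)) - (\<Sum>\<^sub>\<infinity>\<xi>. norm (a \<xi>))"
    by (intro tendsto_lowerbound) auto
  then show "torus_coeff F \<eta> = a \<eta>" by simp
qed

text \<open>Of the 2N + k derivatives, 2N pay for the summation over the lattice and k for the
  weight.\<close>

lemma summable_torus_coeff:
  fixes \<phi> :: "real ^ 'n::finite \<Rightarrow> complex"
  assumes "\<phi> \<in> test_functions"
  shows "(\<lambda>\<xi>. bracket \<xi> ^ k * norm (torus_coeff \<phi> \<xi>)) summable_on UNIV" (is ?A)
    and "(\<Sum>\<^sub>\<infinity>\<xi>. bracket \<xi> ^ k * norm (torus_coeff \<phi> \<xi>)) \<le> (1 + real CARD('n)) ^ (2 * CARD('n) + k) *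
      C_seminorm (2 * CARD('n) + k) \<phi> * (\<Sum>\<^sub>\<infinity>\<xi>::int^'n. 1 / bracket \<xi> ^ (2 * CARD('n)))" (is ?B)
proof -
  have le: "bracket \<xi> ^ (2 * CARD('n)) * norm (bracket \<xi> ^ k * norm (torus_coeff \<phi> \<xi>)) \<le>
      (1 + real CARD('n)) ^ (2 * CARD('n) + k) * C_seminorm (2 * CARD('n) + k) \<phi>" for \<xi>
    using bracket_torus_coeff_le[OF assms, of \<xi> "2 * CARD('n) + k"]
    by (simp add: power_add abs_mult mult.assoc)
  from bracket_summableI[OF this] show ?A ?B by (simp_all add: abs_mult)
qed

text \<open>The series and the function are continuous and periodic with the same coefficients, so
  their difference has only zero coefficients.\<close>

theorem fourier_inversion:
  assumes "\<phi> \<in> test_functions"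
  shows "\<phi> x = (\<Sum>\<^sub>\<infinity>\<xi>. torus_coeff \<phi> \<xi> * wave \<xi> x)"
proof -
  define \<psi> where "\<psi> x = (\<Sum>\<^sub>\<infinity>\<xi>. torus_coeff \<phi> \<xi> * wave \<xi> x)" for x
  have s: "(\<lambda>\<xi>. norm (torus_coeff \<phi> \<xi>)) summable_on UNIV"
    using summable_torus_coeff(1)[OF assms, of 0] by simp
  note \<psi> = fourier_sum[OF s, folded \<psi>_def]
  have \<phi>: "continuous_on UNIV \<phi>" "periodic \<phi>"
    using test_continuous[OF assms, of _ "[]"] test_periodic[OF assms, of "[]"] by auto
  have "\<phi> x + (-1) * \<psi> x = 0"
  proof (rule torus_coeff_zero_imp_zero)
    show "continuous_on UNIV (\<lambda>x. \<phi> x + (-1) * \<psi> x)" by (intro continuous_intros \<phi> \<psi>)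
    show "periodic (\<lambda>x. \<phi> x + (-1) * \<psi> x)" using \<phi>(2) \<psi>(2) by (simp add: periodic_def)
    show "torus_coeff (\<lambda>x. \<phi> x + (-1) * \<psi> x) \<xi> = 0" for \<xi>
    proof -
      have "torus_coeff (\<lambda>x. \<phi> x + (-1) * \<psi> x) \<xi> = torus_coeff \<phi> \<xi> + torus_coeff (\<lambda>x. (-1) * \<psi> x) \<xi>"
        by (intro torus_coeff_add continuous_intros \<phi> \<psi>)
      then show ?thesis by (simp only: torus_coeff_cmult \<psi>(3)) simp
    qed
  qed
  then show ?thesis by (simp add: \<psi>_def)
qed

subsection \<open>Distributions and their Fourier coefficients\<close>

lemma fourier_coeff_wave: "fourier_coeff u \<xi> = u (wave (- \<xi>))"
  by (simp add: fourier_coeff_def wave_minus_eq[abs_def] wave_def[abs_def])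

lemma distr_off: "u \<in> distributions \<Longrightarrow> \<phi> \<notin> test_functions \<Longrightarrow> u \<phi> = 0"
  and distr_add: "u \<in> distributions \<Longrightarrow> \<phi> \<in> test_functions \<Longrightarrow> \<psi> \<in> test_functions \<Longrightarrow>
    u (\<lambda>x. \<phi> x + \<psi> x) = u \<phi> + u \<psi>"
  and distr_cmult: "u \<in> distributions \<Longrightarrow> \<phi> \<in> test_functions \<Longrightarrow> u (\<lambda>x. c * \<phi> x) = c * u \<phi>"
  by (auto simp: distributions_def)

lemma distr_bound:
  assumes "u \<in> distributions"
  obtains C k where "C \<ge> 0" "\<And>\<phi>. \<phi> \<in> test_functions \<Longrightarrow> norm (u \<phi>) \<le> C * C_seminorm k \<phi>"
proof -
  obtain C k where *: "\<And>\<phi>. \<phi> \<in> test_functions \<Longrightarrow> norm (u \<phi>) \<le> C * C_seminorm k \<phi>"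
    using assms unfolding distributions_def by blast
  have "norm (u \<phi>) \<le> \<bar>C\<bar> * C_seminorm k \<phi>" if "\<phi> \<in> test_functions" for \<phi>
    using *[OF that] C_seminorm_nonneg[OF that, of k] by (meson abs_ge_self mult_right_mono order_trans)
  then show thesis using that[of "\<bar>C\<bar>" k] by simp
qed

lemma distr_sum:
  assumes u: "u \<in> distributions" and "finite I" "\<And>i. i \<in> I \<Longrightarrow> \<phi> i \<in> test_functions"
  shows "u (\<lambda>x. \<Sum>i\<in>I. \<phi> i x) = (\<Sum>i\<in>I. u (\<phi> i))"
  using assms(2,3)
proof (induction I rule: finite_induct)
  case empty
  show ?case using distr_cmult[OF u test_zero, of 0] by simp
next
  case (insert i I)
  then show ?case using distr_add[OF u, of "\<phi> i" "\<lambda>x. \<Sum>i\<in>I. \<phi> i x"] test_sum[of I \<phi>] by simp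
qed

lemma C_seminorm_mono:
  assumes "\<phi> \<in> test_functions" "k \<le> l"
  shows "C_seminorm k \<phi> \<le> C_seminorm l \<phi>"
  by (intro C_seminorm_le norm_le_C_seminorm assms) (use assms in auto)

lemma C_seminorm_wave_le: "C_seminorm k (wave \<xi>) \<le> bracket \<xi> ^ k"
proof (rule C_seminorm_le)
  fix js :: "'a list" and x assume "length js \<le> k"
  have "norm (D_fun js (wave \<xi>) x) \<le> bracket \<xi> ^ length js"
    using D_fun_wave[of js 1 \<xi>] norm_freq_power_le[of js \<xi>] by (simp add: norm_mult)
  also have "\<dots> \<le> bracket \<xi> ^ k"
    using \<open>length js \<le> k\<close> by (intro power_increasing bracket_ge_1) auto
  finally show "norm (D_fun js (wave \<xi>) x) \<le> bracket \<xi> ^ k" .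
qed

lemma fourier_coeff_bound:
  assumes "u \<in> distributions"
  obtains C k where "\<And>\<xi>. norm (fourier_coeff u \<xi>) \<le> C * bracket \<xi> ^ k"
proof -
  obtain C k where C: "C \<ge> 0" "\<And>\<phi>. \<phi> \<in> test_functions \<Longrightarrow> norm (u \<phi>) \<le> C * C_seminorm k \<phi>"
    using distr_bound[OF assms] by blast
  have "norm (fourier_coeff u \<xi>) \<le> C * bracket \<xi> ^ k" for \<xi>
    using C(2)[OF wave_test, of "- \<xi>"] mult_left_mono[OF C_seminorm_wave_le[of k "- \<xi>"] C(1)]
    by (simp add: fourier_coeff_wave)
  then show thesis using that by blast
qed

lemma distr_lincomb:
  assumes u: "u \<in> distributions" and v: "v \<in> distributions"
  shows "(\<lambda>\<phi>. a * u \<phi> + b * v \<phi>) \<in> distributions"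
proof -
  obtain C k where C: "C \<ge> 0" "\<And>\<phi>. \<phi> \<in> test_functions \<Longrightarrow> norm (u \<phi>) \<le> C * C_seminorm k \<phi>"
    using distr_bound[OF u] by blast
  obtain D l where D: "D \<ge> 0" "\<And>\<phi>. \<phi> \<in> test_functions \<Longrightarrow> norm (v \<phi>) \<le> D * C_seminorm l \<phi>"
    using distr_bound[OF v] by blast
  have "norm (a * u \<phi> + b * v \<phi>) \<le> (norm a * C + norm b * D) * C_seminorm (max k l) \<phi>" if "\<phi> \<in> test_functions" for \<phi>
  proof -
    have "norm (u \<phi>) \<le> C * C_seminorm (max k l) \<phi>"
      using C(2)[OF that] mult_left_mono[OF C_seminorm_mono[OF that, of k "max k l"] C(1)] by simp
    moreover have "norm (v \<phi>) \<le> D * C_seminorm (max k l) \<phi>"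
      using D(2)[OF that] mult_left_mono[OF C_seminorm_mono[OF that, of l "max k l"] D(1)] by simp
    moreover have "norm (a * u \<phi> + b * v \<phi>) \<le> norm a * norm (u \<phi>) + norm b * norm (v \<phi>)"
      by (metis norm_mult norm_triangle_ineq)
    ultimately show ?thesis
      using mult_left_mono[of "norm (u \<phi>)" _ "norm a"] mult_left_mono[of "norm (v \<phi>)" _ "norm b"]
      by (fastforce simp: algebra_simps)
  qed
  then have "\<exists>C k. \<forall>\<phi>\<in>test_functions. norm (a * u \<phi> + b * v \<phi>) \<le> C * C_seminorm k \<phi>"
    by blast
  then show ?thesis
    unfolding distributions_def mem_Collect_eq
    by (intro conjI allI ballI impI) (simp_all add: distr_off distr_add distr_cmult u v algebra_simps)
qed

lemma fourier_coeff_lincomb: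
  "fourier_coeff (\<lambda>\<phi>. a * u \<phi> + b * v \<phi>) \<xi> = a * fourier_coeff u \<xi> + b * fourier_coeff v \<xi>"
  by (simp add: fourier_coeff_def)

lemma diff_distr_lincomb: "diff_distr u v = (\<lambda>\<phi>. 1 * u \<phi> + (-1) * v \<phi>)"
  by (simp add: diff_distr_def)

lemma diff_distr [simp]: "u \<in> distributions \<Longrightarrow> v \<in> distributions \<Longrightarrow> diff_distr u v \<in> distributions"
  unfolding diff_distr_lincomb by (rule distr_lincomb)

lemma fourier_coeff_diff: "fourier_coeff (diff_distr u v) \<xi> = fourier_coeff u \<xi> - fourier_coeff v \<xi>"
  by (simp add: fourier_coeff_def diff_distr_def)

text \<open>Let k be the order of u. The partial sums of \<phi> converge to \<phi> in
  \<open>C_seminorm k\<close>, since a derivative of order at most k multiplies a coefficient by at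
  most \<open>bracket \<xi> ^ k\<close>; continuity of u then gives convergence of the pairings. The
  sign in -\<xi> comes from \<open>fourier_coeff\<close>, which evaluates u at the conjugate
  wave.\<close>

theorem distr_fourier_series:
  fixes u :: "'n::finite functional"
  assumes u: "u \<in> distributions" and \<phi>: "\<phi> \<in> test_functions"
  shows "((\<lambda>\<xi>. torus_coeff \<phi> \<xi> * fourier_coeff u (- \<xi>)) has_sum u \<phi>) UNIV"
proof -
  obtain C k where C: "C \<ge> 0" "\<And>\<phi>. \<phi> \<in> test_functions \<Longrightarrow> norm (u \<phi>) \<le> C * C_seminorm k \<phi>"
    using distr_bound[OF u] by blast
  define g where "g \<xi> = bracket \<xi> ^ k * norm (torus_coeff \<phi> \<xi>)" for \<xi>
  have g: "g summable_on UNIV" unfolding g_def by (rule summable_torus_coeff[OF \<phi>])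
  define S where "S X x = (\<Sum>\<xi>\<in>X. torus_coeff \<phi> \<xi> * wave \<xi> x)" for X x
  have le: "norm (u \<phi> - (\<Sum>\<xi>\<in>X. torus_coeff \<phi> \<xi> * fourier_coeff u (- \<xi>))) \<le> C * (infsum g UNIV - sum g X)"
    if X: "finite X" for X
  proof -
    have S: "S X \<in> test_functions"
      unfolding S_def[abs_def] by (intro test_sum X test_cmult wave_test)
    have "u (S X) = (\<Sum>\<xi>\<in>X. torus_coeff \<phi> \<xi> * fourier_coeff u (- \<xi>))"
      unfolding S_def[abs_def] by (subst distr_sum[OF u X]) (auto simp: distr_cmult[OF u] fourier_coeff_wave)
    then have eq: "u \<phi> - (\<Sum>\<xi>\<in>X. torus_coeff \<phi> \<xi> * fourier_coeff u (- \<xi>)) = u (\<lambda>x. \<phi> x + (-1) * S X x)"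
      using distr_add[OF u \<phi> test_cmult[OF S, of "-1"]] distr_cmult[OF u S, of "-1"] by simp
    have "C_seminorm k (\<lambda>x. \<phi> x + (-1) * S X x) \<le> infsum g UNIV - sum g X"
    proof (rule C_seminorm_le)
      fix js :: "'n list" and x assume js: "length js \<le> k"
      have "D_fun js (S X) x = (\<Sum>\<xi>\<in>X. torus_coeff (D_fun js \<phi>) \<xi> * wave \<xi> x)"
        unfolding S_def[abs_def]
        by (subst D_fun_sum) (auto simp: X D_fun_wave torus_coeff_D_fun[OF \<phi>])
      then have "D_fun js (\<lambda>x. \<phi> x + (-1) * S X x) x =
          (\<Sum>\<^sub>\<infinity>\<xi>. torus_coeff (D_fun js \<phi>) \<xi> * wave \<xi> x) - (\<Sum>\<xi>\<in>X. torus_coeff (D_fun js \<phi>) \<xi> * wave \<xi> x)"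
        using fourier_inversion[OF D_fun_test[OF \<phi>], of js x]
        by (simp only: D_fun_add[OF \<phi> test_cmult[OF S]] D_fun_cmult[OF S]) simp
      also have "norm \<dots> \<le> infsum g UNIV - sum g X"
      proof (rule infsum_tail_bound[OF g _ X])
        fix \<xi>
        have "norm (freq_power js \<xi>) \<le> bracket \<xi> ^ k"
          using norm_freq_power_le[of js \<xi>] power_increasing[OF js bracket_ge_1, of \<xi>] by linarith
        then show "norm (torus_coeff (D_fun js \<phi>) \<xi> * wave \<xi> x) \<le> g \<xi>"
          by (simp add: torus_coeff_D_fun[OF \<phi>] g_def norm_mult mult_right_mono)
      qed
      finally show "norm (D_fun js (\<lambda>x. \<phi> x + (-1) * S X x) x) \<le> infsum g UNIV - sum g X" .
    qed
    then show ?thesis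
      unfolding eq using C(2)[OF test_add[OF \<phi> test_cmult[OF S]]] mult_left_mono[OF _ C(1)] order_trans by blast
  qed
  have "((\<lambda>X. C * (infsum g UNIV - sum g X)) \<longlongrightarrow> C * (infsum g UNIV - infsum g UNIV)) (finite_subsets_at_top UNIV)"
    by (intro tendsto_intros infsum_tendsto g)
  then have lim: "((\<lambda>X. C * (infsum g UNIV - sum g X)) \<longlongrightarrow> 0) (finite_subsets_at_top UNIV)" by simp
  have "((\<lambda>X. u \<phi> - (\<Sum>\<xi>\<in>X. torus_coeff \<phi> \<xi> * fourier_coeff u (- \<xi>))) \<longlongrightarrow> 0) (finite_subsets_at_top UNIV)"
    by (rule Lim_null_comparison[OF _ lim])
      (auto simp: eventually_finite_subsets_at_top intro!: exI[of _ "{}"] le)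
  then have "((\<lambda>X. u \<phi> - (u \<phi> - (\<Sum>\<xi>\<in>X. torus_coeff \<phi> \<xi> * fourier_coeff u (- \<xi>)))) \<longlongrightarrow> u \<phi> - 0) (finite_subsets_at_top UNIV)"
    by (intro tendsto_intros)
  then show ?thesis by (simp add: has_sum_def)
qed

lemma distr_eqI:
  assumes "u \<in> distributions" "v \<in> distributions" "\<And>\<xi>. fourier_coeff u \<xi> = fourier_coeff v \<xi>"
  shows "u = v"
proof
  fix \<phi>
  show "u \<phi> = v \<phi>"
  proof (cases "\<phi> \<in> test_functions")
    case True
    then show ?thesis
      using distr_fourier_series[OF assms(1) True] distr_fourier_series[OF assms(2) True] assms(3)
      by (metis (no_types, lifting) has_sum_cong has_sum_unique)
  qed (simp add: assms distr_off)
qed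

section \<open>Distributions with prescribed coefficients, and Fourier multipliers\<close>

definition distr_of :: "(int ^ 'n \<Rightarrow> complex) \<Rightarrow> 'n::finite functional" where
  "distr_of a \<phi> = (if \<phi> \<in> test_functions then \<Sum>\<^sub>\<infinity>\<xi>. torus_coeff \<phi> \<xi> * a (- \<xi>) else 0)"

text \<open>Valid for every sequence a, whatever its growth: tested on a wave, the series has a
  single nonzero term.\<close>

lemma fourier_coeff_distr_of [simp]: "fourier_coeff (distr_of a) \<xi> = a \<xi>"
proof -
  have "(\<Sum>\<^sub>\<infinity>\<eta>. torus_coeff (wave (- \<xi>)) \<eta> * a (- \<eta>)) = a \<xi>"
  proof -
    have "(\<Sum>\<^sub>\<infinity>\<eta>. torus_coeff (wave (- \<xi>)) \<eta> * a (- \<eta>)) = (\<Sum>\<^sub>\<infinity>\<eta>\<in>{- \<xi>}. torus_coeff (wave (- \<xi>)) \<eta> * a (- \<eta>))"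
      by (intro infsum_cong_neutral) (auto simp: torus_coeff_wave)
    then show ?thesis by (simp add: torus_coeff_wave)
  qed
  then show ?thesis by (simp add: fourier_coeff_wave distr_of_def)
qed

text \<open>The second claim keeps the constant explicit, because \<open>sobolev_pairing\<close>
  applies it with a constant C proportional to the norm of the functional.\<close>

lemma distr_of_distribution:
  fixes a :: "int ^ 'n::finite \<Rightarrow> complex"
  assumes a: "\<And>\<xi>. norm (a \<xi>) \<le> C * bracket \<xi> ^ k"
  shows "distr_of a \<in> distributions"
    and "\<phi> \<in> test_functions \<Longrightarrow> norm (distr_of a \<phi>) \<le> C * (1 + real CARD('n)) ^ (2 * CARD('n) + k) *
      (\<Sum>\<^sub>\<infinity>\<xi>::int^'n. 1 / bracket \<xi> ^ (2 * CARD('n))) * C_seminorm (2 * CARD('n) + k) \<phi>"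
proof -
  have le: "norm (torus_coeff \<phi> \<xi> * a (- \<xi>)) \<le> C * (bracket \<xi> ^ k * norm (torus_coeff \<phi> \<xi>))" for \<phi> \<xi>
    using mult_left_mono[OF a[of "- \<xi>"], of "norm (torus_coeff \<phi> \<xi>)"] by (simp add: norm_mult mult_ac)
  have g: "(\<lambda>\<xi>. C * (bracket \<xi> ^ k * norm (torus_coeff \<phi> \<xi>))) summable_on UNIV" if "\<phi> \<in> test_functions" for \<phi>
    by (intro summable_on_cmult_right summable_torus_coeff that)
  have abs: "(\<lambda>\<xi>. norm (torus_coeff \<phi> \<xi> * a (- \<xi>))) summable_on UNIV" if "\<phi> \<in> test_functions" for \<phi>
    by (rule summable_on_comparison_test[OF g[OF that]]) (use le in auto)
  have s: "(\<lambda>\<xi>. torus_coeff \<phi> \<xi> * a (- \<xi>)) summable_on UNIV" if "\<phi> \<in> test_functions" for \<phi>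
    by (rule abs_summable_summable[OF abs[OF that]])
  have "0 \<le> C * bracket (0 :: int ^ 'n) ^ k" using order_trans[OF norm_ge_zero a[of 0]] .
  then have C: "0 \<le> C" by (simp add: bracket_def)
  show bound: "norm (distr_of a \<phi>) \<le> C * (1 + real CARD('n)) ^ (2 * CARD('n) + k) *
      (\<Sum>\<^sub>\<infinity>\<xi>::int^'n. 1 / bracket \<xi> ^ (2 * CARD('n))) * C_seminorm (2 * CARD('n) + k) \<phi>" if "\<phi> \<in> test_functions" for \<phi>
  proof -
    have "norm (distr_of a \<phi>) \<le> (\<Sum>\<^sub>\<infinity>\<xi>. norm (torus_coeff \<phi> \<xi> * a (- \<xi>)))"
      using norm_infsum_bound[OF abs[OF that]] that by (simp add: distr_of_def)
    also have "\<dots> \<le> (\<Sum>\<^sub>\<infinity>\<xi>. C * (bracket \<xi> ^ k * norm (torus_coeff \<phi> \<xi>)))"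
      by (intro infsum_mono abs g that le)
    also have "\<dots> = C * (\<Sum>\<^sub>\<infinity>\<xi>. bracket \<xi> ^ k * norm (torus_coeff \<phi> \<xi>))"
      by (simp only: infsum_cmult_right')
    also have "\<dots> \<le> C * ((1 + real CARD('n)) ^ (2 * CARD('n) + k) *
        C_seminorm (2 * CARD('n) + k) \<phi> * (\<Sum>\<^sub>\<infinity>\<xi>::int^'n. 1 / bracket \<xi> ^ (2 * CARD('n))))"
      by (intro mult_left_mono summable_torus_coeff that C)
    finally show ?thesis by (simp add: mult_ac)
  qed
  have cont: "continuous_on UNIV \<phi>" if "\<phi> \<in> test_functions" for \<phi> :: "real ^ 'n \<Rightarrow> complex"
    using test_continuous[OF that, of _ "[]"] by simp
  show "distr_of a \<in> distributions"
    unfolding distributions_def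
  proof (intro CollectI conjI ballI allI impI)
    show "\<exists>C k. \<forall>\<phi>\<in>test_functions. norm (distr_of a \<phi>) \<le> C * C_seminorm k \<phi>"
      using bound by blast
    show "distr_of a (\<lambda>x. \<phi> x + \<psi> x) = distr_of a \<phi> + distr_of a \<psi>"
      if "\<phi> \<in> test_functions" "\<psi> \<in> test_functions" for \<phi> \<psi>
      using that infsum_add[OF s[OF that(1)] s[OF that(2)]]
      by (simp add: distr_of_def torus_coeff_add cont distrib_right)
    show "distr_of a (\<lambda>x. c * \<phi> x) = c * distr_of a \<phi>" if "\<phi> \<in> test_functions" for c \<phi>
      using that by (simp add: distr_of_def torus_coeff_cmult mult.assoc infsum_cmult_right')
  qed (simp add: distr_of_def)
qed

lemma distr_of_fourier_coeff:
  assumes "u \<in> distributions"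
  shows "distr_of (fourier_coeff u) = u"
proof -
  obtain C k where "\<And>\<xi>. norm (fourier_coeff u \<xi>) \<le> C * bracket \<xi> ^ k"
    using fourier_coeff_bound[OF assms] by blast
  from distr_of_distribution(1)[OF this] assms show ?thesis
    by (rule distr_eqI) simp
qed

definition multiplier :: "(int ^ 'n \<Rightarrow> complex) \<Rightarrow> 'n::finite functional \<Rightarrow> 'n functional" where
  "multiplier m u = distr_of (\<lambda>\<xi>. m \<xi> * fourier_coeff u \<xi>)"

lemma fourier_coeff_multiplier [simp]: "fourier_coeff (multiplier m u) \<xi> = m \<xi> * fourier_coeff u \<xi>"
  by (simp add: multiplier_def)

lemma multiplier_distribution [simp]:
  assumes "u \<in> distributions" "\<And>\<xi>. norm (m \<xi>) \<le> L * bracket \<xi> ^ p"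
  shows "multiplier m u \<in> distributions"
proof -
  obtain C k where C: "\<And>\<xi>. norm (fourier_coeff u \<xi>) \<le> C * bracket \<xi> ^ k"
    using fourier_coeff_bound[OF assms(1)] by blast
  have "norm (m \<xi> * fourier_coeff u \<xi>) \<le> (L * C) * bracket \<xi> ^ (p + k)" for \<xi>
    using mult_mono'[OF assms(2)[of \<xi>] C[of \<xi>]] by (simp add: norm_mult power_add mult_ac)
  then show ?thesis unfolding multiplier_def by (rule distr_of_distribution)
qed

subsection \<open>Sobolev spaces\<close>

text \<open>The square root of the summand in the Sobolev norm, so that the norm is a supremum of
  \<open>L2_set\<close> over finite sets and inherits its triangle inequality.\<close>

definition sobolev_weight :: "real \<Rightarrow> 'n::finite functional \<Rightarrow> int ^ 'n \<Rightarrow> real" where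
  "sobolev_weight r u \<xi> = norm (fourier_coeff u \<xi>) * bracket \<xi> powr r"

lemma sobolev_weight_square:
  "(sobolev_weight r u \<xi>)\<^sup>2 = (norm (fourier_coeff u \<xi>))\<^sup>2 * (1 + norm (freq \<xi>)) powr (2 * r)"
proof -
  have "(bracket \<xi> powr r)\<^sup>2 = bracket \<xi> powr (2 * r)"
    by (simp add: powr_power mult.commute)
  then show ?thesis by (simp add: sobolev_weight_def power_mult_distrib bracket_def)
qed

lemma sobolev_weight_nonneg [simp]: "0 \<le> sobolev_weight r u \<xi>"
  by (simp add: sobolev_weight_def)

lemma sobolev_iff:
  "u \<in> sobolev r \<longleftrightarrow> u \<in> distributions \<and> (\<lambda>\<xi>. (sobolev_weight r u \<xi>)\<^sup>2) summable_on UNIV"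
  by (simp add: sobolev_def sobolev_weight_square)

lemma sobolev_norm_eq: "sobolev_norm r u = sqrt (\<Sum>\<^sub>\<infinity>\<xi>. (sobolev_weight r u \<xi>)\<^sup>2)"
  by (simp add: sobolev_norm_def sobolev_weight_square)

lemma sobolev_norm_nonneg [simp]: "0 \<le> sobolev_norm r u"
  by (simp add: sobolev_norm_eq infsum_nonneg)

lemma sobolev_distributions: "u \<in> sobolev r \<Longrightarrow> u \<in> distributions"
  by (simp add: sobolev_iff)

lemma L2_set_le_sobolev_norm:
  assumes "u \<in> sobolev r" "finite X"
  shows "L2_set (sobolev_weight r u) X \<le> sobolev_norm r u"
  unfolding L2_set_def sobolev_norm_eq using assms
  by (intro real_sqrt_le_mono finite_sum_le_infsum) (auto simp: sobolev_iff)

text \<open>Membership and the norm bound are obtained together from finite sets of frequencies; the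
  estimates below therefore never handle infinite sums of squares.\<close>

lemma sobolevI_L2_set:
  assumes "u \<in> distributions" "0 \<le> B" "\<And>X. finite X \<Longrightarrow> L2_set (sobolev_weight r u) X \<le> B"
  shows "u \<in> sobolev r" "sobolev_norm r u \<le> B"
proof -
  have le: "(\<Sum>\<xi>\<in>X. (sobolev_weight r u \<xi>)\<^sup>2) \<le> B\<^sup>2" if "finite X" for X
    using assms(3)[OF that] unfolding L2_set_def by (rule sqrt_le_D)
  have s: "(\<lambda>\<xi>. (sobolev_weight r u \<xi>)\<^sup>2) summable_on UNIV"
    by (rule nonneg_bdd_above_summable_on) (auto intro!: bdd_aboveI[of _ "B\<^sup>2"] le)
  then show "u \<in> sobolev r" using assms(1) by (simp add: sobolev_iff)
  have "(\<Sum>\<^sub>\<infinity>\<xi>. (sobolev_weight r u \<xi>)\<^sup>2) \<le> B\<^sup>2"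
    by (rule infsum_le_finite_sums[OF s]) (use le in auto)
  then show "sobolev_norm r u \<le> B"
    unfolding sobolev_norm_eq using assms(2) by (simp add: real_le_lsqrt)
qed

lemma sobolev_compare:
  assumes u: "u \<in> sobolev r" and v: "v \<in> distributions" and "0 \<le> L"
    and le: "\<And>\<xi>. sobolev_weight r' v \<xi> \<le> L * sobolev_weight r u \<xi>"
  shows "v \<in> sobolev r'" "sobolev_norm r' v \<le> L * sobolev_norm r u"
proof -
  have "L2_set (sobolev_weight r' v) X \<le> L * sobolev_norm r u" if "finite X" for X
  proof -
    have "L2_set (sobolev_weight r' v) X \<le> L2_set (\<lambda>\<xi>. L * sobolev_weight r u \<xi>) X"
      by (intro L2_set_mono le) auto
    also have "\<dots> = L * L2_set (sobolev_weight r u) X"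
      by (rule L2_set_right_distrib[OF \<open>0 \<le> L\<close>, symmetric])
    also have "\<dots> \<le> L * sobolev_norm r u"
      by (intro mult_left_mono L2_set_le_sobolev_norm u that \<open>0 \<le> L\<close>)
    finally show ?thesis .
  qed
  from sobolevI_L2_set[OF v _ this] \<open>0 \<le> L\<close>
  show "v \<in> sobolev r'" "sobolev_norm r' v \<le> L * sobolev_norm r u" by auto
qed

lemma sobolev_lincomb:
  assumes u: "u \<in> sobolev r" and v: "v \<in> sobolev r"
  shows "(\<lambda>\<phi>. a * u \<phi> + b * v \<phi>) \<in> sobolev r"
    and "sobolev_norm r (\<lambda>\<phi>. a * u \<phi> + b * v \<phi>) \<le> norm a * sobolev_norm r u + norm b * sobolev_norm r v"
proof -
  let ?w = "\<lambda>\<phi>. a * u \<phi> + b * v \<phi>"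
  have "L2_set (sobolev_weight r ?w) X \<le> norm a * sobolev_norm r u + norm b * sobolev_norm r v"
    if "finite X" for X
  proof -
    have "sobolev_weight r ?w \<xi> \<le> norm a * sobolev_weight r u \<xi> + norm b * sobolev_weight r v \<xi>" for \<xi>
    proof -
      have "norm (a * fourier_coeff u \<xi> + b * fourier_coeff v \<xi>) \<le>
          norm a * norm (fourier_coeff u \<xi>) + norm b * norm (fourier_coeff v \<xi>)"
        by (metis norm_mult norm_triangle_ineq)
      from mult_right_mono[OF this, of "bracket \<xi> powr r"] show ?thesis
        by (simp add: sobolev_weight_def fourier_coeff_lincomb algebra_simps)
    qed
    then have "L2_set (sobolev_weight r ?w) X \<le>
        L2_set (\<lambda>\<xi>. norm a * sobolev_weight r u \<xi> + norm b * sobolev_weight r v \<xi>) X"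
      by (intro L2_set_mono) auto
    also have "\<dots> \<le> L2_set (\<lambda>\<xi>. norm a * sobolev_weight r u \<xi>) X + L2_set (\<lambda>\<xi>. norm b * sobolev_weight r v \<xi>) X"
      by (rule L2_set_triangle_ineq)
    also have "\<dots> = norm a * L2_set (sobolev_weight r u) X + norm b * L2_set (sobolev_weight r v) X"
      by (simp add: L2_set_right_distrib)
    also have "\<dots> \<le> norm a * sobolev_norm r u + norm b * sobolev_norm r v"
      by (intro add_mono mult_left_mono L2_set_le_sobolev_norm u v that) auto
    finally show ?thesis .
  qed
  from sobolevI_L2_set[OF distr_lincomb[OF u[THEN sobolev_distributions] v[THEN sobolev_distributions]] _ this]
  show "?w \<in> sobolev r" "sobolev_norm r ?w \<le> norm a * sobolev_norm r u + norm b * sobolev_norm r v" by auto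
qed

lemma sobolev_diff [simp]: "u \<in> sobolev r \<Longrightarrow> v \<in> sobolev r \<Longrightarrow> diff_distr u v \<in> sobolev r"
  unfolding diff_distr_lincomb by (rule sobolev_lincomb)

lemma fourier_coeff_le_sobolev_norm:
  assumes "u \<in> sobolev r"
  shows "norm (fourier_coeff u \<xi>) * bracket \<xi> powr r \<le> sobolev_norm r u"
  using L2_set_le_sobolev_norm[OF assms, of "{\<xi>}"] by (simp add: sobolev_weight_def)

lemma sobolev_norm_diff_self [simp]: "sobolev_norm r (diff_distr u u) = 0"
  by (simp add: sobolev_norm_eq sobolev_weight_def fourier_coeff_diff)

lemma sobolev_metric: "Metric_space (sobolev r) (\<lambda>u v. sobolev_norm r (diff_distr u v))"
proof
  show "sobolev_norm r (diff_distr u v) = sobolev_norm r (diff_distr v u)" for u v :: "'a functional"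
    by (simp add: sobolev_norm_eq sobolev_weight_def fourier_coeff_diff norm_minus_commute)
  show "sobolev_norm r (diff_distr u v) = 0 \<longleftrightarrow> u = v" if "u \<in> sobolev r" "v \<in> sobolev r" for u v :: "'a functional"
  proof
    assume 0: "sobolev_norm r (diff_distr u v) = 0"
    have "fourier_coeff u \<xi> = fourier_coeff v \<xi>" for \<xi>
      using fourier_coeff_le_sobolev_norm[OF sobolev_diff[OF that], of \<xi>]
      by (simp add: 0 fourier_coeff_diff mult_le_0_iff)
    then show "u = v" using that by (intro distr_eqI) (auto simp: sobolev_iff)
  qed simp
  show "sobolev_norm r (diff_distr u w) \<le> sobolev_norm r (diff_distr u v) + sobolev_norm r (diff_distr v w)"
    if "u \<in> sobolev r" "v \<in> sobolev r" "w \<in> sobolev r" for u v w :: "'a functional"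
  proof -
    have "diff_distr u w = (\<lambda>\<phi>. 1 * diff_distr u v \<phi> + 1 * diff_distr v w \<phi>)"
      by (simp add: diff_distr_def)
    then show ?thesis
      using sobolev_lincomb(2)[OF sobolev_diff[OF that(1,2)] sobolev_diff[OF that(2,3)], of 1 1] by simp
  qed
qed simp

lemma topspace_sobolev [simp]: "topspace (sobolev_topology r) = sobolev r"
  unfolding sobolev_topology_def by (rule Metric_space.topspace_mtopology[OF sobolev_metric])

text \<open>Turns continuity at t for an abstract target topology into a statement about a filter.
  The filter is punctured, hence the separate condition at t.\<close>

lemma ex_openin_iff_eventually:
  assumes "t \<in> S"
  shows "(\<exists>U. openin (top_of_set S) U \<and> t \<in> U \<and> (\<forall>y\<in>U. P y)) \<longleftrightarrow> P t \<and> (\<forall>\<^sub>F y in at t within S. P y)"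
proof
  assume "\<exists>U. openin (top_of_set S) U \<and> t \<in> U \<and> (\<forall>y\<in>U. P y)"
  then obtain U where U: "open U" "t \<in> S \<inter> U" "\<forall>y\<in>S \<inter> U. P y" by (auto simp: openin_open)
  then show "P t \<and> (\<forall>\<^sub>F y in at t within S. P y)"
    by (auto simp: eventually_at_topological intro!: exI[of _ U])
next
  assume "P t \<and> (\<forall>\<^sub>F y in at t within S. P y)"
  then obtain U where U: "P t" "open U" "t \<in> U" "\<And>y. y \<in> U \<Longrightarrow> y \<noteq> t \<Longrightarrow> y \<in> S \<Longrightarrow> P y"
    unfolding eventually_at_topological by blast
  show "\<exists>U. openin (top_of_set S) U \<and> t \<in> U \<and> (\<forall>y\<in>U. P y)"
  proof (intro exI[of _ "S \<inter> U"] conjI ballI)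
    show "openin (top_of_set S) (S \<inter> U)" using U by (auto simp: openin_open)
    show "P y" if "y \<in> S \<inter> U" for y using that U by (cases "y = t") auto
  qed (use U assms in auto)
qed

lemma continuous_into_sobolev:
  "continuous_into T (sobolev_topology r) u \<longleftrightarrow> (\<forall>t\<in>{0..T}. u t \<in> sobolev r) \<and>
     (\<forall>t\<in>{0..T}. \<forall>e>0. \<forall>\<^sub>F \<tau> in at t within {0..T}. sobolev_norm r (diff_distr (u \<tau>) (u t)) < e)"
  (is "_ \<longleftrightarrow> ?A \<and> ?B")
proof -
  interpret Metric_space "sobolev r :: 'a functional set" "\<lambda>u v. sobolev_norm r (diff_distr u v)"
    by (rule sobolev_metric)
  have sym: "sobolev_norm r (diff_distr u v) = sobolev_norm r (diff_distr v u)" for u v :: "'a functional"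
    by (rule commute)
  have "continuous_into T (sobolev_topology r) u \<longleftrightarrow>
      (\<forall>t\<in>{0..T}. \<forall>e>0. \<exists>U. openin (top_of_set {0..T}) U \<and> t \<in> U \<and> (\<forall>y\<in>U. u y \<in> mball (u t) e))"
    unfolding continuous_into_def sobolev_topology_def continuous_map_to_metric by simp
  also have "\<dots> \<longleftrightarrow> (\<forall>t\<in>{0..T}. \<forall>e>0. u t \<in> mball (u t) e \<and> (\<forall>\<^sub>F \<tau> in at t within {0..T}. u \<tau> \<in> mball (u t) e))"
    by (intro ball_cong refl all_cong imp_cong ex_openin_iff_eventually)
  also have "\<dots> \<longleftrightarrow> ?A \<and> ?B"
  proof (intro iffI conjI)
    assume *: "\<forall>t\<in>{0..T}. \<forall>e>0. u t \<in> mball (u t) e \<and> (\<forall>\<^sub>F \<tau> in at t within {0..T}. u \<tau> \<in> mball (u t) e)"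
    then show ?A using zero_less_one unfolding in_mball by blast
    from * show ?B
      by (auto elim!: eventually_mono simp: in_mball sym)
  next
    assume AB: "?A \<and> ?B"
    show "\<forall>t\<in>{0..T}. \<forall>e>0. u t \<in> mball (u t) e \<and> (\<forall>\<^sub>F \<tau> in at t within {0..T}. u \<tau> \<in> mball (u t) e)"
    proof (intro ballI allI impI conjI)
      fix t e :: real assume t: "t \<in> {0..T}" and e: "e > 0"
      show "u t \<in> mball (u t) e" using AB t e by (simp add: in_mball)
      have "\<forall>\<^sub>F \<tau> in at t within {0..T}. sobolev_norm r (diff_distr (u \<tau>) (u t)) < e" using AB t e by blast
      moreover have "\<forall>\<^sub>F \<tau> in at t within {0..T}. \<tau> \<in> {0..T}" by (auto simp: eventually_at_filter)
      ultimately show "\<forall>\<^sub>F \<tau> in at t within {0..T}. u \<tau> \<in> mball (u t) e"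
        by eventually_elim (use AB t in \<open>simp add: in_mball sym\<close>)
    qed
  qed
  finally show ?thesis .
qed

lemma sobolev_embedding:
  assumes "u \<in> sobolev r" "r' \<le> r"
  shows "u \<in> sobolev r'" "sobolev_norm r' u \<le> sobolev_norm r u"
proof -
  have "sobolev_weight r' u \<xi> \<le> 1 * sobolev_weight r u \<xi>" for \<xi>
    using assms(2) bracket_ge_1[of \<xi>] by (auto simp: sobolev_weight_def intro!: mult_left_mono powr_mono)
  from sobolev_compare[OF assms(1) sobolev_distributions[OF assms(1)] _ this]
  show "u \<in> sobolev r'" "sobolev_norm r' u \<le> sobolev_norm r u" by auto
qed

text \<open>The constants depend only on r and the dimension. Uniformity in u allows the estimate to
  be applied to differences of values of a curve, and to all its values at once.\<close>

lemma sobolev_pairing: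
  obtains K k where "K \<ge> 0"
    "\<And>(u :: 'n::finite functional) \<phi>. u \<in> sobolev r \<Longrightarrow> \<phi> \<in> test_functions \<Longrightarrow>
       norm (u \<phi>) \<le> sobolev_norm r u * K * C_seminorm k \<phi>"
proof -
  \<comment> \<open>The coefficients are bounded by the norm times
    \<open>bracket \<xi> powr (- r)\<close>; k is a natural exponent above -r.\<close>
  define k where "k = nat \<lceil>\<bar>r\<bar>\<rceil>"
  define K where "K = (1 + real CARD('n)) ^ (2 * CARD('n) + k) *
      (\<Sum>\<^sub>\<infinity>\<xi>::int^'n. 1 / bracket \<xi> ^ (2 * CARD('n)))"
  have "K \<ge> 0" unfolding K_def by (intro mult_nonneg_nonneg infsum_nonneg) auto
  moreover have "norm (u \<phi>) \<le> sobolev_norm r u * K * C_seminorm (2 * CARD('n) + k) \<phi>"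
    if u: "u \<in> sobolev r" and \<phi>: "\<phi> \<in> test_functions" for u :: "'n functional" and \<phi>
  proof -
    have "norm (fourier_coeff u \<xi>) \<le> sobolev_norm r u * bracket \<xi> ^ k" for \<xi>
    proof -
      have "- r \<le> real k" unfolding k_def by linarith
      then have "bracket \<xi> powr (- r) \<le> bracket \<xi> powr real k"
        by (intro powr_mono bracket_ge_1)
      then have le: "bracket \<xi> powr (- r) \<le> bracket \<xi> ^ k" by (simp add: powr_realpow)
      have "norm (fourier_coeff u \<xi>) = (norm (fourier_coeff u \<xi>) * bracket \<xi> powr r) * bracket \<xi> powr (- r)"
        by (simp add: mult.assoc powr_add[symmetric])
      also have "\<dots> \<le> sobolev_norm r u * bracket \<xi> ^ k"
        by (intro mult_mono fourier_coeff_le_sobolev_norm u le) auto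
      finally show ?thesis .
    qed
    from distr_of_distribution(2)[OF this \<phi>] show ?thesis
      unfolding distr_of_fourier_coeff[OF sobolev_distributions[OF u]] K_def by (simp add: mult_ac)
  qed
  ultimately show thesis using that by blast
qed

lemma distr_diff_apply: "diff_distr u v \<phi> = u \<phi> - v \<phi>"
  by (simp add: diff_distr_def)

lemma continuous_into_sobolev_apply:
  assumes u: "continuous_into T (sobolev_topology r) (u :: real \<Rightarrow> 'n::finite functional)" and \<phi>: "\<phi> \<in> test_functions"
  shows "continuous_on {0..T} (\<lambda>t. u t \<phi>)"
  unfolding continuous_on_def
proof
  obtain K k where K: "K \<ge> 0" "\<And>(u :: 'n functional) \<phi>. u \<in> sobolev r \<Longrightarrow> \<phi> \<in> test_functions \<Longrightarrow>
       norm (u \<phi>) \<le> sobolev_norm r u * K * C_seminorm k \<phi>"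
    using sobolev_pairing[where ?'n = 'n and r = r] by blast
  define c where "c = K * C_seminorm k \<phi>"
  have mem: "u t \<in> sobolev r" if "t \<in> {0..T}" for t using u that by (simp add: continuous_into_sobolev)
  fix t assume t: "t \<in> {0..T}"
  have "((\<lambda>\<tau>. sobolev_norm r (diff_distr (u \<tau>) (u t))) \<longlongrightarrow> 0) (at t within {0..T})"
    unfolding tendsto_iff dist_real_def using u t by (simp add: continuous_into_sobolev)
  then have "((\<lambda>\<tau>. sobolev_norm r (diff_distr (u \<tau>) (u t)) * c) \<longlongrightarrow> 0 * c) (at t within {0..T})"
    by (intro tendsto_intros)
  then have lim: "((\<lambda>\<tau>. sobolev_norm r (diff_distr (u \<tau>) (u t)) * c) \<longlongrightarrow> 0) (at t within {0..T})" by simp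
  have "\<forall>\<^sub>F \<tau> in at t within {0..T}. \<tau> \<in> {0..T}" by (auto simp: eventually_at_filter)
  then have "\<forall>\<^sub>F \<tau> in at t within {0..T}. norm (u \<tau> \<phi> - u t \<phi>) \<le> sobolev_norm r (diff_distr (u \<tau>) (u t)) * c"
  proof eventually_elim
    case (elim \<tau>)
    show ?case using K(2)[OF sobolev_diff[OF mem[OF elim] mem[OF t]] \<phi>]
      by (simp add: distr_diff_apply c_def mult_ac)
  qed
  from Lim_null_comparison[OF this lim] show "((\<lambda>\<tau>. u \<tau> \<phi>) \<longlongrightarrow> u t \<phi>) (at t within {0..T})"
    by (simp add: LIM_zero_iff)
qed

text \<open>The norm along the curve is continuous on a compact interval, hence bounded, and
  \<open>sobolev_pairing\<close> converts this into a common order for all times.\<close>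

lemma continuous_into_sobolev_bound:
  assumes u: "continuous_into T (sobolev_topology r) (u :: real \<Rightarrow> 'n::finite functional)"
  obtains C k where "C \<ge> 0" "\<And>t \<phi>. t \<in> {0..T} \<Longrightarrow> \<phi> \<in> test_functions \<Longrightarrow> norm (u t \<phi>) \<le> C * C_seminorm k \<phi>"
proof -
  obtain K k where K: "K \<ge> 0" "\<And>(u :: 'n functional) \<phi>. u \<in> sobolev r \<Longrightarrow> \<phi> \<in> test_functions \<Longrightarrow>
       norm (u \<phi>) \<le> sobolev_norm r u * K * C_seminorm k \<phi>"
    using sobolev_pairing[where ?'n = 'n and r = r] by blast
  have mem: "u t \<in> sobolev r" if "t \<in> {0..T}" for t using u that by (simp add: continuous_into_sobolev)
  have tri: "sobolev_norm r v \<le> sobolev_norm r w + sobolev_norm r (diff_distr v w)"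
    if "v \<in> sobolev r" "w \<in> sobolev r" for v w :: "'n functional"
  proof -
    have "v = (\<lambda>\<phi>. 1 * w \<phi> + 1 * diff_distr v w \<phi>)" by (simp add: diff_distr_def)
    then show ?thesis using sobolev_lincomb(2)[OF that(2) sobolev_diff[OF that], of 1 1] by simp
  qed
  have "continuous_on {0..T} (\<lambda>t. sobolev_norm r (u t))"
    unfolding continuous_on_def tendsto_iff
  proof (intro ballI allI impI)
    fix t e :: real assume t: "t \<in> {0..T}" and "0 < e"
    then have "\<forall>\<^sub>F \<tau> in at t within {0..T}. sobolev_norm r (diff_distr (u \<tau>) (u t)) < e"
      using u by (simp add: continuous_into_sobolev)
    moreover have "\<forall>\<^sub>F \<tau> in at t within {0..T}. \<tau> \<in> {0..T}" by (auto simp: eventually_at_filter)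
    ultimately show "\<forall>\<^sub>F \<tau> in at t within {0..T}. dist (sobolev_norm r (u \<tau>)) (sobolev_norm r (u t)) < e"
    proof eventually_elim
      case (elim \<tau>)
      have "sobolev_norm r (diff_distr (u t) (u \<tau>)) = sobolev_norm r (diff_distr (u \<tau>) (u t))"
        by (rule Metric_space.commute[OF sobolev_metric])
      then show ?case
        using tri[OF mem[OF elim(2)] mem[OF t]] tri[OF mem[OF t] mem[OF elim(2)]] elim(1)
        by (simp add: dist_real_def)
    qed
  qed
  then have "compact ((\<lambda>t. sobolev_norm r (u t)) ` {0..T})" by (intro compact_continuous_image) auto
  then obtain B where B: "B > 0" "\<And>t. t \<in> {0..T} \<Longrightarrow> sobolev_norm r (u t) \<le> B"
  proof -
    assume *: "\<And>B. B > 0 \<Longrightarrow> (\<And>t. t \<in> {0..T} \<Longrightarrow> sobolev_norm r (u t) \<le> B) \<Longrightarrow> thesis"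
    obtain B where "B > 0" "\<forall>x \<in> (\<lambda>t. sobolev_norm r (u t)) ` {0..T}. norm x \<le> B"
      using compact_imp_bounded[OF \<open>compact _\<close>] unfolding bounded_pos by blast
    then show thesis by (intro *[of B]) auto
  qed
  have "norm (u t \<phi>) \<le> (B * K) * C_seminorm k \<phi>" if "t \<in> {0..T}" "\<phi> \<in> test_functions" for t \<phi>
  proof -
    have "norm (u t \<phi>) \<le> sobolev_norm r (u t) * (K * C_seminorm k \<phi>)"
      using K(2)[OF mem[OF that(1)] that(2)] by (simp add: mult_ac)
    also have "\<dots> \<le> B * (K * C_seminorm k \<phi>)"
      by (intro mult_right_mono B that mult_nonneg_nonneg K C_seminorm_nonneg)
    finally show ?thesis by (simp add: mult_ac)
  qed
  with K(1) B(1) show thesis using that[of "B * K" k] by simp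
qed

subsection \<open>Time dependent multipliers\<close>

text \<open>The bound on the size is weaker than boundedness, but it has the same form as the bound
  on the increments, so that a single mapping property serves for both. The power 2 is the order of
  the spatial operators.\<close>

definition lipschitz_multiplier :: "real \<Rightarrow> real \<Rightarrow> (real \<Rightarrow> int ^ 'n::finite \<Rightarrow> complex) \<Rightarrow> bool" where
  "lipschitz_multiplier T L m \<longleftrightarrow> (\<forall>t\<in>{0..T}. \<forall>\<xi>. norm (m t \<xi>) \<le> L * bracket \<xi> ^ 2) \<and>
     (\<forall>t\<in>{0..T}. \<forall>\<tau>\<in>{0..T}. \<forall>\<xi>. norm (m \<tau> \<xi> - m t \<xi>) \<le> L * \<bar>\<tau> - t\<bar> * bracket \<xi> ^ 2)"

lemma lipschitz_multiplier_nonneg: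
  assumes "lipschitz_multiplier T L (m :: real \<Rightarrow> int ^ 'n::finite \<Rightarrow> complex)" "0 \<le> T"
  shows "0 \<le> L"
proof -
  have "norm (m 0 0) \<le> L * bracket (0 :: int ^ 'n) ^ 2"
    using assms by (auto simp: lipschitz_multiplier_def)
  from order_trans[OF norm_ge_zero this] show ?thesis by (simp add: bracket_def)
qed

lemma sobolev_multiplier:
  assumes u: "u \<in> sobolev r" and m: "\<And>\<xi>. norm (m \<xi>) \<le> L * bracket \<xi> ^ 2" and "0 \<le> L"
  shows "multiplier m u \<in> sobolev (r - 2)"
    and "sobolev_norm (r - 2) (multiplier m u) \<le> L * sobolev_norm r u"
proof -
  have "sobolev_weight (r - 2) (multiplier m u) \<xi> \<le> L * sobolev_weight r u \<xi>" for \<xi>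
  proof -
    have "bracket \<xi> powr r = bracket \<xi> ^ 2 * bracket \<xi> powr (r - 2)"
      using powr_add[of "bracket \<xi>" 2 "r - 2"] by simp
    then show ?thesis
      using mult_right_mono[OF m[of \<xi>], of "norm (fourier_coeff u \<xi>) * bracket \<xi> powr (r - 2)"]
      by (simp add: sobolev_weight_def norm_mult mult_ac)
  qed
  from sobolev_compare[OF u multiplier_distribution[OF sobolev_distributions[OF u] m] \<open>0 \<le> L\<close> this]
  show "multiplier m u \<in> sobolev (r - 2)"
    "sobolev_norm (r - 2) (multiplier m u) \<le> L * sobolev_norm r u" .
qed

text \<open>The usual splitting m u - n v = m (u - v) + (m - n) v. The free factor c is 1 for norms;
  with c = 2 the right side is a half-and-half combination, under which an absolutely convex
  neighbourhood is closed.\<close>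

lemma multiplier_diff_split:
  assumes u: "u \<in> distributions" "v \<in> distributions"
    and m: "\<And>\<xi>. norm (m \<xi>) \<le> L * bracket \<xi> ^ p" "\<And>\<xi>. norm (n \<xi>) \<le> L * bracket \<xi> ^ p"
    and c: "c \<noteq> 0"
  shows "diff_distr (multiplier m u) (multiplier n v) =
    (\<lambda>\<phi>. 1 / c * multiplier (\<lambda>\<xi>. c * m \<xi>) (diff_distr u v) \<phi> + 1 / c * multiplier (\<lambda>\<xi>. c * (m \<xi> - n \<xi>)) v \<phi>)"
proof (rule distr_eqI)
  have 1: "norm (c * m \<xi>) \<le> (norm c * L) * bracket \<xi> ^ p" for \<xi>
    using mult_left_mono[OF m(1), of "norm c"] by (simp add: norm_mult mult_ac)
  have 2: "norm (c * (m \<xi> - n \<xi>)) \<le> (norm c * (2 * L)) * bracket \<xi> ^ p" for \<xi>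
  proof -
    have "norm (m \<xi> - n \<xi>) \<le> 2 * L * bracket \<xi> ^ p"
      using norm_triangle_ineq4[of "m \<xi>" "n \<xi>"] m[of \<xi>] by linarith
    from mult_left_mono[OF this, of "norm c"] show ?thesis by (simp add: norm_mult mult_ac)
  qed
  show "diff_distr (multiplier m u) (multiplier n v) \<in> distributions"
    by (intro diff_distr multiplier_distribution[OF u(1) m(1)] multiplier_distribution[OF u(2) m(2)])
  show "(\<lambda>\<phi>. 1 / c * multiplier (\<lambda>\<xi>. c * m \<xi>) (diff_distr u v) \<phi> + 1 / c * multiplier (\<lambda>\<xi>. c * (m \<xi> - n \<xi>)) v \<phi>) \<in> distributions"
    by (intro distr_lincomb multiplier_distribution[OF diff_distr[OF u] 1] multiplier_distribution[OF u(2) 2])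
qed (use c in \<open>simp only: fourier_coeff_diff fourier_coeff_lincomb fourier_coeff_multiplier, simp add: field_simps\<close>)

text \<open>In the splitting of the increment, the first term is small by continuity of u and the
  second by the Lipschitz bound applied to the fixed element \<open>u t\<close>.\<close>

lemma continuous_into_sobolev_multiplier:
  assumes u: "continuous_into T (sobolev_topology r) u" and m: "lipschitz_multiplier T L m" and "0 \<le> T"
  shows "continuous_into T (sobolev_topology (r - 2)) (\<lambda>t. multiplier (m t) (u t))"
  unfolding continuous_into_sobolev
proof (intro conjI ballI allI impI)
  have L: "0 \<le> L" by (rule lipschitz_multiplier_nonneg[OF m \<open>0 \<le> T\<close>])
  have mem: "u t \<in> sobolev r" if "t \<in> {0..T}" for t using u that by (simp add: continuous_into_sobolev)
  have mb: "norm (m t \<xi>) \<le> L * bracket \<xi> ^ 2" if "t \<in> {0..T}" for t \<xi>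
    using m that by (simp add: lipschitz_multiplier_def)
  fix t assume t: "t \<in> {0..T}"
  show "multiplier (m t) (u t) \<in> sobolev (r - 2)" by (rule sobolev_multiplier[OF mem[OF t] mb[OF t] L])
  fix e :: real assume "e > 0"
  have "((\<lambda>\<tau>. sobolev_norm r (diff_distr (u \<tau>) (u t))) \<longlongrightarrow> 0) (at t within {0..T})"
    unfolding tendsto_iff dist_real_def using u t by (simp add: continuous_into_sobolev)
  then have "((\<lambda>\<tau>. L * sobolev_norm r (diff_distr (u \<tau>) (u t)) + L * \<bar>\<tau> - t\<bar> * sobolev_norm r (u t)) \<longlongrightarrow>
      L * 0 + L * \<bar>t - t\<bar> * sobolev_norm r (u t)) (at t within {0..T})"
    by (intro tendsto_intros)
  then have "\<forall>\<^sub>F \<tau> in at t within {0..T}. L * sobolev_norm r (diff_distr (u \<tau>) (u t)) + L * \<bar>\<tau> - t\<bar> * sobolev_norm r (u t) < e"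
    using \<open>e > 0\<close> by (intro order_tendstoD(2)[where y = 0]) auto
  moreover have "\<forall>\<^sub>F \<tau> in at t within {0..T}. \<tau> \<in> {0..T}" by (auto simp: eventually_at_filter)
  ultimately show "\<forall>\<^sub>F \<tau> in at t within {0..T}.
      sobolev_norm (r - 2) (diff_distr (multiplier (m \<tau>) (u \<tau>)) (multiplier (m t) (u t))) < e"
  proof eventually_elim
    case (elim \<tau>)
    have d: "norm (m \<tau> \<xi> - m t \<xi>) \<le> (L * \<bar>\<tau> - t\<bar>) * bracket \<xi> ^ 2" for \<xi>
      using m t elim(2) by (simp add: lipschitz_multiplier_def)
    note A = sobolev_multiplier[OF sobolev_diff[OF mem[OF elim(2)] mem[OF t]] mb[OF elim(2)] L]
    note B = sobolev_multiplier[OF mem[OF t] d]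
    have "sobolev_norm (r - 2) (diff_distr (multiplier (m \<tau>) (u \<tau>)) (multiplier (m t) (u t))) \<le>
        sobolev_norm (r - 2) (multiplier (m \<tau>) (diff_distr (u \<tau>) (u t))) +
        sobolev_norm (r - 2) (multiplier (\<lambda>\<xi>. m \<tau> \<xi> - m t \<xi>) (u t))"
      using sobolev_lincomb(2)[OF A(1) B(1), of 1 1] L
        multiplier_diff_split[OF mem[OF elim(2), THEN sobolev_distributions] mem[OF t, THEN sobolev_distributions]
          mb[OF elim(2)] mb[OF t], of 1]
      by simp
    also have "\<dots> \<le> L * sobolev_norm r (diff_distr (u \<tau>) (u t)) + L * \<bar>\<tau> - t\<bar> * sobolev_norm r (u t)"
      using A(2) B(2) L by (intro add_mono) auto
    finally show ?case using elim(1) by simp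
  qed
qed

subsection \<open>The space of smooth functions\<close>

lemma topspace_smooth [simp]: "topspace smooth_topology = smooth"
proof -
  have "openin (sobolev_topology 0) (sobolev 0 :: 'a functional set)"
    by (metis openin_topspace topspace_sobolev)
  moreover have "(sobolev 0 :: 'a functional set) \<inter> smooth = smooth" by (auto simp: smooth_def)
  ultimately have "(smooth :: 'a functional set) \<in> {U \<inter> smooth | U. \<exists>r. openin (sobolev_topology r) U}"
    by blast
  then show ?thesis
    unfolding smooth_topology_def topology_generated_by_topspace by blast
qed

text \<open>The universal property of an initial topology.\<close>

lemma continuous_into_smooth:
  fixes u :: "real \<Rightarrow> 'n::finite functional"
  shows "continuous_into T smooth_topology u \<longleftrightarrow> (\<forall>r. continuous_into T (sobolev_topology r) u)"
proof
  assume u: "continuous_into T smooth_topology u"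
  then have mem: "u ` {0..T} \<subseteq> smooth"
    using continuous_map_image_subset_topspace[of "top_of_set {0..T}" smooth_topology u]
    by (simp add: continuous_into_def)
  show "\<forall>r. continuous_into T (sobolev_topology r) u"
  proof
    fix r
    have "openin (top_of_set {0..T}) {x \<in> {0..T}. u x \<in> U}" if "openin (sobolev_topology r) U" for U
    proof -
      have "openin smooth_topology (U \<inter> smooth)"
        unfolding smooth_topology_def using that by (intro topology_generated_by_Basis) blast
      then have "openin (top_of_set {0..T}) {x \<in> {0..T}. u x \<in> U \<inter> smooth}"
        using u unfolding continuous_into_def continuous_map_def topspace_euclidean_subtopology by blast
      moreover have "{x \<in> {0..T}. u x \<in> U \<inter> smooth} = {x \<in> {0..T}. u x \<in> U}" using mem by auto
      ultimately show ?thesis by simp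
    qed
    then show "continuous_into T (sobolev_topology r) u"
      using mem by (auto simp: continuous_into_def continuous_map_def smooth_def)
  qed
next
  assume u: "\<forall>r. continuous_into T (sobolev_topology r) u"
  then have mem: "u ` {0..T} \<subseteq> smooth" by (auto simp: continuous_into_sobolev smooth_def)
  show "continuous_into T smooth_topology u"
    unfolding continuous_into_def smooth_topology_def continuous_on_generated_topo_iff
  proof (intro conjI allI impI)
    show "u ` topspace (top_of_set {0..T}) \<subseteq> \<Union> {U \<inter> (smooth :: 'n functional set) |U. \<exists>r. openin (sobolev_topology r) U}"
      using mem topspace_smooth[unfolded smooth_topology_def topology_generated_by_topspace, where ?'a = 'n] by simp
    fix U' :: "'n functional set" assume "U' \<in> {U \<inter> smooth |U. \<exists>r. openin (sobolev_topology r) U}"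
    then obtain U r where U: "U' = U \<inter> smooth" "openin (sobolev_topology r) U" by auto
    have "openin (top_of_set {0..T}) {x \<in> {0..T}. u x \<in> U}"
      using u U(2) by (simp add: continuous_into_def continuous_map_def)
    moreover have "u -` U' \<inter> topspace (top_of_set {0..T}) = {x \<in> {0..T}. u x \<in> U}"
      using mem U(1) by (auto simp: image_subset_iff)
    ultimately show "openin (top_of_set {0..T}) (u -` U' \<inter> topspace (top_of_set {0..T}))" by simp
  qed
qed

lemma continuous_into_smooth_multiplier:
  assumes "continuous_into T smooth_topology u" "lipschitz_multiplier T L m" "0 \<le> T"
  shows "continuous_into T smooth_topology (\<lambda>t. multiplier (m t) (u t))"
  unfolding continuous_into_smooth
proof
  fix r
  have "continuous_into T (sobolev_topology (r + 2)) u" using assms(1) by (simp add: continuous_into_smooth)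
  from continuous_into_sobolev_multiplier[OF this assms(2,3)]
  show "continuous_into T (sobolev_topology r) (\<lambda>t. multiplier (m t) (u t))" by simp
qed

subsection \<open>Gevrey classes\<close>

definition rapid :: "(int ^ 'n::finite \<Rightarrow> complex) \<Rightarrow> bool" where
  "rapid a \<longleftrightarrow> (\<forall>k. (\<lambda>\<xi>. bracket \<xi> ^ k * norm (a \<xi>)) summable_on UNIV)"

definition fourier_series :: "(int ^ 'n::finite \<Rightarrow> complex) \<Rightarrow> real ^ 'n \<Rightarrow> complex" where
  "fourier_series a x = (\<Sum>\<^sub>\<infinity>\<xi>. a \<xi> * wave \<xi> x)"

lemma rapid_summable: "rapid a \<Longrightarrow> (\<lambda>\<xi>. norm (a \<xi>)) summable_on UNIV"
  unfolding rapid_def by (drule spec[of _ 0]) simp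

lemma rapid_freq_power:
  assumes "rapid a"
  shows "rapid (\<lambda>\<xi>. freq_power js \<xi> * a \<xi>)"
  unfolding rapid_def
proof
  fix k
  have s: "(\<lambda>\<xi>. bracket \<xi> ^ (k + length js) * norm (a \<xi>)) summable_on UNIV"
    using assms by (simp add: rapid_def)
  show "(\<lambda>\<xi>. bracket \<xi> ^ k * norm (freq_power js \<xi> * a \<xi>)) summable_on UNIV"
  proof (rule summable_on_comparison_test[OF s])
    fix \<xi>
    show "bracket \<xi> ^ k * norm (freq_power js \<xi> * a \<xi>) \<le> bracket \<xi> ^ (k + length js) * norm (a \<xi>)"
      using mult_left_mono[OF mult_right_mono[OF norm_freq_power_le[of js \<xi>], of "norm (a \<xi>)"], of "bracket \<xi> ^ k"]
      by (simp add: norm_mult power_add mult_ac)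
  qed auto
qed

lemma rapid_smooth:
  fixes f :: "'n::finite functional"
  assumes "f \<in> smooth"
  shows "rapid (fourier_coeff f)"
  unfolding rapid_def
proof
  fix k :: nat
  define p where "p = 2 * CARD('n) + k"
  have "f \<in> sobolev (real p)" using assms by (simp add: smooth_def)
  from fourier_coeff_le_sobolev_norm[OF this]
  have "norm (fourier_coeff f \<xi>) * bracket \<xi> ^ p \<le> sobolev_norm (real p) f" for \<xi>
    by (simp only: powr_realpow[OF bracket_pos])
  then have "bracket \<xi> ^ (2 * CARD('n)) * norm (bracket \<xi> ^ k * norm (fourier_coeff f \<xi>)) \<le> sobolev_norm (real p) f" for \<xi>
    by (simp add: p_def power_add abs_mult mult_ac)
  from bracket_summableI(1)[OF this]
  show "(\<lambda>\<xi>. bracket \<xi> ^ k * norm (fourier_coeff f \<xi>)) summable_on UNIV" by (simp add: abs_mult)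
qed

lemma norm_exp_minus_linear_le: "norm (exp (\<i> * of_real y) - 1 - \<i> * of_real y) \<le> y\<^sup>2"
  using Taylor_exp[of "\<i> * of_real y" 1] by (simp add: norm_mult power2_eq_square algebra_simps)

text \<open>The remainder of exp (i y) after its linear part is at most y^2, so the difference
  quotient deviates from the differentiated series by at most |h| M with M the sum of
  \<open>bracket \<xi> ^ 2 * norm (a \<xi>)\<close>.\<close>

lemma has_partial_fourier_series:
  assumes a: "rapid a"
  shows "has_partial j (fourier_series a) (fourier_series (\<lambda>\<xi>. \<i> * of_int (\<xi> $ j) * a \<xi>))"
  unfolding has_partial_def
proof
  fix x
  let ?G = "fourier_series (\<lambda>\<xi>. \<i> * of_int (\<xi> $ j) * a \<xi>) x"
  have bd: "\<bar>of_int (\<xi> $ j)\<bar> \<le> bracket \<xi>" for \<xi> using abs_nth_le_bracket[of \<xi> j] by linarith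
  have g: "(\<lambda>\<xi>. bracket \<xi> ^ 2 * norm (a \<xi>)) summable_on UNIV" using a by (simp add: rapid_def)
  define M where "M = (\<Sum>\<^sub>\<infinity>\<xi>. bracket \<xi> ^ 2 * norm (a \<xi>))"
  have s0: "(\<lambda>\<xi>. a \<xi> * wave \<xi> y) summable_on UNIV" for y
    by (rule abs_summable_summable) (simp add: norm_mult rapid_summable[OF a])
  have s1: "(\<lambda>\<xi>. \<i> * of_int (\<xi> $ j) * a \<xi> * wave \<xi> x) summable_on UNIV"
  proof (rule abs_summable_summable)
    show "(\<lambda>\<xi>. norm (\<i> * of_int (\<xi> $ j) * a \<xi> * wave \<xi> x)) summable_on UNIV"
      using rapid_summable[OF rapid_freq_power[OF a, of "[j]"]] by (simp add: norm_mult)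
  qed
  have le: "norm (fourier_series a (x + h *\<^sub>R axis j 1) - fourier_series a x - h *\<^sub>R ?G) \<le> h\<^sup>2 * M" for h :: real
  proof -
    let ?t = "\<lambda>\<xi>. a \<xi> * wave \<xi> x * (exp (\<i> * of_real (h * of_int (\<xi> $ j))) - 1 - \<i> * of_real (h * of_int (\<xi> $ j)))"
    have "fourier_series a (x + h *\<^sub>R axis j 1) - fourier_series a x - h *\<^sub>R ?G =
       (\<Sum>\<^sub>\<infinity>\<xi>. a \<xi> * wave \<xi> (x + axis j h)) + (\<Sum>\<^sub>\<infinity>\<xi>. (-1) * (a \<xi> * wave \<xi> x)) +
       (\<Sum>\<^sub>\<infinity>\<xi>. (- of_real h) * (\<i> * of_int (\<xi> $ j) * a \<xi> * wave \<xi> x))"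
      unfolding infsum_cmult_right' fourier_series_def scaleR_axis by (simp add: scaleR_conv_of_real)
    also have "\<dots> = (\<Sum>\<^sub>\<infinity>\<xi>. a \<xi> * wave \<xi> (x + axis j h) + (-1) * (a \<xi> * wave \<xi> x) +
       (- of_real h) * (\<i> * of_int (\<xi> $ j) * a \<xi> * wave \<xi> x))"
      by (simp only: infsum_add[OF summable_on_add[OF s0[of "x + axis j h"] summable_on_cmult_right[OF s0[of x], of "-1"]]
            summable_on_cmult_right[OF s1, of "- of_real h"]]
          infsum_add[OF s0[of "x + axis j h"] summable_on_cmult_right[OF s0[of x], of "-1"]])
    also have "\<dots> = (\<Sum>\<^sub>\<infinity>\<xi>. ?t \<xi>)"
      by (simp add: wave_shift wave_axis algebra_simps)
    finally have eq: "fourier_series a (x + h *\<^sub>R axis j 1) - fourier_series a x - h *\<^sub>R ?G = (\<Sum>\<^sub>\<infinity>\<xi>. ?t \<xi>)" .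
    have nt: "norm (?t \<xi>) \<le> h\<^sup>2 * (bracket \<xi> ^ 2 * norm (a \<xi>))" for \<xi>
    proof -
      have "norm (?t \<xi>) \<le> norm (a \<xi>) * (h * of_int (\<xi> $ j))\<^sup>2"
        unfolding norm_mult norm_wave mult_1_right by (intro mult_left_mono norm_exp_minus_linear_le) auto
      also have "\<dots> \<le> norm (a \<xi>) * (h\<^sup>2 * bracket \<xi> ^ 2)"
        unfolding power_mult_distrib using power_mono[OF bd[of \<xi>], of 2] by (intro mult_left_mono) auto
      also have "\<dots> = h\<^sup>2 * (bracket \<xi> ^ 2 * norm (a \<xi>))" by simp
      finally show ?thesis .
    qed
    have g': "(\<lambda>\<xi>. h\<^sup>2 * (bracket \<xi> ^ 2 * norm (a \<xi>))) summable_on UNIV"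
      by (intro summable_on_cmult_right g)
    have nts: "(\<lambda>\<xi>. norm (?t \<xi>)) summable_on UNIV"
      by (rule summable_on_comparison_test[OF g']) (use nt in auto)
    have "norm (\<Sum>\<^sub>\<infinity>\<xi>. ?t \<xi>) \<le> (\<Sum>\<^sub>\<infinity>\<xi>. norm (?t \<xi>))" by (rule norm_infsum_bound[OF nts])
    also have "\<dots> \<le> (\<Sum>\<^sub>\<infinity>\<xi>. h\<^sup>2 * (bracket \<xi> ^ 2 * norm (a \<xi>)))" by (intro infsum_mono nts g' nt)
    also have "\<dots> = h\<^sup>2 * M" unfolding M_def by (rule infsum_cmult_right')
    finally show ?thesis unfolding eq .
  qed
  have "((\<lambda>h::real. \<bar>h\<bar> * M) \<longlongrightarrow> \<bar>0\<bar> * M) (at 0)" by (intro tendsto_intros)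
  then have lim: "((\<lambda>h::real. \<bar>h\<bar> * M) \<longlongrightarrow> 0) (at 0)" by simp
  have "(\<lambda>h::real. norm (fourier_series a (x + (0 + h) *\<^sub>R axis j 1) - fourier_series a (x + 0 *\<^sub>R axis j 1) - h *\<^sub>R ?G) / norm h) \<midarrow>0\<rightarrow> 0"
  proof (rule Lim_null_comparison[OF _ lim])
    show "\<forall>\<^sub>F h in at 0. norm (norm (fourier_series a (x + (0 + h) *\<^sub>R axis j 1) - fourier_series a (x + 0 *\<^sub>R axis j 1) - h *\<^sub>R ?G) / norm h) \<le> \<bar>h\<bar> * M"
    proof (rule always_eventually, rule allI)
      fix h :: real
      show "norm (norm (fourier_series a (x + (0 + h) *\<^sub>R axis j 1) - fourier_series a (x + 0 *\<^sub>R axis j 1) - h *\<^sub>R ?G) / norm h) \<le> \<bar>h\<bar> * M"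
        using le[of h] by (cases "h = 0") (auto simp: divide_le_eq power2_eq_square mult_ac)
    qed
  qed
  then show "((\<lambda>h. fourier_series a (x + h *\<^sub>R axis j 1)) has_vector_derivative ?G) (at 0)"
    unfolding has_vector_derivative_def has_derivative_at
    by (intro conjI bounded_linear_scaleR_left)
qed

lemma D_fun_fourier_series:
  assumes a: "rapid a"
  shows "D_fun js (fourier_series a) = fourier_series (\<lambda>\<xi>. freq_power js \<xi> * a \<xi>)"
proof (induction js)
  case (Cons j js)
  have "Dx_fun j (fourier_series b) = fourier_series (\<lambda>\<xi>. of_int (\<xi> $ j) * b \<xi>)" if "rapid b" for b
  proof
    fix x
    have "Dx_fun j (fourier_series b) x = 1 / \<i> * (\<Sum>\<^sub>\<infinity>\<xi>. \<i> * (of_int (\<xi> $ j) * b \<xi> * wave \<xi> x))"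
      unfolding Dx_fun_eq has_partial_partial[OF has_partial_fourier_series[OF that]]
      by (simp add: fourier_series_def mult.assoc)
    then show "Dx_fun j (fourier_series b) x = fourier_series (\<lambda>\<xi>. of_int (\<xi> $ j) * b \<xi>) x"
      unfolding infsum_cmult_right' fourier_series_def by simp
  qed
  from this[OF rapid_freq_power[OF a]] show ?case
    using Cons by (simp add: mult.assoc)
qed simp

lemma fun_of_eq: "fun_of f = fourier_series (fourier_coeff f)"
  by (rule ext) (simp add: fun_of_def fourier_series_def wave_def)

lemma norm_fourier_series_le:
  assumes "(\<lambda>\<xi>. norm (a \<xi>)) summable_on UNIV"
  shows "norm (fourier_series a x) \<le> (\<Sum>\<^sub>\<infinity>\<xi>. norm (a \<xi>))"
  unfolding fourier_series_def using norm_infsum_bound[of "\<lambda>\<xi>. a \<xi> * wave \<xi> x" UNIV] assms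
  by (simp add: norm_mult)

lemma D_fun_fun_of:
  assumes "f \<in> smooth"
  shows "D_fun js (fun_of f) = fourier_series (\<lambda>\<xi>. freq_power js \<xi> * fourier_coeff f \<xi>)"
  unfolding fun_of_eq by (rule D_fun_fourier_series[OF rapid_smooth[OF assms]])

lemma bdd_above_D_fun_fun_of:
  assumes "f \<in> smooth"
  shows "bdd_above (range (\<lambda>x. norm (D_fun js (fun_of f) x)))"
  unfolding D_fun_fun_of[OF assms]
  by (rule bdd_aboveI2, rule norm_fourier_series_le, rule rapid_summable, rule rapid_freq_power, rule rapid_smooth[OF assms])

section \<open>Gevrey norms and Fourier multipliers\<close>

lemma gevrey_step_smooth: "f \<in> gevrey_step h s \<Longrightarrow> f \<in> smooth"
  by (simp add: gevrey_step_def)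

lemma smooth_distributions: "f \<in> smooth \<Longrightarrow> f \<in> distributions"
  by (auto simp: smooth_def intro: sobolev_distributions[of _ 0])

lemma norm_D_fun_le_gevrey_norm:
  assumes f: "f \<in> gevrey_step h s" and h: "h > 0"
  shows "norm (D_fun js (fun_of f) x) \<le> gevrey_norm h s f * (h ^ length js * fact (length js) powr s)"
proof -
  have pos: "0 < h ^ length js * (fact (length js) :: real) powr s" using h by simp
  have "gevrey_quotient h s f js \<le> gevrey_norm h s f"
    unfolding gevrey_norm_def using f by (intro cSUP_upper) (auto simp: gevrey_step_def)
  then have "sup_norm (D_fun js (fun_of f)) \<le> gevrey_norm h s f * (h ^ length js * fact (length js) powr s)"
    unfolding gevrey_quotient_def pos_divide_le_eq[OF pos] .
  then show ?thesis
    using norm_le_sup_norm[OF bdd_above_D_fun_fun_of[OF gevrey_step_smooth[OF f]], of js x] by linarith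
qed

lemma gevrey_stepI:
  assumes f: "f \<in> smooth" and h: "h > 0"
    and le: "\<And>js x. norm (D_fun js (fun_of f) x) \<le> B * (h ^ length js * fact (length js) powr s)"
  shows "f \<in> gevrey_step h s" "gevrey_norm h s f \<le> B"
proof -
  have *: "gevrey_quotient h s f js \<le> B" for js
  proof -
    have pos: "0 < h ^ length js * (fact (length js) :: real) powr s" using h by simp
    show ?thesis unfolding gevrey_quotient_def pos_divide_le_eq[OF pos] by (rule sup_norm_le[OF le])
  qed
  show "f \<in> gevrey_step h s" using f * by (auto simp: gevrey_step_def intro!: bdd_aboveI2)
  show "gevrey_norm h s f \<le> B" unfolding gevrey_norm_def by (intro cSUP_least *) auto
qed

lemma gevrey_norm_nonneg:
  assumes "f \<in> gevrey_step h s" "h > 0"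
  shows "0 \<le> gevrey_norm h s f"
  using order_trans[OF norm_ge_zero norm_D_fun_le_gevrey_norm[OF assms, of "[]" 0]] by simp

lemma gevrey_iff: "f \<in> gevrey s \<longleftrightarrow> (\<exists>h>0. f \<in> gevrey_step h s)"
proof
  assume "f \<in> gevrey s"
  then obtain C h where C: "f \<in> smooth" "h > 0"
    "\<And>js x. norm (D_fun js (fun_of f) x) \<le> C * h ^ length js * fact (length js) powr s"
    by (auto simp: gevrey_def)
  then have "f \<in> gevrey_step h s" by (intro gevrey_stepI(1)[of f h C]) (simp_all add: mult.assoc)
  then show "\<exists>h>0. f \<in> gevrey_step h s" using C by blast
next
  assume "\<exists>h>0. f \<in> gevrey_step h s"
  then obtain h where h: "h > 0" "f \<in> gevrey_step h s" by blast
  let ?C = "gevrey_norm h s f + 1"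
  have "norm (D_fun js (fun_of f) x) \<le> ?C * h ^ length js * fact (length js) powr s" for js x
  proof -
    have "norm (D_fun js (fun_of f) x) \<le> gevrey_norm h s f * (h ^ length js * fact (length js) powr s)"
      by (rule norm_D_fun_le_gevrey_norm[OF h(2,1)])
    also have "\<dots> \<le> ?C * (h ^ length js * fact (length js) powr s)"
      using h by (intro mult_right_mono) auto
    finally show ?thesis by (simp add: mult.assoc)
  qed
  moreover have "?C > 0" using gevrey_norm_nonneg[OF h(2,1)] by simp
  ultimately show "f \<in> gevrey s"
    using h gevrey_step_smooth[OF h(2)] unfolding gevrey_def by blast
qed

lemma gevrey_smooth: "f \<in> gevrey s \<Longrightarrow> f \<in> smooth"
  by (simp add: gevrey_def)

lemma norm_freq_power_coeff_le_gevrey_norm: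
  assumes f: "f \<in> gevrey_step h s" and h: "h > 0"
  shows "norm (freq_power js \<xi> * fourier_coeff f \<xi>) \<le> gevrey_norm h s f * (h ^ length js * fact (length js) powr s)"
proof -
  let ?a = "\<lambda>\<xi>. freq_power js \<xi> * fourier_coeff f \<xi>"
  have a: "(\<lambda>\<xi>. norm (?a \<xi>)) summable_on UNIV"
    by (intro rapid_summable rapid_freq_power rapid_smooth gevrey_step_smooth[OF f])
  have "norm (torus_coeff (fourier_series ?a) \<xi>) \<le> gevrey_norm h s f * (h ^ length js * fact (length js) powr s)"
    using norm_D_fun_le_gevrey_norm[OF f h, of js] fourier_sum(1)[OF a]
    unfolding D_fun_fun_of[OF gevrey_step_smooth[OF f]] fourier_series_def[abs_def]
    by (intro norm_torus_coeff_le)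
  then show ?thesis using fourier_sum(3)[OF a, of \<xi>] by (simp add: fourier_series_def[abs_def])
qed

text \<open>The binomial coefficient is at most 2^(n + p). This is the origin of the factor 2^s by
  which the parameter h grows under a multiplier.\<close>

lemma fact_add_powr_le:
  assumes "0 \<le> s"
  shows "fact (n + p) powr s \<le> (2 powr s) ^ (n + p) * (fact n powr s * fact p powr s :: real)"
proof -
  have "fact (n + p) = (fact n * fact p * real ((n + p) choose n) :: real)"
  proof -
    have "real (fact n * fact p * ((n + p) choose n)) = real (fact (n + p))"
      using binomial_fact_lemma[of n "n + p"] by simp
    then show ?thesis by simp
  qed
  also have "\<dots> \<le> fact n * fact p * 2 ^ (n + p)"
  proof (rule mult_left_mono)
    show "real ((n + p) choose n) \<le> 2 ^ (n + p)"
      by (metis binomial_le_pow2 of_nat_le_iff of_nat_numeral of_nat_power)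
  qed simp
  finally have "fact (n + p) powr s \<le> (fact n * fact p * 2 ^ (n + p) :: real) powr s"
    using assms by (intro powr_mono2) auto
  also have "\<dots> = (2 powr s) ^ (n + p) * (fact n powr s * fact p powr s)"
  proof -
    have "((2::real) ^ (n + p)) powr s = (2 powr real (n + p)) powr s" by (simp only: powr_realpow zero_less_numeral)
    also have "\<dots> = (2 powr s) powr real (n + p)" by (simp only: powr_powr mult.commute)
    also have "\<dots> = (2 powr s) ^ (n + p)" by (rule powr_realpow) simp
    finally show ?thesis by (simp add: powr_mult mult.commute)
  qed
  finally show ?thesis .
qed

text \<open>Everything in the next estimate that depends on neither the function nor the derivative:
  the first factor is the constant of \<open>bracket_power_freq_power\<close>, 1 + h^p covers lists
  of length n and n + p alike, and the rest is left over from splitting the factorial.\<close>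

definition gevrey_const :: "nat \<Rightarrow> real \<Rightarrow> real \<Rightarrow> nat \<Rightarrow> real" where
  "gevrey_const N h s p = (1 + real N) ^ p * ((1 + h ^ p) * ((2 powr s) ^ p * fact p powr s))"

lemma gevrey_const_nonneg: "0 < h \<Longrightarrow> 0 \<le> gevrey_const N h s p"
  unfolding gevrey_const_def by (intro mult_nonneg_nonneg) auto

text \<open>The p powers of \<open>bracket\<close> amount to at most p further derivatives.
  Splitting their factorial leaves a factor (2^s)^n, exponential in the order n of the derivative,
  and this is absorbed by replacing h with h 2^s.\<close>

lemma bracket_coeff_le_gevrey_norm:
  fixes f :: "'n::finite functional"
  assumes f: "f \<in> gevrey_step h s" and h: "h > 0" and s: "0 \<le> s"
  shows "bracket \<xi> ^ p * norm (freq_power js \<xi> * fourier_coeff f \<xi>) \<le>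
    gevrey_const CARD('n) h s p * gevrey_norm h s f * ((h * 2 powr s) ^ length js * fact (length js) powr s)"
proof -
  let ?n = "length js"
  obtain ks where len: "length ks \<in> {?n, ?n + p}" and
    le: "bracket \<xi> ^ p * norm (freq_power js \<xi>) \<le> (1 + real CARD('n)) ^ p * norm (freq_power ks \<xi>)"
    using bracket_power_freq_power[of js p \<xi>] by blast
  have two: "1 \<le> (2 powr s :: real)" using s by (simp add: ge_one_powr_ge_zero)
  have fp: "1 \<le> (fact p :: real) powr s" using s by (simp add: ge_one_powr_ge_zero)
  have key: "h ^ length ks * fact (length ks) powr s \<le>
      ((1 + h ^ p) * ((2 powr s) ^ p * fact p powr s)) * ((h * 2 powr s) ^ ?n * fact ?n powr s)"
  proof -
    have "h ^ length ks * fact (length ks) powr s \<le>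
      ((1 + h ^ p) * h ^ ?n) * ((2 powr s) ^ (?n + p) * (fact ?n powr s * fact p powr s))"
    proof (rule mult_mono)
      show "h ^ length ks \<le> (1 + h ^ p) * h ^ ?n" using len h by (auto simp: power_add algebra_simps)
      show "(fact (length ks) :: real) powr s \<le> (2 powr s) ^ (?n + p) * (fact ?n powr s * fact p powr s)"
      proof (cases "length ks = ?n + p")
        case True
        then show ?thesis using fact_add_powr_le[OF s, of ?n p] by simp
      next
        case False
        then have "length ks = ?n" using len by auto
        moreover have "1 * (fact ?n powr s * 1) \<le> (2 powr s) ^ (?n + p) * ((fact ?n :: real) powr s * fact p powr s)"
          using fp two by (intro mult_mono) (auto intro: one_le_power)
        ultimately show ?thesis by simp
      qed
    qed (use h in auto)
    then show ?thesis by (simp add: power_add power_mult_distrib mult_ac)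
  qed
  have "bracket \<xi> ^ p * norm (freq_power js \<xi> * fourier_coeff f \<xi>) \<le>
      (1 + real CARD('n)) ^ p * norm (freq_power ks \<xi>) * norm (fourier_coeff f \<xi>)"
    using mult_right_mono[OF le, of "norm (fourier_coeff f \<xi>)"] by (simp add: norm_mult mult.assoc)
  also have "\<dots> = (1 + real CARD('n)) ^ p * norm (freq_power ks \<xi> * fourier_coeff f \<xi>)"
    by (simp add: norm_mult)
  also have "\<dots> \<le> (1 + real CARD('n)) ^ p * (gevrey_norm h s f * (h ^ length ks * fact (length ks) powr s))"
    by (intro mult_left_mono norm_freq_power_coeff_le_gevrey_norm f h) auto
  also have "\<dots> \<le> (1 + real CARD('n)) ^ p * (gevrey_norm h s f *
      (((1 + h ^ p) * ((2 powr s) ^ p * fact p powr s)) * ((h * 2 powr s) ^ ?n * fact ?n powr s)))"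
    by (intro mult_left_mono key gevrey_norm_nonneg f h) auto
  finally show ?thesis by (simp add: gevrey_const_def mult_ac)
qed

lemma multiplier_smooth:
  assumes f: "f \<in> smooth" and m: "\<And>\<xi>. norm (m \<xi>) \<le> L * bracket \<xi> ^ 2" and "0 \<le> L"
  shows "multiplier m f \<in> smooth"
  unfolding smooth_def
proof
  fix r
  have "f \<in> sobolev (r + 2)" using f by (simp add: smooth_def)
  from sobolev_multiplier(1)[OF this m \<open>0 \<le> L\<close>] show "multiplier m f \<in> sobolev r" by simp
qed

text \<open>The exponent 2N + 2 consists of 2N for summing the Fourier series and 2 for the growth
  of m. The bound is linear in L, so it also controls increments, for which L is a multiple of the
  time difference.\<close>

lemma gevrey_multiplier:
  fixes f :: "'n::finite functional"
  assumes f: "f \<in> gevrey_step h s" and h: "h > 0" and s: "0 \<le> s"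
    and m: "\<And>\<xi>. norm (m \<xi>) \<le> L * bracket \<xi> ^ 2" and L: "0 \<le> L"
  defines "K \<equiv> gevrey_const CARD('n) h s (2 * CARD('n) + 2) * (\<Sum>\<^sub>\<infinity>\<xi>::int^'n. 1 / bracket \<xi> ^ (2 * CARD('n)))"
  shows "multiplier m f \<in> gevrey_step (h * 2 powr s) s"
    and "gevrey_norm (h * 2 powr s) s (multiplier m f) \<le> L * K * gevrey_norm h s f"
proof -
  have sm: "multiplier m f \<in> smooth" by (rule multiplier_smooth[OF gevrey_step_smooth[OF f] m L])
  have "norm (D_fun js (fun_of (multiplier m f)) x) \<le> (L * K * gevrey_norm h s f) *
      ((h * 2 powr s) ^ length js * fact (length js) powr s)" for js x
  proof -
    let ?a = "\<lambda>\<xi>. freq_power js \<xi> * (m \<xi> * fourier_coeff f \<xi>)"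
    let ?C = "L * (gevrey_const CARD('n) h s (2 * CARD('n) + 2) * gevrey_norm h s f * ((h * 2 powr s) ^ length js * fact (length js) powr s))"
    have "bracket \<xi> ^ (2 * CARD('n)) * norm (?a \<xi>) \<le> ?C" for \<xi>
    proof -
      have "bracket \<xi> ^ (2 * CARD('n)) * norm (?a \<xi>) =
          norm (m \<xi>) * (bracket \<xi> ^ (2 * CARD('n)) * norm (freq_power js \<xi> * fourier_coeff f \<xi>))"
        by (simp add: norm_mult mult_ac)
      also have "\<dots> \<le> (L * bracket \<xi> ^ 2) * (bracket \<xi> ^ (2 * CARD('n)) * norm (freq_power js \<xi> * fourier_coeff f \<xi>))"
        by (intro mult_right_mono m) auto
      also have "\<dots> = L * (bracket \<xi> ^ (2 * CARD('n) + 2) * norm (freq_power js \<xi> * fourier_coeff f \<xi>))"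
        by (simp add: power_add mult_ac power2_eq_square)
      also have "\<dots> \<le> ?C" by (intro mult_left_mono bracket_coeff_le_gevrey_norm f h s L)
      finally show ?thesis .
    qed
    note S = bracket_summableI[OF this]
    have "norm (fourier_series ?a x) \<le> ?C * (\<Sum>\<^sub>\<infinity>\<xi>::int^'n. 1 / bracket \<xi> ^ (2 * CARD('n)))"
      using norm_fourier_series_le[OF S(1), of x] S(2) by linarith
    then show ?thesis by (simp add: D_fun_fun_of[OF sm] K_def mult_ac)
  qed
  from gevrey_stepI[OF sm _ this] h
  show "multiplier m f \<in> gevrey_step (h * 2 powr s) s"
    "gevrey_norm (h * 2 powr s) s (multiplier m f) \<le> L * K * gevrey_norm h s f" by simp_all
qed

lemma gevrey_step_lincomb:
  assumes f: "f \<in> gevrey_step h s" and g: "g \<in> gevrey_step h s" and h: "h > 0"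
  shows "(\<lambda>\<phi>. a * f \<phi> + b * g \<phi>) \<in> gevrey_step h s"
    and "gevrey_norm h s (\<lambda>\<phi>. a * f \<phi> + b * g \<phi>) \<le> norm a * gevrey_norm h s f + norm b * gevrey_norm h s g"
proof -
  let ?w = "\<lambda>\<phi>. a * f \<phi> + b * g \<phi>"
  have sm: "?w \<in> smooth"
    using gevrey_step_smooth[OF f] gevrey_step_smooth[OF g] unfolding smooth_def by (auto intro: sobolev_lincomb(1))
  have "norm (D_fun js (fun_of ?w) x) \<le> (norm a * gevrey_norm h s f + norm b * gevrey_norm h s g) *
      (h ^ length js * fact (length js) powr s)" for js x
  proof -
    have s: "(\<lambda>\<xi>. freq_power js \<xi> * fourier_coeff w \<xi> * wave \<xi> x) summable_on UNIV" if "w \<in> smooth" for w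
    proof (rule abs_summable_summable)
      show "(\<lambda>\<xi>. norm (freq_power js \<xi> * fourier_coeff w \<xi> * wave \<xi> x)) summable_on UNIV"
        using rapid_summable[OF rapid_freq_power[OF rapid_smooth[OF that], of js]] by (simp add: norm_mult)
    qed
    have "D_fun js (fun_of ?w) x = (\<Sum>\<^sub>\<infinity>\<xi>. a * (freq_power js \<xi> * fourier_coeff f \<xi> * wave \<xi> x) +
        b * (freq_power js \<xi> * fourier_coeff g \<xi> * wave \<xi> x))"
      unfolding D_fun_fun_of[OF sm] fourier_series_def fourier_coeff_lincomb by (simp add: algebra_simps)
    also have "\<dots> = a * D_fun js (fun_of f) x + b * D_fun js (fun_of g) x"
      unfolding D_fun_fun_of[OF gevrey_step_smooth[OF f]] D_fun_fun_of[OF gevrey_step_smooth[OF g]] fourier_series_def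
        infsum_add[OF summable_on_cmult_right[OF s[OF gevrey_step_smooth[OF f]], of a]
          summable_on_cmult_right[OF s[OF gevrey_step_smooth[OF g]], of b]] infsum_cmult_right' ..
    also have "norm \<dots> \<le> norm a * norm (D_fun js (fun_of f) x) + norm b * norm (D_fun js (fun_of g) x)"
      by (metis norm_mult norm_triangle_ineq)
    also have "\<dots> \<le> norm a * (gevrey_norm h s f * (h ^ length js * fact (length js) powr s)) +
        norm b * (gevrey_norm h s g * (h ^ length js * fact (length js) powr s))"
      by (intro add_mono mult_left_mono norm_D_fun_le_gevrey_norm f g h) auto
    finally show ?thesis by (simp add: algebra_simps)
  qed
  from gevrey_stepI[OF sm h this] show "?w \<in> gevrey_step h s"
    "gevrey_norm h s ?w \<le> norm a * gevrey_norm h s f + norm b * gevrey_norm h s g" .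
qed

lemma gevrey_step_mono:
  assumes f: "f \<in> gevrey_step h s" and h: "0 < h" "h \<le> h'"
  shows "f \<in> gevrey_step h' s"
proof (rule gevrey_stepI(1)[OF gevrey_step_smooth[OF f]])
  show "norm (D_fun js (fun_of f) x) \<le> gevrey_norm h s f * (h' ^ length js * fact (length js) powr s)" for js x
  proof -
    have "norm (D_fun js (fun_of f) x) \<le> gevrey_norm h s f * (h ^ length js * fact (length js) powr s)"
      by (rule norm_D_fun_le_gevrey_norm[OF f h(1)])
    also have "\<dots> \<le> gevrey_norm h s f * (h' ^ length js * fact (length js) powr s)"
      using h by (intro mult_left_mono mult_right_mono power_mono gevrey_norm_nonneg f) auto
    finally show ?thesis .
  qed
qed (use h in auto)

lemma gevrey_lincomb:
  assumes "f \<in> gevrey s" "g \<in> gevrey s"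
  shows "(\<lambda>\<phi>. a * f \<phi> + b * g \<phi>) \<in> gevrey s"
proof -
  obtain h h' where h: "h > 0" "f \<in> gevrey_step h s" "h' > 0" "g \<in> gevrey_step h' s"
    using assms by (auto simp: gevrey_iff)
  have "(\<lambda>\<phi>. a * f \<phi> + b * g \<phi>) \<in> gevrey_step (max h h') s"
    by (rule gevrey_step_lincomb(1)[OF gevrey_step_mono[OF h(2,1)] gevrey_step_mono[OF h(4,3)]]) (use h in auto)
  then show ?thesis using h(1) by (auto simp: gevrey_iff intro!: exI[of _ "max h h'"])
qed

section \<open>Neighbourhoods of zero in the inductive limit topology\<close>

lemma gevrey_zero_base_scale:
  fixes V :: "'n::finite functional set"
  assumes V: "V \<in> gevrey_zero_base s"
  shows "{w \<in> gevrey s. (\<lambda>\<phi>. c * w \<phi>) \<in> V} \<in> gevrey_zero_base s"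
  unfolding gevrey_zero_base_def
proof (intro CollectI conjI allI impI)
  show "absolutely_convex {w \<in> gevrey s. (\<lambda>\<phi>. c * w \<phi>) \<in> V}"
    unfolding absolutely_convex_def
  proof (intro ballI allI impI CollectI conjI)
    fix u v :: "'n functional" and a b :: complex
    assume u: "u \<in> {w \<in> gevrey s. (\<lambda>\<phi>. c * w \<phi>) \<in> V}" and v: "v \<in> {w \<in> gevrey s. (\<lambda>\<phi>. c * w \<phi>) \<in> V}"
      and ab: "norm a + norm b \<le> 1"
    show "(\<lambda>\<phi>. a * u \<phi> + b * v \<phi>) \<in> gevrey s" using u v by (intro gevrey_lincomb) auto
    have "(\<lambda>\<phi>. a * (c * u \<phi>) + b * (c * v \<phi>)) \<in> V"
      using V u v ab by (auto simp: gevrey_zero_base_def absolutely_convex_def)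
    then show "(\<lambda>\<phi>. c * (a * u \<phi> + b * v \<phi>)) \<in> V" by (simp add: algebra_simps)
  qed
  fix h :: real assume h: "h > 0"
  obtain e where e: "e > 0" "\<And>v. v \<in> gevrey_step h s \<Longrightarrow> gevrey_norm h s v < e \<Longrightarrow> v \<in> V"
    using V h by (auto simp: gevrey_zero_base_def)
  show "\<exists>e>0. \<forall>v\<in>gevrey_step h s. gevrey_norm h s v < e \<longrightarrow> v \<in> {w \<in> gevrey s. (\<lambda>\<phi>. c * w \<phi>) \<in> V}"
  proof (intro exI[of _ "e / (norm c + 1)"] conjI ballI impI CollectI)
    show "0 < e / (norm c + 1)" using e(1) by (intro divide_pos_pos) (auto intro: add_nonneg_pos)
    fix v :: "'n functional" assume v: "v \<in> gevrey_step h s" "gevrey_norm h s v < e / (norm c + 1)"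
    show "v \<in> gevrey s" using v h by (auto simp: gevrey_iff)
    have pos: "0 < norm c + 1" by (simp add: add_nonneg_pos)
    have "gevrey_norm h s (\<lambda>\<phi>. c * v \<phi> + 0 * v \<phi>) \<le> norm c * gevrey_norm h s v"
      using gevrey_step_lincomb(2)[OF v(1) v(1) h, of c 0] by simp
    also have "\<dots> \<le> (norm c + 1) * gevrey_norm h s v"
      using gevrey_norm_nonneg[OF v(1) h] by (intro mult_right_mono) auto
    also have "\<dots> < e" using v(2) unfolding pos_less_divide_eq[OF pos] by (simp add: mult.commute)
    finally have "(\<lambda>\<phi>. c * v \<phi> + 0 * v \<phi>) \<in> V" by (intro e(2) gevrey_step_lincomb(1) v h)
    then show "(\<lambda>\<phi>. c * v \<phi>) \<in> V" by simp
  qed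
qed auto

lemma gevrey_zero_base_zero:
  fixes V :: "'n::finite functional set"
  assumes V: "V \<in> gevrey_zero_base s"
  shows "(\<lambda>\<phi>. 0) \<in> V"
proof -
  obtain e where e: "e > 0" "\<And>v. v \<in> gevrey_step 1 s \<Longrightarrow> gevrey_norm 1 s v < e \<Longrightarrow> v \<in> V"
    using V zero_less_one unfolding gevrey_zero_base_def by blast
  have z: "(\<lambda>\<phi>. 0) \<in> (distributions :: 'n functional set)"
  proof -
    have "\<exists>C k. \<forall>\<phi>\<in>test_functions. norm (0 :: complex) \<le> C * C_seminorm k (\<phi> :: real ^ 'n \<Rightarrow> complex)"
      by (intro exI[of _ 0]) simp
    then show ?thesis by (simp add: distributions_def)
  qed
  have 0: "fourier_coeff (\<lambda>\<phi>. 0) (\<xi> :: int ^ 'n) = 0" for \<xi> by (simp add: fourier_coeff_def)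
  have sm: "(\<lambda>\<phi>. 0) \<in> (smooth :: 'n functional set)"
    by (simp add: smooth_def sobolev_def z 0)
  have "norm (D_fun js (fun_of (\<lambda>\<phi>. 0)) (x :: real ^ 'n)) \<le> 0 * (1 ^ length js * fact (length js) powr s)" for js x
    unfolding D_fun_fun_of[OF sm] by (simp add: fourier_series_def 0)
  from gevrey_stepI[OF sm zero_less_one this] e show ?thesis by simp
qed

lemma topspace_gevrey [simp]: "topspace (gevrey_topology s) = (gevrey s :: 'n::finite functional set)"
proof
  show "topspace (gevrey_topology s) \<subseteq> (gevrey s :: 'n functional set)"
    using openin_topspace[of "gevrey_topology s"] unfolding openin_gevrey_topology by blast
  have base: "(gevrey s :: 'n functional set) \<in> gevrey_zero_base s"
    unfolding gevrey_zero_base_def absolutely_convex_def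
  proof (intro CollectI conjI allI impI ballI)
    fix h :: real assume "h > 0"
    then show "\<exists>e>0. \<forall>v\<in>gevrey_step h s. gevrey_norm h s v < e \<longrightarrow> v \<in> (gevrey s :: 'n functional set)"
      using zero_less_one gevrey_iff by blast
  qed (auto intro: gevrey_lincomb)
  have "openin (gevrey_topology s) (gevrey s :: 'n functional set)"
    unfolding openin_gevrey_topology using base gevrey_lincomb[of _ s _ 1 1] by auto
  then show "(gevrey s :: 'n functional set) \<subseteq> topspace (gevrey_topology s)" by (rule openin_subset)
qed

text \<open>A member V of the base is a neighbourhood of zero but need not be open, so for the
  forward direction an open set around \<open>u t\<close> inside the translate of V has to be
  constructed.\<close>

lemma continuous_into_gevrey:
  fixes u :: "real \<Rightarrow> 'n::finite functional"
  shows "continuous_into T (gevrey_topology s) u \<longleftrightarrow> (\<forall>t\<in>{0..T}. u t \<in> gevrey s) \<and>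
     (\<forall>t\<in>{0..T}. \<forall>V\<in>gevrey_zero_base s. \<forall>\<^sub>F \<tau> in at t within {0..T}. diff_distr (u \<tau>) (u t) \<in> V)"
  (is "_ \<longleftrightarrow> ?A \<and> ?B")
proof (intro iffI conjI)
  assume u: "continuous_into T (gevrey_topology s) u"
  then show A: ?A unfolding continuous_into_def continuous_map_def by auto
  show ?B
  proof (intro ballI)
    fix t and V :: "'n functional set" assume t: "t \<in> {0..T}" and V: "V \<in> gevrey_zero_base s"
    have ac: "(\<lambda>\<phi>. a * v \<phi> + b * w \<phi>) \<in> V" if "v \<in> V" "w \<in> V" "norm a + norm b \<le> 1" for a b v w
      using V that by (auto simp: gevrey_zero_base_def absolutely_convex_def)
    \<comment> \<open>The translates w for which w - u t still lies in V after a slight dilation: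
      the open gauge ball of V around \<open>u t\<close>.\<close>
    define U where "U = {w \<in> gevrey s. \<exists>c::real. c > 1 \<and> (\<lambda>\<phi>. of_real c * diff_distr w (u t) \<phi>) \<in> V}"
    have "openin (gevrey_topology s) U"
      unfolding openin_gevrey_topology
    proof (intro conjI ballI)
      fix w assume "w \<in> U"
      then obtain c :: real where w: "w \<in> gevrey s" and c: "c > 1" and cV: "(\<lambda>\<phi>. of_real c * diff_distr w (u t) \<phi>) \<in> V"
        by (auto simp: U_def)
      define c' where "c' = (1 + c) / 2"
      have c': "1 < c'" "c' < c" using c by (auto simp: c'_def)
      \<comment> \<open>Chosen so that (1 - c' / c) k = c'. The convex combination with weights c' /
        c and 1 - c' / c of c (w - u t) and k v is then c' (w + v - u t), with c' still greater than
        1.\<close>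
      define k where "k = c * c' / (c - c')"
      let ?W = "{v \<in> gevrey s. (\<lambda>\<phi>. of_real k * v \<phi>) \<in> V}"
      have "(\<lambda>\<phi>. w \<phi> + v \<phi>) \<in> U" if v: "v \<in> ?W" for v
      proof -
        have "(\<lambda>\<phi>. of_real (c' / c) * (of_real c * diff_distr w (u t) \<phi>) + of_real (1 - c' / c) * (of_real k * v \<phi>)) \<in> V"
          by (rule ac[OF cV]) (use v c c' in \<open>auto simp del: of_real_divide of_real_diff\<close>)
        moreover have "(1 - c' / c) * k = c'" using c c' by (simp add: k_def field_simps)
        then have "of_real (1 - c' / c) * (of_real k * x) = of_real c' * x" for x :: complex
          by (metis mult.assoc of_real_mult)
        moreover have "of_real (c' / c) * (of_real c * x) = of_real c' * x" for x :: complex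
          using c by simp
        ultimately have "(\<lambda>\<phi>. of_real c' * diff_distr w (u t) \<phi> + of_real c' * v \<phi>) \<in> V"
          by (simp only:)
        moreover have "(\<lambda>\<phi>. of_real c' * diff_distr (\<lambda>\<phi>. w \<phi> + v \<phi>) (u t) \<phi>) =
            (\<lambda>\<phi>. of_real c' * diff_distr w (u t) \<phi> + of_real c' * v \<phi>)"
          by (simp add: diff_distr_def algebra_simps)
        ultimately have "(\<lambda>\<phi>. of_real c' * diff_distr (\<lambda>\<phi>. w \<phi> + v \<phi>) (u t) \<phi>) \<in> V"
          by (simp only:)
        then show ?thesis using c' w v gevrey_lincomb[of w s v 1 1] by (auto simp: U_def)
      qed
      then show "\<exists>W\<in>gevrey_zero_base s. \<forall>v\<in>W. (\<lambda>\<phi>. w \<phi> + v \<phi>) \<in> U"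
        using gevrey_zero_base_scale[OF V] by blast
    qed (auto simp: U_def)
    moreover have "u t \<in> U"
      using A t gevrey_zero_base_zero[OF V] by (auto simp: U_def diff_distr_def intro!: exI[of _ 2])
    ultimately have "\<exists>W. openin (top_of_set {0..T}) W \<and> t \<in> W \<and> (\<forall>y\<in>W. u y \<in> U)"
      using u t unfolding continuous_into_def continuous_map_eq_topcontinuous_at topcontinuous_at_def by simp
    then have "\<forall>\<^sub>F \<tau> in at t within {0..T}. u \<tau> \<in> U"
      using ex_openin_iff_eventually[OF t] by blast
    then show "\<forall>\<^sub>F \<tau> in at t within {0..T}. diff_distr (u \<tau>) (u t) \<in> V"
    proof eventually_elim
      case (elim \<tau>)
      then obtain c :: real where c: "c > 1" "(\<lambda>\<phi>. of_real c * diff_distr (u \<tau>) (u t) \<phi>) \<in> V" by (auto simp: U_def)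
      have "(\<lambda>\<phi>. of_real (1 / c) * (of_real c * diff_distr (u \<tau>) (u t) \<phi>) + 0 * (of_real c * diff_distr (u \<tau>) (u t) \<phi>)) \<in> V"
        by (rule ac[OF c(2) c(2)]) (use c(1) in \<open>auto simp: norm_divide\<close>)
      then show ?case using c(1) by simp
    qed
  qed
next
  assume AB: "?A \<and> ?B"
  show "continuous_into T (gevrey_topology s) u"
    unfolding continuous_into_def continuous_map_eq_topcontinuous_at topcontinuous_at_def
  proof (intro ballI conjI allI impI)
    fix t assume "t \<in> topspace (top_of_set {0..T})"
    then have t: "t \<in> {0..T}" by simp
    then show "t \<in> topspace (top_of_set {0..T})" by simp
    show "u \<in> topspace (top_of_set {0..T}) \<rightarrow> topspace (gevrey_topology s)" using AB by simp
    fix U assume U: "openin (gevrey_topology s) U \<and> u t \<in> U"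
    then obtain V where V: "V \<in> gevrey_zero_base s" "\<And>v. v \<in> V \<Longrightarrow> (\<lambda>\<phi>. u t \<phi> + v \<phi>) \<in> U"
      by (auto simp: openin_gevrey_topology)
    have "\<forall>\<^sub>F \<tau> in at t within {0..T}. diff_distr (u \<tau>) (u t) \<in> V" using AB t V(1) by blast
    then have "\<forall>\<^sub>F \<tau> in at t within {0..T}. u \<tau> \<in> U"
    proof eventually_elim
      case (elim \<tau>)
      then show ?case using V(2)[OF elim] by (simp add: diff_distr_def)
    qed
    then show "\<exists>W. openin (top_of_set {0..T}) W \<and> t \<in> W \<and> (\<forall>y\<in>W. u y \<in> U)"
      using U by (simp add: ex_openin_iff_eventually[OF t])
  qed
qed

text \<open>Summable coefficients are square summable, with the smaller norm. Index 0 is enough, as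
  a solution is only required to be continuous into some Sobolev space.\<close>

lemma gevrey_embedding:
  fixes f :: "'n::finite functional"
  assumes f: "f \<in> gevrey_step h s" and h: "h > 0" and s: "0 \<le> s"
  shows "f \<in> sobolev 0" "sobolev_norm 0 f \<le> gevrey_const CARD('n) h s (2 * CARD('n)) * gevrey_norm h s f *
    (\<Sum>\<^sub>\<infinity>\<xi>::int^'n. 1 / bracket \<xi> ^ (2 * CARD('n)))"
proof -
  have "bracket \<xi> ^ (2 * CARD('n)) * norm (fourier_coeff f \<xi>) \<le> gevrey_const CARD('n) h s (2 * CARD('n)) * gevrey_norm h s f" for \<xi>
    using bracket_coeff_le_gevrey_norm[OF f h s, of \<xi> "2 * CARD('n)" "[]"] by simp
  note S = bracket_summableI[OF this]
  have "L2_set (sobolev_weight 0 f) X \<le> (\<Sum>\<^sub>\<infinity>\<xi>. norm (fourier_coeff f \<xi>))" if "finite X" for X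
  proof -
    have "L2_set (sobolev_weight 0 f) X \<le> (\<Sum>\<xi>\<in>X. sobolev_weight 0 f \<xi>)" by (rule L2_set_le_sum) simp
    also have "\<dots> = (\<Sum>\<xi>\<in>X. norm (fourier_coeff f \<xi>))" by (simp add: sobolev_weight_def)
    also have "\<dots> \<le> (\<Sum>\<^sub>\<infinity>\<xi>. norm (fourier_coeff f \<xi>))" by (intro finite_sum_le_infsum S that) auto
    finally show ?thesis .
  qed
  from sobolevI_L2_set[OF smooth_distributions[OF gevrey_step_smooth[OF f]] _ this] S(2)
  show "f \<in> sobolev 0" "sobolev_norm 0 f \<le> gevrey_const CARD('n) h s (2 * CARD('n)) * gevrey_norm h s f *
    (\<Sum>\<^sub>\<infinity>\<xi>::int^'n. 1 / bracket \<xi> ^ (2 * CARD('n)))"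
    by (auto simp: infsum_nonneg)
qed

text \<open>For a locally convex inductive limit, boundedness of the embedding on each step already
  makes it continuous; here this becomes a statement about preimages of balls.\<close>

lemma sobolev_ball_gevrey_zero_base:
  fixes s e :: real
  assumes "0 \<le> s" "e > 0"
  defines "V \<equiv> {w :: 'n::finite functional. w \<in> gevrey s \<and> sobolev_norm 0 w < e}"
  shows "V \<in> gevrey_zero_base s"
  unfolding gevrey_zero_base_def
proof (intro CollectI conjI allI impI)
  have sob: "w \<in> sobolev 0" if "w \<in> gevrey s" for w :: "'n functional"
    using gevrey_smooth[OF that] by (simp add: smooth_def)
  show "absolutely_convex V"
    unfolding absolutely_convex_def
  proof (intro ballI allI impI)
    fix u v :: "'n functional" and a b :: complex
    assume u: "u \<in> V" and v: "v \<in> V" and ab: "norm a + norm b \<le> 1"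
    have "(\<lambda>\<phi>. a * u \<phi> + b * v \<phi>) \<in> gevrey s" using u v unfolding V_def by (intro gevrey_lincomb) auto
    \<comment> \<open>The maximum keeps the inequality strict without distinguishing the cases where
      a or b vanishes.\<close>
    define M where "M = max (sobolev_norm 0 u) (sobolev_norm 0 v)"
    have M: "0 \<le> M" "M < e" using u v by (simp_all add: M_def V_def le_max_iff_disj)
    have "sobolev_norm 0 (\<lambda>\<phi>. a * u \<phi> + b * v \<phi>) \<le> norm a * sobolev_norm 0 u + norm b * sobolev_norm 0 v"
      using u v sob unfolding V_def by (intro sobolev_lincomb) auto
    also have "\<dots> \<le> norm a * M + norm b * M"
      by (intro add_mono mult_left_mono) (auto simp: M_def)
    also have "\<dots> \<le> 1 * M" using mult_right_mono[OF ab M(1)] by (simp add: algebra_simps)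
    finally have "sobolev_norm 0 (\<lambda>\<phi>. a * u \<phi> + b * v \<phi>) < e" using M by simp
    with \<open>_ \<in> gevrey s\<close> show "(\<lambda>\<phi>. a * u \<phi> + b * v \<phi>) \<in> V" by (simp add: V_def)
  qed
  fix h :: real assume h: "h > 0"
  define K where "K = gevrey_const CARD('n) h s (2 * CARD('n)) * (\<Sum>\<^sub>\<infinity>\<xi>::int^'n. 1 / bracket \<xi> ^ (2 * CARD('n)))"
  have K: "0 \<le> K" unfolding K_def by (intro mult_nonneg_nonneg gevrey_const_nonneg h infsum_nonneg) auto
  show "\<exists>d>0. \<forall>v\<in>gevrey_step h s. gevrey_norm h s v < d \<longrightarrow> v \<in> V"
  proof (intro exI[of _ "e / (K + 1)"] conjI ballI impI)
    show "0 < e / (K + 1)" using K assms by simp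
    fix v :: "'n functional" assume v: "v \<in> gevrey_step h s" "gevrey_norm h s v < e / (K + 1)"
    have "v \<in> gevrey s" using v h by (auto simp: gevrey_iff)
    have "sobolev_norm 0 v \<le> K * gevrey_norm h s v"
      using gevrey_embedding(2)[OF v(1) h assms(1)] by (simp add: K_def mult_ac)
    also have "\<dots> \<le> (K + 1) * gevrey_norm h s v"
      using gevrey_norm_nonneg[OF v(1) h] by (intro mult_right_mono) auto
    also have "\<dots> < e" using v(2) K by (simp add: pos_less_divide_eq mult.commute)
    finally show "v \<in> V" using \<open>v \<in> gevrey s\<close> by (simp add: V_def)
  qed
qed (auto simp: V_def)

lemma continuous_into_gevrey_sobolev:
  fixes u :: "real \<Rightarrow> 'n::finite functional"
  assumes u: "continuous_into T (gevrey_topology s) u" and s: "0 \<le> s"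
  shows "continuous_into T (sobolev_topology 0) u"
  unfolding continuous_into_sobolev
proof (intro conjI ballI allI impI)
  fix t assume t: "t \<in> {0..T}"
  then have "u t \<in> gevrey s" using u by (simp add: continuous_into_gevrey)
  from gevrey_smooth[OF this] show "u t \<in> sobolev 0" by (simp add: smooth_def)
  fix e :: real assume "e > 0"
  from sobolev_ball_gevrey_zero_base[OF s this]
  have "\<forall>\<^sub>F \<tau> in at t within {0..T}. diff_distr (u \<tau>) (u t) \<in> {w. w \<in> gevrey s \<and> sobolev_norm 0 w < e}"
    using u t unfolding continuous_into_gevrey by blast
  then show "\<forall>\<^sub>F \<tau> in at t within {0..T}. sobolev_norm 0 (diff_distr (u \<tau>) (u t)) < e"
    by eventually_elim simp
qed

text \<open>Equicontinuity of the multipliers \<open>m \<sigma>\<close> on the inductive limit: the intersection of the preimages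
  of a basic neighbourhood of zero is again one.\<close>

lemma gevrey_zero_base_multiplier:
  fixes V :: "'n::finite functional set"
  assumes V: "V \<in> gevrey_zero_base s" and s: "0 \<le> s" and L: "0 \<le> L"
    and m: "\<And>\<sigma> \<xi>. \<sigma> \<in> I \<Longrightarrow> norm (m \<sigma> \<xi>) \<le> L * bracket \<xi> ^ 2"
  shows "{w \<in> gevrey s. \<forall>\<sigma>\<in>I. multiplier (m \<sigma>) w \<in> V} \<in> gevrey_zero_base s"
  unfolding gevrey_zero_base_def
proof (intro CollectI conjI allI impI)
  have dist: "multiplier (m \<sigma>) w \<in> distributions" if "w \<in> gevrey s" "\<sigma> \<in> I" for w \<sigma>
    by (rule multiplier_distribution[OF smooth_distributions[OF gevrey_smooth[OF that(1)]] m[OF that(2)]])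
  show "absolutely_convex {w \<in> gevrey s. \<forall>\<sigma>\<in>I. multiplier (m \<sigma>) w \<in> V}"
    unfolding absolutely_convex_def
  proof (intro ballI allI impI CollectI conjI)
    fix u v :: "'n functional" and a b :: complex
    assume u: "u \<in> {w \<in> gevrey s. \<forall>\<sigma>\<in>I. multiplier (m \<sigma>) w \<in> V}"
      and v: "v \<in> {w \<in> gevrey s. \<forall>\<sigma>\<in>I. multiplier (m \<sigma>) w \<in> V}" and ab: "norm a + norm b \<le> 1"
    show mem: "(\<lambda>\<phi>. a * u \<phi> + b * v \<phi>) \<in> gevrey s" using u v by (intro gevrey_lincomb) auto
    fix \<sigma> assume \<sigma>: "\<sigma> \<in> I"
    have "multiplier (m \<sigma>) (\<lambda>\<phi>. a * u \<phi> + b * v \<phi>) = (\<lambda>\<phi>. a * multiplier (m \<sigma>) u \<phi> + b * multiplier (m \<sigma>) v \<phi>)"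
      using u v mem \<sigma> by (intro distr_eqI dist distr_lincomb) (auto simp: fourier_coeff_lincomb algebra_simps)
    also have "\<dots> \<in> V"
      using V u v ab \<sigma> by (auto simp: gevrey_zero_base_def absolutely_convex_def)
    finally show "multiplier (m \<sigma>) (\<lambda>\<phi>. a * u \<phi> + b * v \<phi>) \<in> V" .
  qed
  fix h :: real assume h: "h > 0"
  define K where "K = gevrey_const CARD('n) h s (2 * CARD('n) + 2) * (\<Sum>\<^sub>\<infinity>\<xi>::int^'n. 1 / bracket \<xi> ^ (2 * CARD('n)))"
  have K: "0 \<le> L * K" unfolding K_def by (intro mult_nonneg_nonneg gevrey_const_nonneg h infsum_nonneg L) auto
  have h': "h * 2 powr s > 0" using h by simp
  then obtain e where e: "e > 0" "\<And>v. v \<in> gevrey_step (h * 2 powr s) s \<Longrightarrow> gevrey_norm (h * 2 powr s) s v < e \<Longrightarrow> v \<in> V"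
    using V by (auto simp: gevrey_zero_base_def)
  show "\<exists>d>0. \<forall>v\<in>gevrey_step h s. gevrey_norm h s v < d \<longrightarrow> v \<in> {w \<in> gevrey s. \<forall>\<sigma>\<in>I. multiplier (m \<sigma>) w \<in> V}"
  proof (intro exI[of _ "e / (L * K + 1)"] conjI ballI impI CollectI)
    show "0 < e / (L * K + 1)" using K e(1) by simp
    fix v :: "'n functional" assume v: "v \<in> gevrey_step h s" "gevrey_norm h s v < e / (L * K + 1)"
    show "v \<in> gevrey s" using v h by (auto simp: gevrey_iff)
    fix \<sigma> assume \<sigma>: "\<sigma> \<in> I"
    note M = gevrey_multiplier[OF v(1) h s m[OF \<sigma>] L]
    have "gevrey_norm (h * 2 powr s) s (multiplier (m \<sigma>) v) \<le> (L * K) * gevrey_norm h s v"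
      using M(2) by (simp add: K_def)
    also have "\<dots> \<le> (L * K + 1) * gevrey_norm h s v"
      using gevrey_norm_nonneg[OF v(1) h] by (intro mult_right_mono) auto
    also have "\<dots> < e" using v(2) K by (simp add: pos_less_divide_eq mult.commute)
    finally show "multiplier (m \<sigma>) v \<in> V" by (intro e(2) M(1))
  qed
qed auto

text \<open>The increment is half of (2 m_\<tau>)(u_\<tau> - u_t) plus half of 2 (m_\<tau> - m_t)
  u_t. The first is handled by equicontinuity; in the second, the element \<open>u t\<close> is
  fixed and lies in one step, where the norm of its image is at most a multiple of |\<tau> -
  t|.\<close>

lemma continuous_into_gevrey_multiplier:
  fixes u :: "real \<Rightarrow> 'n::finite functional"
  assumes u: "continuous_into T (gevrey_topology s) u" and m: "lipschitz_multiplier T L m"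
    and "0 \<le> T" and s: "0 \<le> s"
  shows "continuous_into T (gevrey_topology s) (\<lambda>t. multiplier (m t) (u t))"
  unfolding continuous_into_gevrey
proof (intro conjI ballI)
  have L: "0 \<le> L" by (rule lipschitz_multiplier_nonneg[OF m \<open>0 \<le> T\<close>])
  have mem: "u t \<in> gevrey s" if "t \<in> {0..T}" for t using u that by (simp add: continuous_into_gevrey)
  have dist: "u t \<in> distributions" if "t \<in> {0..T}" for t
    by (rule smooth_distributions[OF gevrey_smooth[OF mem[OF that]]])
  have mb: "norm (m t \<xi>) \<le> L * bracket \<xi> ^ 2" if "t \<in> {0..T}" for t \<xi>
    using m that by (simp add: lipschitz_multiplier_def)
  fix t assume t: "t \<in> {0..T}"
  obtain h where h: "h > 0" "u t \<in> gevrey_step h s" using mem[OF t] by (auto simp: gevrey_iff)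
  have h': "h * 2 powr s > 0" using h by simp
  show "multiplier (m t) (u t) \<in> gevrey s"
    using gevrey_multiplier(1)[OF h(2,1) s mb[OF t] L] h' by (auto simp: gevrey_iff)
  fix V :: "'n functional set" assume V: "V \<in> gevrey_zero_base s"
  have 2: "norm (2 * m \<sigma> \<xi>) \<le> (2 * L) * bracket \<xi> ^ 2" if "\<sigma> \<in> {0..T}" for \<sigma> \<xi>
    using mb[OF that, of \<xi>] by (simp add: norm_mult)
  \<comment> \<open>All \<sigma> at once: the neighbourhood must be chosen before \<tau> approaches
    t, whereas the multiplier applied to the increment varies with \<tau>.\<close>
  have A: "\<forall>\<^sub>F \<tau> in at t within {0..T}. diff_distr (u \<tau>) (u t) \<in> {w \<in> gevrey s. \<forall>\<sigma>\<in>{0..T}. multiplier (\<lambda>\<xi>. 2 * m \<sigma> \<xi>) w \<in> V}"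
  proof -
    have "0 \<le> 2 * L" using L by simp
    from gevrey_zero_base_multiplier[OF V s this, where I = "{0..T}" and m = "\<lambda>\<sigma> \<xi>. 2 * m \<sigma> \<xi>", OF 2]
    show ?thesis using u t unfolding continuous_into_gevrey by blast
  qed
  obtain e where e: "e > 0" "\<And>v. v \<in> gevrey_step (h * 2 powr s) s \<Longrightarrow> gevrey_norm (h * 2 powr s) s v < e \<Longrightarrow> v \<in> V"
    using V h' by (auto simp: gevrey_zero_base_def)
  define K where "K = gevrey_const CARD('n) h s (2 * CARD('n) + 2) * (\<Sum>\<^sub>\<infinity>\<xi>::int^'n. 1 / bracket \<xi> ^ (2 * CARD('n)))"
  have "((\<lambda>\<tau>. 2 * L * \<bar>\<tau> - t\<bar> * (K * gevrey_norm h s (u t))) \<longlongrightarrow> 2 * L * \<bar>t - t\<bar> * (K * gevrey_norm h s (u t))) (at t within {0..T})"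
    by (intro tendsto_intros)
  then have B: "\<forall>\<^sub>F \<tau> in at t within {0..T}. 2 * L * \<bar>\<tau> - t\<bar> * (K * gevrey_norm h s (u t)) < e"
    using e(1) by (intro order_tendstoD(2)[where y = 0]) auto
  have C: "\<forall>\<^sub>F \<tau> in at t within {0..T}. \<tau> \<in> {0..T}" by (auto simp: eventually_at_filter)
  from A B C show "\<forall>\<^sub>F \<tau> in at t within {0..T}. diff_distr (multiplier (m \<tau>) (u \<tau>)) (multiplier (m t) (u t)) \<in> V"
  proof eventually_elim
    case (elim \<tau>)
    have d: "norm (2 * (m \<tau> \<xi> - m t \<xi>)) \<le> (2 * L * \<bar>\<tau> - t\<bar>) * bracket \<xi> ^ 2" for \<xi>
    proof -
      have "norm (m \<tau> \<xi> - m t \<xi>) \<le> L * \<bar>\<tau> - t\<bar> * bracket \<xi> ^ 2"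
        using m t elim(3) by (simp add: lipschitz_multiplier_def)
      then show ?thesis unfolding norm_mult by simp
    qed
    have "0 \<le> 2 * L * \<bar>\<tau> - t\<bar>" using L by simp
    note M = gevrey_multiplier[OF h(2,1) s d this]
    have "multiplier (\<lambda>\<xi>. 2 * (m \<tau> \<xi> - m t \<xi>)) (u t) \<in> V"
      using M(2) elim(2) by (intro e(2) M(1)) (simp add: K_def mult.assoc)
    moreover have "multiplier (\<lambda>\<xi>. 2 * m \<tau> \<xi>) (diff_distr (u \<tau>) (u t)) \<in> V" using elim by blast
    moreover have "norm (1 / 2 :: complex) + norm (1 / 2 :: complex) \<le> 1" by (simp add: norm_divide)
    ultimately have "(\<lambda>\<phi>. 1 / 2 * multiplier (\<lambda>\<xi>. 2 * m \<tau> \<xi>) (diff_distr (u \<tau>) (u t)) \<phi> +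
        1 / 2 * multiplier (\<lambda>\<xi>. 2 * (m \<tau> \<xi> - m t \<xi>)) (u t) \<phi>) \<in> V"
      using V unfolding gevrey_zero_base_def absolutely_convex_def by blast
    then show ?case
      by (subst multiplier_diff_split[OF dist[OF elim(3)] dist[OF t] mb[OF elim(3)] mb[OF t], of 2]) simp_all
  qed
qed

subsection \<open>Smooth bump functions\<close>

text \<open>The standard flat function is the case n = 0. The negative powers make the family closed
  under differentiation up to linear combinations.\<close>

definition flat_exp :: "nat \<Rightarrow> real \<Rightarrow> real" where
  "flat_exp n x = (if x > 0 then exp (- (1 / x)) / x ^ n else 0)"

lemma flat_exp_tendsto_0: "(flat_exp n \<longlongrightarrow> 0) (at 0)"
proof -
  have "((\<lambda>x. inverse x ^ n / exp (inverse x)) \<longlongrightarrow> (0::real)) (at_right 0)"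
    by (rule filterlim_compose[OF tendsto_power_div_exp_0 filterlim_inverse_at_top_right])
  moreover have "\<forall>\<^sub>F x in at_right 0. inverse x ^ n / exp (inverse x) = flat_exp n x"
    by (auto simp: eventually_at_filter flat_exp_def exp_minus field_simps)
  ultimately have "(flat_exp n \<longlongrightarrow> 0) (at_right 0)"
    by (rule Lim_transform_eventually)
  moreover have "(flat_exp n \<longlongrightarrow> 0) (at_left 0)"
    by (rule tendsto_eventually) (auto simp: eventually_at_filter flat_exp_def)
  ultimately show ?thesis by (simp add: filterlim_split_at)
qed

lemma DERIV_flat_exp: "DERIV (flat_exp n) x :> flat_exp (n + 2) x - real n * flat_exp (n + 1) x"
proof (cases x "0 :: real" rule: linorder_cases)
  case less
  have "DERIV (\<lambda>x. 0) x :> flat_exp (n + 2) x - real n * flat_exp (n + 1) x"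
    using less by (simp add: flat_exp_def)
  then show ?thesis
  proof (rule DERIV_cong_ev[THEN iffD1, rotated -1])
    show "\<forall>\<^sub>F y in nhds x. 0 = flat_exp n y"
      using eventually_nhds_in_open[of "{..<0}" x] less by (auto elim!: eventually_mono simp: flat_exp_def)
  qed auto
next
  case equal
  \<comment> \<open>At the origin the difference quotient is itself a member of the family, with n +
    1, and all members tend to 0 there.\<close>
  have "(\<lambda>h. (flat_exp n (0 + h) - flat_exp n 0) / h) \<midarrow>0\<rightarrow> 0"
  proof (rule Lim_transform_eventually[OF flat_exp_tendsto_0[of "n + 1"]])
    show "\<forall>\<^sub>F h in at 0. flat_exp (n + 1) h = (flat_exp n (0 + h) - flat_exp n 0) / h"
      by (rule always_eventually) (simp add: flat_exp_def)
  qed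
  then show ?thesis using equal by (simp add: DERIV_def flat_exp_def)
next
  case greater
  have "DERIV (\<lambda>x. exp (- (1 / x)) / x ^ n) x :> flat_exp (n + 2) x - real n * flat_exp (n + 1) x"
  proof (cases n)
    case 0
    then show ?thesis using greater
      by (auto intro!: derivative_eq_intros simp: flat_exp_def power2_eq_square)
  next
    case (Suc m)
    have "x * x ^ (m - Suc 0) = x ^ m" if "m \<noteq> 0"
      using that by (cases m) auto
    then show ?thesis using greater unfolding Suc
      by (cases "m = 0") (auto intro!: derivative_eq_intros simp: flat_exp_def field_simps power2_eq_square)
  qed
  then show ?thesis
  proof (rule DERIV_cong_ev[THEN iffD1, rotated -1])
    show "\<forall>\<^sub>F y in nhds x. exp (- (1 / y)) / y ^ n = flat_exp n y"
      using eventually_nhds_in_open[of "{0<..}" x] greater by (auto elim!: eventually_mono simp: flat_exp_def)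
  qed auto
qed

text \<open>A class that contains the bump functions used below and is closed under differentiation.
  Smoothness of its members follows by induction, with no formula for higher derivatives; complex
  multiples are included because \<open>Dt_fun\<close> carries the factor 1 / i.\<close>

inductive_set flat_exp_algebra :: "(real \<Rightarrow> complex) set" where
  shift: "(\<lambda>t. of_real (flat_exp n (t - a))) \<in> flat_exp_algebra"
| reflect: "(\<lambda>t. of_real (flat_exp n (c - t))) \<in> flat_exp_algebra"
| add: "f \<in> flat_exp_algebra \<Longrightarrow> g \<in> flat_exp_algebra \<Longrightarrow> (\<lambda>t. f t + g t) \<in> flat_exp_algebra"
| mult: "f \<in> flat_exp_algebra \<Longrightarrow> g \<in> flat_exp_algebra \<Longrightarrow> (\<lambda>t. f t * g t) \<in> flat_exp_algebra"
| cmult: "f \<in> flat_exp_algebra \<Longrightarrow> (\<lambda>t. z * f t) \<in> flat_exp_algebra"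

lemma flat_exp_algebra_derivative:
  "f \<in> flat_exp_algebra \<Longrightarrow> \<exists>g\<in>flat_exp_algebra. \<forall>t. (f has_vector_derivative g t) (at t)"
proof (induction rule: flat_exp_algebra.induct)
  case (shift n a)
  let ?g = "\<lambda>t. complex_of_real (flat_exp (n + 2) (t - a)) + (- of_nat n) * of_real (flat_exp (n + 1) (t - a))"
  have "((\<lambda>t. complex_of_real (flat_exp n (t - a))) has_vector_derivative ?g t) (at t)" for t
  proof -
    have "((\<lambda>t. flat_exp n (t - a)) has_real_derivative (flat_exp (n + 2) (t - a) - real n * flat_exp (n + 1) (t - a)) * 1) (at t)"
      by (rule DERIV_chain2[OF DERIV_flat_exp]) (auto intro!: derivative_eq_intros)
    then have "((\<lambda>t. complex_of_real (flat_exp n (t - a))) has_vector_derivative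
        of_real (flat_exp (n + 2) (t - a) - real n * flat_exp (n + 1) (t - a))) (at t)"
      by (intro has_vector_derivative_of_real) (simp add: has_real_derivative_iff_has_vector_derivative)
    then show ?thesis by simp
  qed
  then show ?case by (intro bexI[of _ ?g] allI flat_exp_algebra.intros)
next
  case (reflect n c)
  let ?g = "\<lambda>t. (-1) * complex_of_real (flat_exp (n + 2) (c - t)) + of_nat n * of_real (flat_exp (n + 1) (c - t))"
  have "((\<lambda>t. complex_of_real (flat_exp n (c - t))) has_vector_derivative ?g t) (at t)" for t
  proof -
    have "((\<lambda>t. flat_exp n (c - t)) has_real_derivative (flat_exp (n + 2) (c - t) - real n * flat_exp (n + 1) (c - t)) * (-1)) (at t)"
      by (rule DERIV_chain2[OF DERIV_flat_exp]) (auto intro!: derivative_eq_intros)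
    then have "((\<lambda>t. complex_of_real (flat_exp n (c - t))) has_vector_derivative
        of_real ((flat_exp (n + 2) (c - t) - real n * flat_exp (n + 1) (c - t)) * (-1))) (at t)"
      by (intro has_vector_derivative_of_real) (simp add: has_real_derivative_iff_has_vector_derivative)
    then show ?thesis by simp
  qed
  then show ?case by (intro bexI[of _ ?g] allI flat_exp_algebra.intros)
next
  case (add f g)
  then obtain f' g' where "f' \<in> flat_exp_algebra" "g' \<in> flat_exp_algebra"
    "\<And>t. (f has_vector_derivative f' t) (at t)" "\<And>t. (g has_vector_derivative g' t) (at t)" by blast
  then show ?case
    by (intro bexI[of _ "\<lambda>t. f' t + g' t"]) (auto intro!: derivative_intros flat_exp_algebra.intros)
next
  case (mult f g)
  then obtain f' g' where "f' \<in> flat_exp_algebra" "g' \<in> flat_exp_algebra"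
    "\<And>t. (f has_vector_derivative f' t) (at t)" "\<And>t. (g has_vector_derivative g' t) (at t)" by blast
  then show ?case using mult
    by (intro bexI[of _ "\<lambda>t. f t * g' t + f' t * g t"])
      (auto intro!: has_vector_derivative_mult flat_exp_algebra.intros)
next
  case (cmult f z)
  then obtain f' where "f' \<in> flat_exp_algebra" "\<And>t. (f has_vector_derivative f' t) (at t)" by blast
  then show ?case
    by (intro bexI[of _ "\<lambda>t. z * f' t"]) (auto intro!: derivative_intros flat_exp_algebra.intros)
qed

lemma Dt_fun_eq: "(\<And>t. (\<theta> has_vector_derivative \<psi> t) (at t)) \<Longrightarrow> Dt_fun \<theta> = (\<lambda>t. 1 / \<i> * \<psi> t)"
  unfolding Dt_fun_def by (auto simp: vector_derivative_at)

lemma flat_exp_algebra_smooth: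
  assumes "f \<in> flat_exp_algebra"
  shows "(Dt_fun ^^ k) f differentiable (at t)"
proof -
  have D: "Dt_fun f \<in> flat_exp_algebra" if f: "f \<in> flat_exp_algebra" for f
  proof -
    obtain g where g: "g \<in> flat_exp_algebra" "\<And>t. (f has_vector_derivative g t) (at t)"
      using flat_exp_algebra_derivative[OF f] by blast
    show ?thesis unfolding Dt_fun_eq[OF g(2)] by (rule flat_exp_algebra.cmult[OF g(1)])
  qed
  have "(Dt_fun ^^ k) f \<in> flat_exp_algebra"
    by (induction k) (auto intro: assms D)
  from flat_exp_algebra_derivative[OF this] show ?thesis
    unfolding has_vector_derivative_def differentiable_def by blast
qed

text \<open>A primitive on the whole line, because \<open>time_test_functions\<close> demands
  differentiability at every real t and not only on the time interval.\<close>

lemma antiderivative_real: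
  fixes f :: "real \<Rightarrow> real"
  assumes "continuous_on UNIV f"
  obtains F where "\<And>x. (F has_vector_derivative f x) (at x)"
proof -
  have "isCont f x" for x using assms by (simp add: continuous_on_eq_continuous_at)
  then have "\<exists>F. \<forall>x. - \<infinity> < ereal x \<longrightarrow> ereal x < \<infinity> \<longrightarrow> (F has_vector_derivative f x) (at x)"
    by (intro einterval_antiderivative) auto
  then show thesis using that by auto
qed

lemma time_test_derivative:
  assumes "\<theta> \<in> time_test_functions T"
  shows "(\<theta> has_vector_derivative vector_derivative \<theta> (at t)) (at t)"
    and "continuous_on X (\<lambda>t. vector_derivative \<theta> (at t))" and "continuous_on X \<theta>"
    and "\<theta> 0 = 0" "\<theta> T = 0"
proof -
  have d: "(Dt_fun ^^ k) \<theta> differentiable (at t)" for k t using assms by (simp add: time_test_functions_def)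
  show "(\<theta> has_vector_derivative vector_derivative \<theta> (at t)) (at t)"
    using d[of 0 t] by (simp add: vector_derivative_works[symmetric])
  show "continuous_on X \<theta>"
    using d[of 0] by (auto intro!: continuous_at_imp_continuous_on differentiable_imp_continuous_within)
  have "continuous_on X (Dt_fun \<theta>)"
    using d[of 1] by (auto intro!: continuous_at_imp_continuous_on differentiable_imp_continuous_within)
  then have "continuous_on X (\<lambda>t. \<i> * Dt_fun \<theta> t)" by (intro continuous_intros)
  then show "continuous_on X (\<lambda>t. vector_derivative \<theta> (at t))" by (simp add: Dt_fun_def)
  show "\<theta> 0 = 0" "\<theta> T = 0" using assms by (auto simp: time_test_functions_def)
qed

subsection \<open>The lemma of du Bois-Reymond\<close>

lemma constant_of_vector_derivative_zero:
  fixes F :: "real \<Rightarrow> 'a::real_normed_vector"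
  assumes "convex S" "\<And>x. x \<in> S \<Longrightarrow> (F has_vector_derivative 0) (at x within S)" "x \<in> S" "y \<in> S"
  shows "F x = F y"
  by (rule has_derivative_zero_unique[OF assms(1) _ assms(3,4)])
    (use assms(2) in \<open>simp add: has_vector_derivative_def\<close>)

text \<open>Test with the primitive of a bump at a minus the same bump at b. As the two bumps have
  equal mass, the primitive has compact support, and the hypothesis says that w has the same
  weighted average around a and around b. Narrow bumps make these averages approach w a and w
  b.\<close>

lemma du_Bois_Reymond_interior:
  fixes w :: "real \<Rightarrow> complex"
  assumes w: "continuous_on {0..T} w"
    and zero: "\<And>\<theta>. \<theta> \<in> time_test_functions T \<Longrightarrow> integral {0..T} (\<lambda>t. w t * vector_derivative \<theta> (at t)) = 0"
    and ab: "a \<in> {0<..<T}" "b \<in> {0<..<T}"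
  shows "w a = w b"
proof -
  have small: "norm (w a - w b) \<le> 2 * e" if e: "e > 0" for e
  proof -
    have near: "\<exists>d>0. \<forall>t\<in>{0..T}. \<bar>t - c\<bar> < d \<longrightarrow> norm (w t - w c) \<le> e" if "c \<in> {0<..<T}" for c
    proof -
      have "c \<in> {0..T}" using that by simp
      then obtain d where "d > 0" "\<forall>t\<in>{0..T}. dist t c < d \<longrightarrow> dist (w t) (w c) < e"
        using w e unfolding continuous_on_iff by blast
      then show ?thesis by (intro exI[of _ d]) (auto simp: dist_norm less_imp_le)
    qed
    obtain d1 where d1: "d1 > 0" "\<forall>t\<in>{0..T}. \<bar>t - a\<bar> < d1 \<longrightarrow> norm (w t - w a) \<le> e" using near[OF ab(1)] by blast
    obtain d2 where d2: "d2 > 0" "\<forall>t\<in>{0..T}. \<bar>t - b\<bar> < d2 \<longrightarrow> norm (w t - w b) \<le> e" using near[OF ab(2)] by blast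
    define M where "M = Min {d1, d2, a, b, T - a, T - b}"
    have "M > 0" using d1 d2 ab by (simp add: M_def)
    have M: "M \<le> d1" "M \<le> d2" "M \<le> a" "M \<le> b" "M \<le> T - a" "M \<le> T - b" by (simp_all add: M_def)
    \<comment> \<open>Half of the minimum, so that all inequalities become strict: both bumps stay
      inside the open interval and within the region where w varies by at most e.\<close>
    define \<epsilon> where "\<epsilon> = M / 2"
    have \<epsilon>: "0 < \<epsilon>" "\<epsilon> < d1" "\<epsilon> < d2" "\<epsilon> < a" "\<epsilon> < b" "a + \<epsilon> < T" "b + \<epsilon> < T"
      using \<open>M > 0\<close> M by (auto simp: \<epsilon>_def)
    define \<beta> where "\<beta> s = flat_exp 0 (s + \<epsilon>) * flat_exp 0 (\<epsilon> - s)" for s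
    have \<beta>0: "\<beta> s = 0" if "s \<le> - \<epsilon> \<or> \<epsilon> \<le> s" for s using that by (auto simp: \<beta>_def flat_exp_def)
    have \<beta>nn: "0 \<le> \<beta> s" for s by (simp add: \<beta>_def flat_exp_def)
    have cf: "continuous_on UNIV (flat_exp 0)"
      by (intro continuous_at_imp_continuous_on ballI DERIV_isCont[OF DERIV_flat_exp])
    have "continuous_on X (\<lambda>s. flat_exp 0 (s + \<epsilon>))" "continuous_on X (\<lambda>s. flat_exp 0 (\<epsilon> - s))" for X
      by (rule continuous_on_compose2[OF cf]; auto intro!: continuous_intros)+
    then have cont\<beta>: "continuous_on X \<beta>" for X
      unfolding \<beta>_def by (intro continuous_on_mult)
    obtain B where B: "\<And>x. (B has_vector_derivative \<beta> x) (at x)"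
      using antiderivative_real[OF cont\<beta>] by blast
    have B0: "(B has_vector_derivative 0) (at x within S)" if "x \<le> - \<epsilon> \<or> \<epsilon> \<le> x" for x S
      using has_vector_derivative_at_within[OF B[of x]] \<beta>0[OF that] by simp
    have Bleft: "B s = B (- \<epsilon>)" if "s \<le> - \<epsilon>" for s
      by (rule constant_of_vector_derivative_zero[of "{..- \<epsilon>}"]) (use that B0 in auto)
    have Bright: "B s = B \<epsilon>" if "\<epsilon> \<le> s" for s
      by (rule constant_of_vector_derivative_zero[of "{\<epsilon>..}"]) (use that B0 in auto)
    define I where "I = B \<epsilon> - B (- \<epsilon>)"
    have "B (- \<epsilon>) < B \<epsilon>"
    proof (rule DERIV_pos_imp_increasing_open[of "- \<epsilon>" \<epsilon> B])
      show "\<exists>y. DERIV B x :> y \<and> y > 0" if "- \<epsilon> < x" "x < \<epsilon>" for x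
        using B[of x] that
        by (intro exI[of _ "\<beta> x"]) (simp add: has_real_derivative_iff_has_vector_derivative \<beta>_def flat_exp_def)
      show "continuous_on {- \<epsilon>..\<epsilon>} B"
        using B by (meson continuous_at_imp_continuous_on has_vector_derivative_continuous)
    qed (use \<epsilon> in simp)
    then have "I > 0" by (simp add: I_def)
    have shift: "((\<lambda>t. B (t - c)) has_vector_derivative \<beta> (t - c)) (at t)" for t c
    proof -
      have "((\<lambda>t. t - c) has_vector_derivative 1) (at t)" by (auto intro!: derivative_eq_intros)
      from vector_diff_chain_at[OF this B] show ?thesis by (simp add: o_def)
    qed
    \<comment> \<open>To the left of both bumps the two terms equal \<open>B (- \<epsilon>)\<close>,
      to the right they equal \<open>B \<epsilon>\<close>; in either case they cancel.\<close>
    define \<theta> where "\<theta> t = complex_of_real (B (t - a) - B (t - b))" for t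
    define \<psi> where "\<psi> t = complex_of_real (\<beta> (t - a)) + (-1) * of_real (\<beta> (t - b))" for t
    have \<theta>d: "(\<theta> has_vector_derivative \<psi> t) (at t)" for t
    proof -
      have "((\<lambda>t. complex_of_real (B (t - a) - B (t - b))) has_vector_derivative of_real (\<beta> (t - a) - \<beta> (t - b))) (at t)"
        by (rule has_vector_derivative_of_real, unfold has_real_derivative_iff_has_vector_derivative)
          (intro has_vector_derivative_diff shift)
      then show ?thesis by (simp add: \<theta>_def[abs_def] \<psi>_def)
    qed
    have \<psi>alg: "\<psi> \<in> flat_exp_algebra"
    proof -
      have eq: "complex_of_real (\<beta> (t - c)) = of_real (flat_exp 0 (t - (c - \<epsilon>))) * of_real (flat_exp 0 ((c + \<epsilon>) - t))" for t c
        by (simp add: \<beta>_def algebra_simps)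
      show ?thesis unfolding \<psi>_def[abs_def] eq by (intro flat_exp_algebra.intros)
    qed
    have "\<theta> \<in> time_test_functions T"
      unfolding time_test_functions_def
    proof (intro CollectI conjI allI)
      fix k t
      show "(Dt_fun ^^ k) \<theta> differentiable (at t)"
      proof (cases k)
        case 0
        then show ?thesis using \<theta>d unfolding has_vector_derivative_def differentiable_def by auto
      next
        case (Suc m)
        have "(Dt_fun ^^ k) \<theta> = (Dt_fun ^^ m) (Dt_fun \<theta>)" unfolding Suc funpow_Suc_right by simp
        then show ?thesis
          unfolding Dt_fun_eq[OF \<theta>d] by (simp only: flat_exp_algebra_smooth[OF flat_exp_algebra.cmult[OF \<psi>alg]])
      qed
      show "\<exists>K. compact K \<and> K \<subseteq> {0<..<T} \<and> (\<forall>t. t \<notin> K \<longrightarrow> \<theta> t = 0)"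
      proof (intro exI[of _ "{min a b - \<epsilon>..max a b + \<epsilon>}"] conjI allI impI)
        show "{min a b - \<epsilon>..max a b + \<epsilon>} \<subseteq> {0<..<T}" using \<epsilon> ab by auto
        fix t assume "t \<notin> {min a b - \<epsilon>..max a b + \<epsilon>}"
        then have "(t - a \<le> - \<epsilon> \<and> t - b \<le> - \<epsilon>) \<or> (\<epsilon> \<le> t - a \<and> \<epsilon> \<le> t - b)" by auto
        then show "\<theta> t = 0"
        proof
          assume "t - a \<le> - \<epsilon> \<and> t - b \<le> - \<epsilon>"
          then show ?thesis using Bleft[of "t - a"] Bleft[of "t - b"] by (simp add: \<theta>_def)
        next
          assume "\<epsilon> \<le> t - a \<and> \<epsilon> \<le> t - b"
          then show ?thesis using Bright[of "t - a"] Bright[of "t - b"] by (simp add: \<theta>_def)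
        qed
      qed auto
    qed
    from zero[OF this] have "integral {0..T} (\<lambda>t. w t * \<psi> t) = 0"
      using vector_derivative_at[OF \<theta>d] by simp
    have cont\<beta>': "continuous_on X (\<lambda>t. complex_of_real (\<beta> (t - c)))" for X c
      by (rule continuous_on_of_real, rule continuous_on_compose2[OF cont\<beta>[of UNIV]])
        (auto intro!: continuous_intros)
    define J where "J c = integral {0..T} (\<lambda>t. w t * of_real (\<beta> (t - c)))" for c
    have "integral {0..T} (\<lambda>t. w t * \<psi> t) = J a + (-1) * J b"
    proof -
      have eq: "(\<lambda>t. w t * \<psi> t) = (\<lambda>t. w t * of_real (\<beta> (t - a)) + (-1) * (w t * of_real (\<beta> (t - b))))"
        by (simp add: \<psi>_def algebra_simps)
      have i: "(\<lambda>t. w t * complex_of_real (\<beta> (t - c))) integrable_on {0..T}" for c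
        by (intro integrable_continuous_real continuous_intros w cont\<beta>')
      show ?thesis unfolding J_def eq integral_add[OF i integrable_on_mult_right[OF i]] by simp
    qed
    then have "J a = J b" using \<open>integral {0..T} (\<lambda>t. w t * \<psi> t) = 0\<close> by simp
    \<comment> \<open>With I the mass of the bump, \<open>J c / I\<close> is a weighted average of w
      over a neighbourhood of c where w deviates from \<open>w c\<close> by at most e.\<close>
    have J: "norm (J c - w c * of_real I) \<le> e * I"
      if c: "c \<in> {0<..<T}" "\<epsilon> < c" "c + \<epsilon> < T" "\<forall>t\<in>{0..T}. \<bar>t - c\<bar> < \<epsilon> \<longrightarrow> norm (w t - w c) \<le> e" for c
    proof -
      have "((\<lambda>t. \<beta> (t - c)) has_integral (B (T - c) - B (0 - c))) {0..T}"
        using c by (intro fundamental_theorem_of_calculus has_vector_derivative_at_within[OF shift]) auto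
      then have hI: "((\<lambda>t. \<beta> (t - c)) has_integral I) {0..T}"
        using Bleft[of "0 - c"] Bright[of "T - c"] c by (simp add: I_def)
      have hIc: "((\<lambda>t. w c * of_real (\<beta> (t - c))) has_integral w c * of_real I) {0..T}"
        by (intro has_integral_mult_right has_integral_of_real hI)
      have hJ: "((\<lambda>t. w t * of_real (\<beta> (t - c))) has_integral J c) {0..T}"
        unfolding J_def by (intro integrable_integral integrable_continuous_real continuous_intros w cont\<beta>')
      have hd: "((\<lambda>t. (w t - w c) * of_real (\<beta> (t - c))) has_integral J c - w c * of_real I) {0..T}"
        using has_integral_diff[OF hJ hIc] by (simp add: algebra_simps)
      have he: "((\<lambda>t. e * \<beta> (t - c)) has_integral e * I) {0..T}"
        by (intro has_integral_mult_right hI)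
      have "norm (integral {0..T} (\<lambda>t. (w t - w c) * of_real (\<beta> (t - c)))) \<le> integral {0..T} (\<lambda>t. e * \<beta> (t - c))"
      proof (rule integral_norm_bound_integral)
        fix t assume t: "t \<in> {0..T}"
        show "norm ((w t - w c) * of_real (\<beta> (t - c))) \<le> e * \<beta> (t - c)"
        proof (cases "\<bar>t - c\<bar> < \<epsilon>")
          case True
          then show ?thesis using c(4) t \<beta>nn by (simp add: norm_mult mult_right_mono)
        next
          case False
          then have "\<beta> (t - c) = 0" by (intro \<beta>0) auto
          then show ?thesis by simp
        qed
      qed (use hd he in \<open>auto simp: has_integral_integrable\<close>)
      then show ?thesis by (simp only: integral_unique[OF hd] integral_unique[OF he])
    qed
    have "norm (J a - w a * of_real I) \<le> e * I" using \<epsilon> ab d1 by (intro J) auto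
    moreover have "norm (J b - w b * of_real I) \<le> e * I" using \<epsilon> ab d2 by (intro J) auto
    ultimately have "norm ((J b - w b * of_real I) - (J a - w a * of_real I)) \<le> 2 * (e * I)"
      using norm_triangle_ineq4[of "J b - w b * of_real I" "J a - w a * of_real I"] by linarith
    moreover have "(J b - w b * of_real I) - (J a - w a * of_real I) = (w a - w b) * of_real I"
      using \<open>J a = J b\<close> by (simp add: algebra_simps)
    ultimately have "norm (w a - w b) * I \<le> (2 * e) * I" using \<open>I > 0\<close> by (simp add: norm_mult)
    then show ?thesis using \<open>I > 0\<close> by simp
  qed
  have "norm (w a - w b) \<le> 0"
  proof (rule field_le_epsilon)
    fix e :: real assume "e > 0"
    then show "norm (w a - w b) \<le> 0 + e" using small[of "e / 2"] by simp
  qed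
  then show ?thesis by simp
qed

text \<open>Continuity extends the constancy from the open interval to its closure; the endpoint 0
  matters because the initial condition is posed there.\<close>

lemma du_Bois_Reymond:
  fixes w :: "real \<Rightarrow> complex"
  assumes "0 < T" and w: "continuous_on {0..T} w"
    and zero: "\<And>\<theta>. \<theta> \<in> time_test_functions T \<Longrightarrow> integral {0..T} (\<lambda>t. w t * vector_derivative \<theta> (at t)) = 0"
    and t: "t \<in> {0..T}"
  shows "w t = w 0"
proof -
  have eq: "w s = w (T / 2)" if "s \<in> {0<..<T}" for s
    by (rule du_Bois_Reymond_interior[OF w zero]) (use that \<open>0 < T\<close> in auto)
  have cl: "closure {0<..<T} = {0..T}" using \<open>0 < T\<close> by simp
  have "w s = w (T / 2)" if "s \<in> {0..T}" for s
    using continuous_constant_on_closure[of "{0<..<T}" w "w (T / 2)" s] w eq that unfolding cl by blast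
  from this[OF t] this[of 0] show ?thesis using \<open>0 < T\<close> by simp
qed

lemma integral_by_parts_time_test:
  assumes "0 \<le> T" and Y: "\<And>t. t \<in> {0..T} \<Longrightarrow> (Y has_vector_derivative q t) (at t within {0..T})"
    and q: "continuous_on {0..T} q" and \<theta>: "\<theta> \<in> time_test_functions T"
  shows "integral {0..T} (\<lambda>t. Y t * vector_derivative \<theta> (at t)) = - integral {0..T} (\<lambda>t. q t * \<theta> t)"
proof -
  have contY: "continuous_on {0..T} Y"
    unfolding continuous_on_eq_continuous_within using Y has_vector_derivative_continuous by blast
  have "((\<lambda>t. Y t * vector_derivative \<theta> (at t) + q t * \<theta> t) has_integral Y T * \<theta> T - Y 0 * \<theta> 0) {0..T}"
    by (rule fundamental_theorem_of_calculus[OF \<open>0 \<le> T\<close>])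
      (intro has_vector_derivative_mult Y has_vector_derivative_at_within[OF time_test_derivative(1)[OF \<theta>]])
  then have "integral {0..T} (\<lambda>t. Y t * vector_derivative \<theta> (at t) + q t * \<theta> t) = 0"
    by (simp add: integral_unique time_test_derivative(4,5)[OF \<theta>])
  moreover have "integral {0..T} (\<lambda>t. Y t * vector_derivative \<theta> (at t) + q t * \<theta> t) =
      integral {0..T} (\<lambda>t. Y t * vector_derivative \<theta> (at t)) + integral {0..T} (\<lambda>t. q t * \<theta> t)"
    by (intro integral_add integrable_continuous_real continuous_intros contY q time_test_derivative(2,3)[OF \<theta>])
  ultimately show ?thesis by (simp add: eq_neg_iff_add_eq_0)
qed

text \<open>Forwards, y minus the primitive of q has weak derivative zero, hence is constant.
  Backwards, integration by parts has no boundary terms, since test functions vanish at both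
  ends.\<close>

lemma weak_derivative_iff:
  fixes y q :: "real \<Rightarrow> complex"
  assumes "0 < T" and y: "continuous_on {0..T} y" and q: "continuous_on {0..T} q"
  shows "(\<forall>\<theta>\<in>time_test_functions T. integral {0..T} (\<lambda>t. y t * vector_derivative \<theta> (at t)) = - integral {0..T} (\<lambda>t. q t * \<theta> t))
    \<longleftrightarrow> (\<forall>t\<in>{0..T}. y t = y 0 + integral {0..t} q)" (is "?L \<longleftrightarrow> ?R")
proof -
  define Q where "Q t = integral {0..t} q" for t
  have Q: "(Q has_vector_derivative q t) (at t within {0..T})" if "t \<in> {0..T}" for t
    unfolding Q_def using integral_has_vector_derivative[OF q that] .
  have contQ: "continuous_on {0..T} Q"
    unfolding continuous_on_eq_continuous_within using Q has_vector_derivative_continuous by blast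
  have T: "0 \<le> T" using \<open>0 < T\<close> by simp
  note IQ = integral_by_parts_time_test[OF T Q q]
  show ?thesis
  proof
    assume L: ?L
    have *: "y t - Q t = y 0 - Q 0" if "t \<in> {0..T}" for t
    proof (rule du_Bois_Reymond[OF \<open>0 < T\<close> _ _ that])
      show "continuous_on {0..T} (\<lambda>t. y t - Q t)" by (intro continuous_intros y contQ)
      fix \<theta> assume \<theta>: "\<theta> \<in> time_test_functions T"
      have "integral {0..T} (\<lambda>t. (y t - Q t) * vector_derivative \<theta> (at t)) =
          integral {0..T} (\<lambda>t. y t * vector_derivative \<theta> (at t)) - integral {0..T} (\<lambda>t. Q t * vector_derivative \<theta> (at t))"
        unfolding left_diff_distrib
        by (intro integral_diff integrable_continuous_real continuous_intros y contQ time_test_derivative(2)[OF \<theta>])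
      then show "integral {0..T} (\<lambda>t. (y t - Q t) * vector_derivative \<theta> (at t)) = 0"
        using L \<theta> IQ[OF _ \<theta>] by simp
    qed
    show ?R
    proof
      fix t assume "t \<in> {0..T}"
      from *[OF this] show "y t = y 0 + integral {0..t} q" by (simp add: Q_def diff_eq_eq)
    qed
  next
    assume R: ?R
    have Y: "(y has_vector_derivative q t) (at t within {0..T})" if t: "t \<in> {0..T}" for t
    proof (rule has_vector_derivative_transform[OF t])
      show "y s = y 0 + Q s" if "s \<in> {0..T}" for s using R that unfolding Q_def by blast
      show "((\<lambda>s. y 0 + Q s) has_vector_derivative q t) (at t within {0..T})"
        using has_vector_derivative_add[OF has_vector_derivative_const[of "y 0"] Q[OF t]] by (simp only: add_0_left)
    qed
    show ?L using integral_by_parts_time_test[OF T Y q] by blast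
  qed
qed

text \<open>The first formula is the integrated form of y' + i p y = i f, and the product rule gives
  (E y)' = i E f. Both directions are used: one for a given solution, the other to certify the
  conjugated curve as a solution.\<close>

lemma integrating_factor:
  fixes p y f :: "real \<Rightarrow> complex"
  assumes "0 \<le> T" and p: "continuous_on {0..T} p" and f: "continuous_on {0..T} f" and y: "continuous_on {0..T} y"
  defines "E \<equiv> \<lambda>t. exp (\<i> * integral {0..t} p)"
  shows "(\<forall>t\<in>{0..T}. y t = y 0 + integral {0..t} (\<lambda>s. \<i> * (f s - p s * y s))) \<longleftrightarrow>
    (\<forall>t\<in>{0..T}. E t * y t = y 0 + \<i> * integral {0..t} (\<lambda>s. E s * f s))" (is "?L \<longleftrightarrow> ?R")
proof -
  have E: "(E has_vector_derivative \<i> * p t * E t) (at t within {0..T})" if "t \<in> {0..T}" for t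
  proof -
    have "((\<lambda>t. \<i> * integral {0..t} p) has_vector_derivative \<i> * p t) (at t within {0..T})"
      by (intro derivative_intros integral_has_vector_derivative p that)
    from field_vector_diff_chain_within[OF this, of exp "exp (\<i> * integral {0..t} p)"]
    show ?thesis by (simp add: E_def o_def mult_ac DERIV_subset[OF DERIV_exp])
  qed
  have E0: "E 0 = 1" by (simp add: E_def)
  have contE: "continuous_on {0..T} E"
    unfolding continuous_on_eq_continuous_within using E has_vector_derivative_continuous by blast
  have Eneq: "E t \<noteq> 0" for t by (simp add: E_def)
  have Ef: "((\<lambda>t. integral {0..t} (\<lambda>s. E s * f s)) has_vector_derivative E t * f t) (at t within {0..T})" if "t \<in> {0..T}" for t
    by (rule integral_has_vector_derivative[OF _ that]) (intro continuous_intros contE f)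
  have q: "((\<lambda>t. integral {0..t} (\<lambda>s. \<i> * (f s - p s * y s))) has_vector_derivative \<i> * (f t - p t * y t)) (at t within {0..T})"
    if "t \<in> {0..T}" for t
    by (rule integral_has_vector_derivative[OF _ that]) (intro continuous_intros p y f)
  have const: "F t = F 0" if "\<And>t. t \<in> {0..T} \<Longrightarrow> (F has_vector_derivative 0) (at t within {0..T})" "t \<in> {0..T}"
    for F :: "real \<Rightarrow> complex" and t
    by (rule constant_of_vector_derivative_zero[of "{0..T}"]) (use that \<open>0 \<le> T\<close> in auto)
  show ?thesis
  proof
    assume L: ?L
    have Y: "(y has_vector_derivative \<i> * (f t - p t * y t)) (at t within {0..T})" if t: "t \<in> {0..T}" for t
    proof (rule has_vector_derivative_transform[OF t])
      show "y s = y 0 + integral {0..s} (\<lambda>s. \<i> * (f s - p s * y s))" if "s \<in> {0..T}" for s using L that by blast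
      show "((\<lambda>s. y 0 + integral {0..s} (\<lambda>s. \<i> * (f s - p s * y s))) has_vector_derivative \<i> * (f t - p t * y t)) (at t within {0..T})"
        using has_vector_derivative_add[OF has_vector_derivative_const[of "y 0"] q[OF t]] by (simp only: add_0_left)
    qed
    show ?R
    proof
      fix t assume t: "t \<in> {0..T}"
      have "E t * y t - \<i> * integral {0..t} (\<lambda>s. E s * f s) = E 0 * y 0 - \<i> * integral {0..0} (\<lambda>s. E s * f s)"
      proof (rule const[OF _ t])
        fix s assume s: "s \<in> {0..T}"
        have "((\<lambda>t. E t * y t - \<i> * integral {0..t} (\<lambda>s. E s * f s)) has_vector_derivative
            (E s * (\<i> * (f s - p s * y s)) + \<i> * p s * E s * y s) - \<i> * (E s * f s)) (at s within {0..T})"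
          by (intro has_vector_derivative_diff has_vector_derivative_mult has_vector_derivative_mult_right E Y Ef s)
        then show "((\<lambda>t. E t * y t - \<i> * integral {0..t} (\<lambda>s. E s * f s)) has_vector_derivative 0) (at s within {0..T})"
          by (simp add: algebra_simps)
      qed
      then show "E t * y t = y 0 + \<i> * integral {0..t} (\<lambda>s. E s * f s)" by (simp add: E0 algebra_simps)
    qed
  next
    assume R: ?R
    \<comment> \<open>The reciprocal of E in exponential form, so that its derivative comes from the
      chain rule.\<close>
    define V where "V t = exp (- (\<i> * integral {0..t} p))" for t
    have VE: "V t * E t = 1" for t by (simp add: V_def E_def flip: exp_add)
    have V: "(V has_vector_derivative - (\<i> * p t) * V t) (at t within {0..T})" if "t \<in> {0..T}" for t
    proof -
      have "((\<lambda>t. - (\<i> * integral {0..t} p)) has_vector_derivative - (\<i> * p t)) (at t within {0..T})"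
        by (intro derivative_intros integral_has_vector_derivative p that)
      from field_vector_diff_chain_within[OF this, of exp "exp (- (\<i> * integral {0..t} p))"]
      show ?thesis by (simp add: V_def[abs_def] o_def mult_ac DERIV_subset[OF DERIV_exp])
    qed
    have yV: "y t = V t * (y 0 + \<i> * integral {0..t} (\<lambda>s. E s * f s))" if "t \<in> {0..T}" for t
      using R that VE[of t] by (metis mult.assoc mult_1)
    have Y: "(y has_vector_derivative \<i> * (f t - p t * y t)) (at t within {0..T})" if t: "t \<in> {0..T}" for t
    proof (rule has_vector_derivative_transform[OF t yV])
      have d: "((\<lambda>t. V t * (y 0 + \<i> * integral {0..t} (\<lambda>s. E s * f s))) has_vector_derivative
          V t * (0 + \<i> * (E t * f t)) + - (\<i> * p t) * V t * (y 0 + \<i> * integral {0..t} (\<lambda>s. E s * f s))) (at t within {0..T})"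
        by (intro has_vector_derivative_mult has_vector_derivative_add has_vector_derivative_const has_vector_derivative_mult_right V Ef t)
      have a: "V t * (0 + \<i> * (E t * f t)) = \<i> * f t" using VE[of t] by (simp add: mult_ac)
      have b: "- (\<i> * p t) * V t * (y 0 + \<i> * integral {0..t} (\<lambda>s. E s * f s)) = - (\<i> * p t) * y t"
        using yV[OF t] by (simp add: mult.assoc)
      have "\<i> * f t + - (\<i> * p t) * y t = \<i> * (f t - p t * y t)" by (simp add: algebra_simps)
      with d show "((\<lambda>t. V t * (y 0 + \<i> * integral {0..t} (\<lambda>s. E s * f s))) has_vector_derivative \<i> * (f t - p t * y t)) (at t within {0..T})"
        unfolding a b by (simp only:)
    qed
    show ?L
    proof
      fix t assume t: "t \<in> {0..T}"
      have "y t - integral {0..t} (\<lambda>s. \<i> * (f s - p s * y s)) = y 0 - integral {0..0} (\<lambda>s. \<i> * (f s - p s * y s))"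
      proof (rule const[OF _ t])
        fix s assume s: "s \<in> {0..T}"
        show "((\<lambda>t. y t - integral {0..t} (\<lambda>s. \<i> * (f s - p s * y s))) has_vector_derivative 0) (at s within {0..T})"
          using has_vector_derivative_diff[OF Y[OF s] q[OF s]] by simp
      qed
      then show "y t = y 0 + integral {0..t} (\<lambda>s. \<i> * (f s - p s * y s))" by (simp add: algebra_simps)
    qed
  qed
qed

subsection \<open>Curves of distributions\<close>

text \<open>The common ground of the function spaces involved. It is stable under the spatial
  operators, which would lower a Sobolev index, and the order k uniform in t ensures that time
  integrals are again distributions.\<close>

definition distr_curve :: "real \<Rightarrow> (real \<Rightarrow> 'n::finite functional) \<Rightarrow> bool" where
  "distr_curve T v \<longleftrightarrow> (\<forall>t\<in>{0..T}. v t \<in> distributions) \<and>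
     (\<exists>C\<ge>0. \<exists>k. \<forall>t\<in>{0..T}. \<forall>\<phi>\<in>test_functions. norm (v t \<phi>) \<le> C * C_seminorm k \<phi>) \<and>
     (\<forall>\<phi>\<in>test_functions. continuous_on {0..T} (\<lambda>t. v t \<phi>))"

lemma distr_curve_sobolev:
  assumes u: "continuous_into T (sobolev_topology r) (u :: real \<Rightarrow> 'n::finite functional)"
  shows "distr_curve T u"
proof -
  obtain C k where "C \<ge> 0" "\<And>t \<phi>. t \<in> {0..T} \<Longrightarrow> \<phi> \<in> test_functions \<Longrightarrow> norm (u t \<phi>) \<le> C * C_seminorm k \<phi>"
    using continuous_into_sobolev_bound[OF u] by blast
  then have "\<exists>C\<ge>0. \<exists>k. \<forall>t\<in>{0..T}. \<forall>\<phi>\<in>test_functions. norm (u t \<phi>) \<le> C * C_seminorm k \<phi>" by blast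
  moreover have "\<forall>t\<in>{0..T}. u t \<in> distributions"
    using u sobolev_distributions unfolding continuous_into_sobolev by blast
  ultimately show ?thesis
    unfolding distr_curve_def using continuous_into_sobolev_apply[OF u] by blast
qed

lemma distr_curve_fourier_coeff:
  "distr_curve T v \<Longrightarrow> continuous_on {0..T} (\<lambda>t. fourier_coeff (v t) \<xi>)"
  unfolding fourier_coeff_wave by (simp add: distr_curve_def)

lemma distr_curve_add:
  fixes v w :: "real \<Rightarrow> 'n::finite functional"
  assumes v: "distr_curve T v" and w: "distr_curve T w"
  shows "distr_curve T (\<lambda>t \<phi>. v t \<phi> + w t \<phi>)"
proof -
  obtain C k where C: "C \<ge> 0" "\<And>t \<phi>. t \<in> {0..T} \<Longrightarrow> \<phi> \<in> test_functions \<Longrightarrow> norm (v t \<phi>) \<le> C * C_seminorm k \<phi>"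
    using v unfolding distr_curve_def by blast
  obtain D l where D: "D \<ge> 0" "\<And>t \<phi>. t \<in> {0..T} \<Longrightarrow> \<phi> \<in> test_functions \<Longrightarrow> norm (w t \<phi>) \<le> D * C_seminorm l \<phi>"
    using w unfolding distr_curve_def by blast
  have "norm (v t \<phi> + w t \<phi>) \<le> (C + D) * C_seminorm (max k l) \<phi>" if t: "t \<in> {0..T}" and \<phi>: "\<phi> \<in> test_functions" for t \<phi>
  proof -
    have "norm (v t \<phi>) \<le> C * C_seminorm (max k l) \<phi>"
      using C(2)[OF t \<phi>] mult_left_mono[OF C_seminorm_mono[OF \<phi>, of k "max k l"] C(1)] by simp
    moreover have "norm (w t \<phi>) \<le> D * C_seminorm (max k l) \<phi>"
      using D(2)[OF t \<phi>] mult_left_mono[OF C_seminorm_mono[OF \<phi>, of l "max k l"] D(1)] by simp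
    ultimately show ?thesis
      using norm_triangle_ineq[of "v t \<phi>" "w t \<phi>"] by (simp add: distrib_right)
  qed
  then have "\<exists>C\<ge>0. \<exists>k. \<forall>t\<in>{0..T}. \<forall>\<phi>\<in>test_functions. norm (v t \<phi> + w t \<phi>) \<le> C * C_seminorm k \<phi>"
    using add_nonneg_nonneg[OF C(1) D(1)] by blast
  moreover have "(\<lambda>\<phi>. v t \<phi> + w t \<phi>) \<in> distributions" if "t \<in> {0..T}" for t
    using distr_lincomb[of "v t" "w t" 1 1] v w that by (simp add: distr_curve_def)
  ultimately show ?thesis
    using v w unfolding distr_curve_def by (auto intro: continuous_on_add)
qed

lemma distr_curve_scale:
  fixes v :: "real \<Rightarrow> 'n::finite functional"
  assumes v: "distr_curve T v" and c: "continuous_on {0..T} c"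
  shows "distr_curve T (\<lambda>t \<phi>. c t * v t \<phi>)"
proof -
  obtain C k where C: "C \<ge> 0" "\<And>t \<phi>. t \<in> {0..T} \<Longrightarrow> \<phi> \<in> test_functions \<Longrightarrow> norm (v t \<phi>) \<le> C * C_seminorm k \<phi>"
    using v unfolding distr_curve_def by blast
  have "bounded (c ` {0..T})" by (intro compact_imp_bounded compact_continuous_image c) auto
  then obtain B where B: "B > 0" "\<And>t. t \<in> {0..T} \<Longrightarrow> norm (c t) \<le> B" by (auto simp: bounded_pos)
  have "norm (c t * v t \<phi>) \<le> (B * C) * C_seminorm k \<phi>" if t: "t \<in> {0..T}" and \<phi>: "\<phi> \<in> test_functions" for t \<phi>
    unfolding norm_mult mult.assoc using B C(2)[OF t \<phi>] t by (intro mult_mono) auto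
  then have "\<exists>C\<ge>0. \<exists>k. \<forall>t\<in>{0..T}. \<forall>\<phi>\<in>test_functions. norm (c t * v t \<phi>) \<le> C * C_seminorm k \<phi>"
    using mult_nonneg_nonneg[OF less_imp_le[OF B(1)] C(1)] by blast
  moreover have "(\<lambda>\<phi>. c t * v t \<phi>) \<in> distributions" if "t \<in> {0..T}" for t
    using distr_lincomb[of "v t" "v t" "c t" 0] v that by (simp add: distr_curve_def)
  ultimately show ?thesis
    using v c unfolding distr_curve_def by (auto intro: continuous_on_mult)
qed

lemma distr_curve_sum:
  fixes v :: "'i \<Rightarrow> real \<Rightarrow> 'n::finite functional"
  assumes "finite I" "I \<noteq> {}" "\<And>i. i \<in> I \<Longrightarrow> distr_curve T (v i)"
  shows "distr_curve T (\<lambda>t \<phi>. \<Sum>i\<in>I. v i t \<phi>)"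
  using assms
proof (induction I rule: finite_ne_induct)
  case (insert i I)
  then show ?case using distr_curve_add[of T "v i" "\<lambda>t \<phi>. \<Sum>i\<in>I. v i t \<phi>"] by simp
qed simp

lemma partial_eq_D_fun: "partial j \<phi> = (\<lambda>x. \<i> * D_fun [j] \<phi> x)"
  by (simp add: Dx_fun_eq)

lemma C_seminorm_partial_le:
  fixes \<phi> :: "real ^ 'n::finite \<Rightarrow> complex"
  assumes "\<phi> \<in> test_functions"
  shows "C_seminorm k (partial j \<phi>) \<le> C_seminorm (k + 1) \<phi>"
proof (rule C_seminorm_le)
  fix js :: "'n list" and x assume "length js \<le> k"
  have "D_fun js (partial j \<phi>) x = \<i> * D_fun (js @ [j]) \<phi> x"
    unfolding partial_eq_D_fun D_fun_cmult[OF D_fun_test[OF assms]] D_fun_append ..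
  then have "norm (D_fun js (partial j \<phi>) x) = norm (D_fun (js @ [j]) \<phi> x)" by (simp add: norm_mult)
  also have "\<dots> \<le> C_seminorm (k + 1) \<phi>"
    using \<open>length js \<le> k\<close> by (intro norm_le_C_seminorm assms) auto
  finally show "norm (D_fun js (partial j \<phi>) x) \<le> C_seminorm (k + 1) \<phi>" .
qed

lemma partial_distr_distribution:
  fixes u :: "'n::finite functional"
  assumes u: "u \<in> distributions"
  shows "partial_distr j u \<in> distributions"
  unfolding distributions_def
proof (intro CollectI conjI allI ballI impI)
  obtain C k where C: "C \<ge> 0" "\<And>\<phi>. \<phi> \<in> test_functions \<Longrightarrow> norm (u \<phi>) \<le> C * C_seminorm k \<phi>"
    using distr_bound[OF u] by blast
  have "norm (partial_distr j u \<phi>) \<le> C * C_seminorm (k + 1) \<phi>" if \<phi>: "\<phi> \<in> test_functions" for \<phi>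
    using C(2)[OF test_partial[OF \<phi>, of j]] mult_left_mono[OF C_seminorm_partial_le[OF \<phi>, of k j] C(1)] \<phi>
    by (simp add: partial_distr_def)
  then show "\<exists>C k. \<forall>\<phi>\<in>test_functions. norm (partial_distr j u \<phi>) \<le> C * C_seminorm k \<phi>" by blast
  have hp: "has_partial j \<phi> (partial j \<phi>)" if "\<phi> \<in> test_functions" for \<phi> :: "real ^ 'n \<Rightarrow> complex"
    using test_has_partial[OF that, of j "[]"] by simp
  show "partial_distr j u (\<lambda>x. \<phi> x + \<psi> x) = partial_distr j u \<phi> + partial_distr j u \<psi>"
    if "\<phi> \<in> test_functions" "\<psi> \<in> test_functions" for \<phi> \<psi>
    using that has_partial_partial[OF has_partial_add[OF hp hp], OF that]
    by (simp add: partial_distr_def distr_add[OF u])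
  show "partial_distr j u (\<lambda>x. c * \<phi> x) = c * partial_distr j u \<phi>" if "\<phi> \<in> test_functions" for c \<phi>
    using that has_partial_partial[OF has_partial_cmult[OF hp], OF that]
    by (simp add: partial_distr_def distr_cmult[OF u])
qed (simp add: partial_distr_def)

lemma distr_curve_partial:
  fixes v :: "real \<Rightarrow> 'n::finite functional"
  assumes v: "distr_curve T v"
  shows "distr_curve T (\<lambda>t. partial_distr j (v t))"
proof -
  obtain C k where C: "C \<ge> 0" "\<And>t \<phi>. t \<in> {0..T} \<Longrightarrow> \<phi> \<in> test_functions \<Longrightarrow> norm (v t \<phi>) \<le> C * C_seminorm k \<phi>"
    using v unfolding distr_curve_def by blast
  have "norm (partial_distr j (v t) \<phi>) \<le> C * C_seminorm (k + 1) \<phi>" if t: "t \<in> {0..T}" and \<phi>: "\<phi> \<in> test_functions" for t \<phi>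
    using C(2)[OF t test_partial[OF \<phi>, of j]] mult_left_mono[OF C_seminorm_partial_le[OF \<phi>, of k j] C(1)] \<phi>
    by (simp add: partial_distr_def)
  then have "\<exists>C\<ge>0. \<exists>k. \<forall>t\<in>{0..T}. \<forall>\<phi>\<in>test_functions. norm (partial_distr j (v t) \<phi>) \<le> C * C_seminorm k \<phi>"
    using C(1) by blast
  moreover have "continuous_on {0..T} (\<lambda>t. partial_distr j (v t) \<phi>)" if "\<phi> \<in> test_functions" for \<phi>
    using v that unfolding distr_curve_def partial_distr_def by (auto intro!: continuous_on_minus)
  ultimately show ?thesis
    using v partial_distr_distribution unfolding distr_curve_def by blast
qed

lemma distr_curve_spatial_op:
  fixes v :: "real \<Rightarrow> 'n::finite functional"
  assumes v: "distr_curve T v" and a: "continuous_on {0..T} a2" "\<And>j. continuous_on {0..T} (a1 j)" "continuous_on {0..T} a0"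
  shows "distr_curve T (\<lambda>t. spatial_op a2 a1 a0 t (v t))"
  unfolding spatial_op_def laplacian_def Dx_def
  by (intro distr_curve_add distr_curve_scale distr_curve_sum distr_curve_partial v
      continuous_intros a finite UNIV_not_empty)

lemma distr_curve_integral:
  fixes v :: "real \<Rightarrow> 'n::finite functional"
  assumes v: "distr_curve T v" and "0 \<le> T"
  shows "(\<lambda>\<phi>. integral {0..T} (\<lambda>t. v t \<phi>)) \<in> distributions"
  unfolding distributions_def
proof (intro CollectI conjI allI ballI impI)
  have d: "v t \<in> distributions" if "t \<in> {0..T}" for t using v that by (simp add: distr_curve_def)
  have cont: "continuous_on {0..T} (\<lambda>t. v t \<phi>)" if "\<phi> \<in> test_functions" for \<phi> using v that by (simp add: distr_curve_def)
  have int: "(\<lambda>t. v t \<phi>) integrable_on {0..T}" if "\<phi> \<in> test_functions" for \<phi>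
    by (intro integrable_continuous_real cont that)
  obtain C k where C: "C \<ge> 0" "\<And>t \<phi>. t \<in> {0..T} \<Longrightarrow> \<phi> \<in> test_functions \<Longrightarrow> norm (v t \<phi>) \<le> C * C_seminorm k \<phi>"
    using v unfolding distr_curve_def by blast
  have "norm (integral {0..T} (\<lambda>t. v t \<phi>)) \<le> (C * T) * C_seminorm k \<phi>" if \<phi>: "\<phi> \<in> test_functions" for \<phi>
    using integral_bound[OF \<open>0 \<le> T\<close> cont[OF \<phi>] C(2)[OF _ \<phi>]] by (simp add: mult_ac)
  then show "\<exists>C k. \<forall>\<phi>\<in>test_functions. norm (integral {0..T} (\<lambda>t. v t \<phi>)) \<le> C * C_seminorm k \<phi>" by blast
  show "integral {0..T} (\<lambda>t. v t \<phi>) = 0" if "\<phi> \<notin> test_functions" for \<phi>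
    by (rule integral_unique, rule has_integral_is_0) (use distr_off[OF d that] in auto)
  show "integral {0..T} (\<lambda>t. v t (\<lambda>x. \<phi> x + \<psi> x)) = integral {0..T} (\<lambda>t. v t \<phi>) + integral {0..T} (\<lambda>t. v t \<psi>)"
    if "\<phi> \<in> test_functions" "\<psi> \<in> test_functions" for \<phi> \<psi>
  proof -
    have "integral {0..T} (\<lambda>t. v t (\<lambda>x. \<phi> x + \<psi> x)) = integral {0..T} (\<lambda>t. v t \<phi> + v t \<psi>)"
      by (rule integral_cong) (rule distr_add[OF d that])
    also have "\<dots> = integral {0..T} (\<lambda>t. v t \<phi>) + integral {0..T} (\<lambda>t. v t \<psi>)"
      by (rule integral_add[OF int[OF that(1)] int[OF that(2)]])
    finally show ?thesis .
  qed
  show "integral {0..T} (\<lambda>t. v t (\<lambda>x. c * \<phi> x)) = c * integral {0..T} (\<lambda>t. v t \<phi>)" if "\<phi> \<in> test_functions" for c \<phi>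
  proof -
    have "integral {0..T} (\<lambda>t. v t (\<lambda>x. c * \<phi> x)) = integral {0..T} (\<lambda>t. c * v t \<phi>)"
      by (rule integral_cong) (rule distr_cmult[OF d that])
    then show ?thesis by simp
  qed
qed

subsection \<open>The equation on the Fourier side\<close>

text \<open>The Laplacian has symbol minus the sum of squares, hence the positive sign in front of
  \<open>a2\<close>.\<close>

definition symbol ::
  "(real \<Rightarrow> complex) \<Rightarrow> ('n::finite \<Rightarrow> real \<Rightarrow> complex) \<Rightarrow> (real \<Rightarrow> complex) \<Rightarrow> int ^ 'n \<Rightarrow> real \<Rightarrow> complex" where
  "symbol a2 a1 a0 \<xi> t = a2 t * (\<Sum>j\<in>UNIV. (of_int (\<xi> $ j))\<^sup>2) + (\<Sum>j\<in>UNIV. a1 j t * of_int (\<xi> $ j)) + a0 t"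

text \<open>This is the integrating factor E: solutions of the homogeneous equation are the initial
  value divided by it.\<close>

definition propagator ::
  "(real \<Rightarrow> complex) \<Rightarrow> ('n::finite \<Rightarrow> real \<Rightarrow> complex) \<Rightarrow> (real \<Rightarrow> complex) \<Rightarrow> int ^ 'n \<Rightarrow> real \<Rightarrow> complex" where
  "propagator a2 a1 a0 \<xi> t = exp (\<i> * integral {0..t} (symbol a2 a1 a0 \<xi>))"

lemma continuous_symbol:
  assumes "continuous_on {0..T} a2" "\<And>j. continuous_on {0..T} (a1 j)" "continuous_on {0..T} a0"
  shows "continuous_on {0..T} (symbol a2 a1 a0 \<xi>)"
  unfolding symbol_def[abs_def] by (intro continuous_intros assms)

lemma partial_wave_minus: "partial j (\<lambda>x. c * wave (- \<xi>) x) = (\<lambda>x. - (\<i> * of_int (\<xi> $ j) * c) * wave (- \<xi>) x)"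
  unfolding has_partial_partial[OF has_partial_cmult[OF has_partial_wave]] by (simp add: mult_ac)

lemma fourier_coeff_spatial_op:
  assumes v: "v \<in> distributions"
  shows "fourier_coeff (spatial_op a2 a1 a0 t v) \<xi> = symbol a2 a1 a0 \<xi> t * fourier_coeff v \<xi>"
proof -
  have w: "(\<lambda>x. c * wave (- \<xi>) x) \<in> test_functions" for c by simp
  have p: "partial_distr j u (\<lambda>x. c * wave (- \<xi>) x) = \<i> * of_int (\<xi> $ j) * c * u (wave (- \<xi>))"
    if "u \<in> distributions" for u j c
    unfolding partial_distr_def partial_wave_minus distr_cmult[OF that wave_test] using w by simp
  have p1: "partial_distr j u (wave (- \<xi>)) = \<i> * of_int (\<xi> $ j) * u (wave (- \<xi>))" if "u \<in> distributions" for u j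
    using p[OF that, of j 1] by simp
  have "laplacian v (wave (- \<xi>)) = (\<Sum>j\<in>UNIV. - ((of_int (\<xi> $ j))\<^sup>2 * v (wave (- \<xi>))))"
    unfolding laplacian_def p1[OF partial_distr_distribution[OF v]] p1[OF v]
    by (rule sum.cong[OF refl]) (simp add: complex_eq_iff power2_eq_square algebra_simps)
  then have "laplacian v (wave (- \<xi>)) = - (\<Sum>j\<in>UNIV. (of_int (\<xi> $ j))\<^sup>2) * v (wave (- \<xi>))"
    by (simp add: sum_negf sum_distrib_right)
  moreover have "Dx j v (wave (- \<xi>)) = of_int (\<xi> $ j) * v (wave (- \<xi>))" for j
    unfolding Dx_def p1[OF v] by (simp add: complex_eq_iff algebra_simps)
  ultimately show ?thesis
    by (simp add: fourier_coeff_wave spatial_op_def symbol_def algebra_simps sum_distrib_left)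
qed

text \<open>For a fixed time test function both sides of the weak equation are distributions on the
  torus, so it is enough to compare their Fourier coefficients, that is, to test with plane
  waves.\<close>

lemma weak_equation_modes:
  fixes u f :: "real \<Rightarrow> 'n::finite functional"
  assumes T: "0 \<le> T" and a: "continuous_on {0..T} a2" "\<And>j. continuous_on {0..T} (a1 j)" "continuous_on {0..T} a0"
    and u: "distr_curve T u" and f: "distr_curve T f" and \<theta>: "\<theta> \<in> time_test_functions T"
  defines "A \<equiv> spatial_op a2 a1 a0"
  shows "(\<forall>\<phi>\<in>test_functions. weak_Dt T u \<theta> \<phi> + time_pairing T (\<lambda>t. A t (u t)) \<theta> \<phi> = time_pairing T f \<theta> \<phi>) \<longleftrightarrow>
    (\<forall>\<xi>. integral {0..T} (\<lambda>t. fourier_coeff (u t) \<xi> * vector_derivative \<theta> (at t)) =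
      - integral {0..T} (\<lambda>t. \<i> * (fourier_coeff (f t) \<xi> - symbol a2 a1 a0 \<xi> t * fourier_coeff (u t) \<xi>) * \<theta> t))"
    (is "?L \<longleftrightarrow> (\<forall>\<xi>. ?R \<xi>)")
proof -
  have d\<theta>: "continuous_on {0..T} (\<lambda>t. vector_derivative \<theta> (at t))" and c\<theta>: "continuous_on {0..T} \<theta>"
    using time_test_derivative(2,3)[OF \<theta>] by auto
  have Dt: "- Dt_fun \<theta> t = \<i> * vector_derivative \<theta> (at t)" for t by (simp add: Dt_fun_def)
  have Au: "distr_curve T (\<lambda>t. A t (u t))" unfolding A_def by (intro distr_curve_spatial_op u a)
  define G where "G \<phi> = weak_Dt T u \<theta> \<phi> + time_pairing T (\<lambda>t. A t (u t)) \<theta> \<phi>" for \<phi>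
  have "distr_curve T (\<lambda>t \<phi>. \<i> * vector_derivative \<theta> (at t) * u t \<phi>)"
    by (rule distr_curve_scale[OF u, of "\<lambda>t. \<i> * vector_derivative \<theta> (at t)"]) (intro continuous_intros d\<theta>)
  from distr_curve_integral[OF this T] have "weak_Dt T u \<theta> \<in> distributions"
    unfolding weak_Dt_def distr_integral_def Dt by (simp only: mult.commute)
  moreover have pair: "time_pairing T v \<theta> \<in> distributions" if "distr_curve T v" for v :: "real \<Rightarrow> 'n functional"
    using distr_curve_integral[OF distr_curve_scale[OF that c\<theta>] T]
    by (simp add: time_pairing_def[abs_def] distr_integral_def mult_ac)
  ultimately have G: "G \<in> distributions"
    unfolding G_def using distr_lincomb[of "weak_Dt T u \<theta>" _ 1 1] pair[OF Au] by simp
  have modes: "fourier_coeff G \<xi> = fourier_coeff (time_pairing T f \<theta>) \<xi> \<longleftrightarrow> ?R \<xi>" for \<xi>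
  proof -
    have X: "weak_Dt T u \<theta> (wave (- \<xi>)) = \<i> * integral {0..T} (\<lambda>t. fourier_coeff (u t) \<xi> * vector_derivative \<theta> (at t))"
    proof -
      have "(\<lambda>t. u t (wave (- \<xi>)) * (\<i> * vector_derivative \<theta> (at t))) = (\<lambda>t. \<i> * (u t (wave (- \<xi>)) * vector_derivative \<theta> (at t)))"
        by (simp add: mult_ac)
      then show ?thesis
        unfolding weak_Dt_def distr_integral_def Dt fourier_coeff_wave by (simp only: integral_mult_right)
    qed
    have P: "time_pairing T (\<lambda>t. A t (u t)) \<theta> (wave (- \<xi>)) =
        integral {0..T} (\<lambda>t. symbol a2 a1 a0 \<xi> t * fourier_coeff (u t) \<xi> * \<theta> t)"
      unfolding time_pairing_def distr_integral_def
    proof (rule integral_cong)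
      fix t assume "t \<in> {0..T}"
      then have "u t \<in> distributions" using u by (simp add: distr_curve_def)
      from fourier_coeff_spatial_op[OF this, of a2 a1 a0 t \<xi>]
      show "A t (u t) (wave (- \<xi>)) * \<theta> t = symbol a2 a1 a0 \<xi> t * fourier_coeff (u t) \<xi> * \<theta> t"
        by (simp add: A_def fourier_coeff_wave)
    qed
    have F: "time_pairing T f \<theta> (wave (- \<xi>)) = integral {0..T} (\<lambda>t. fourier_coeff (f t) \<xi> * \<theta> t)"
      by (simp add: time_pairing_def distr_integral_def fourier_coeff_wave)
    have "integral {0..T} (\<lambda>t. \<i> * (fourier_coeff (f t) \<xi> - symbol a2 a1 a0 \<xi> t * fourier_coeff (u t) \<xi>) * \<theta> t) =
        \<i> * (integral {0..T} (\<lambda>t. fourier_coeff (f t) \<xi> * \<theta> t) -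
          integral {0..T} (\<lambda>t. symbol a2 a1 a0 \<xi> t * fourier_coeff (u t) \<xi> * \<theta> t))"
      by (subst integral_diff[symmetric])
        (intro integrable_continuous_real continuous_on_mult distr_curve_fourier_coeff f u c\<theta> continuous_symbol a,
         intro integrable_continuous_real continuous_on_mult distr_curve_fourier_coeff f u c\<theta> continuous_symbol a,
         simp only: integral_mult_right[symmetric] mult.assoc left_diff_distrib)
    then have S: "?R \<xi> \<longleftrightarrow> integral {0..T} (\<lambda>t. fourier_coeff (u t) \<xi> * vector_derivative \<theta> (at t)) =
        - (\<i> * (integral {0..T} (\<lambda>t. fourier_coeff (f t) \<xi> * \<theta> t) -
          integral {0..T} (\<lambda>t. symbol a2 a1 a0 \<xi> t * fourier_coeff (u t) \<xi> * \<theta> t)))"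
      by (simp only:)
    have alg: "\<i> * x + p = q \<longleftrightarrow> x = - (\<i> * (q - p))" for x p q :: complex
      by (auto simp: complex_eq_iff)
    have "fourier_coeff G \<xi> = fourier_coeff (time_pairing T f \<theta>) \<xi> \<longleftrightarrow>
        \<i> * integral {0..T} (\<lambda>t. fourier_coeff (u t) \<xi> * vector_derivative \<theta> (at t)) +
        integral {0..T} (\<lambda>t. symbol a2 a1 a0 \<xi> t * fourier_coeff (u t) \<xi> * \<theta> t) =
        integral {0..T} (\<lambda>t. fourier_coeff (f t) \<xi> * \<theta> t)"
      unfolding fourier_coeff_wave[of G] fourier_coeff_wave[of "time_pairing T f \<theta>"] G_def X P F ..
    then show ?thesis unfolding S alg .
  qed
  show ?thesis
  proof
    assume L: ?L
    have "fourier_coeff G \<xi> = fourier_coeff (time_pairing T f \<theta>) \<xi>" for \<xi>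
      unfolding fourier_coeff_wave[of G] fourier_coeff_wave[of "time_pairing T f \<theta>"] G_def using L wave_test by blast
    then show "\<forall>\<xi>. ?R \<xi>" using modes by blast
  next
    assume "\<forall>\<xi>. ?R \<xi>"
    then have "G = time_pairing T f \<theta>" using modes by (intro distr_eqI G pair f) blast
    then show ?L unfolding G_def by (metis (no_types))
  qed
qed

text \<open>Once the equation is reduced to modes for every time test function, the quantifiers are
  exchanged; for each frequency there remains a scalar weak equation, which is integrated and then
  solved by the integrating factor.\<close>

lemma solves_iff_modes:
  fixes u f :: "real \<Rightarrow> 'n::finite functional"
  assumes T: "0 < T" and a: "continuous_on {0..T} a2" "\<And>j. continuous_on {0..T} (a1 j)" "continuous_on {0..T} a0"
    and u: "continuous_into T (sobolev_topology \<rho>) u" and f: "distr_curve T f"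
  defines "E \<equiv> propagator a2 a1 a0"
  shows "solves T (spatial_op a2 a1 a0) f g u \<longleftrightarrow> u 0 = g \<and>
    (\<forall>\<xi>. \<forall>t\<in>{0..T}. E \<xi> t * fourier_coeff (u t) \<xi> =
      fourier_coeff (u 0) \<xi> + \<i> * integral {0..t} (\<lambda>s. E \<xi> s * fourier_coeff (f s) \<xi>))"
proof -
  have T0: "0 \<le> T" using T by simp
  have uc: "distr_curve T u" by (rule distr_curve_sobolev[OF u])
  have cu: "continuous_on {0..T} (\<lambda>t. fourier_coeff (u t) \<xi>)" for \<xi> by (rule distr_curve_fourier_coeff[OF uc])
  have cf: "continuous_on {0..T} (\<lambda>t. fourier_coeff (f t) \<xi>)" for \<xi> by (rule distr_curve_fourier_coeff[OF f])
  have cs: "continuous_on {0..T} (symbol a2 a1 a0 \<xi>)" for \<xi> by (rule continuous_symbol[OF a])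
  have cq: "continuous_on {0..T} (\<lambda>t. \<i> * (fourier_coeff (f t) \<xi> - symbol a2 a1 a0 \<xi> t * fourier_coeff (u t) \<xi>))" for \<xi>
    by (intro continuous_intros cu cf cs)
  have "(\<forall>\<theta>\<in>time_test_functions T. \<forall>\<phi>\<in>test_functions.
        weak_Dt T u \<theta> \<phi> + time_pairing T (\<lambda>t. spatial_op a2 a1 a0 t (u t)) \<theta> \<phi> = time_pairing T f \<theta> \<phi>) \<longleftrightarrow>
      (\<forall>\<theta>\<in>time_test_functions T. \<forall>\<xi>. integral {0..T} (\<lambda>t. fourier_coeff (u t) \<xi> * vector_derivative \<theta> (at t)) =
      - integral {0..T} (\<lambda>t. \<i> * (fourier_coeff (f t) \<xi> - symbol a2 a1 a0 \<xi> t * fourier_coeff (u t) \<xi>) * \<theta> t))"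
    by (rule ball_cong[OF refl], rule weak_equation_modes[OF T0 a uc f])
  also have "\<dots> \<longleftrightarrow> (\<forall>\<xi>. \<forall>\<theta>\<in>time_test_functions T. integral {0..T} (\<lambda>t. fourier_coeff (u t) \<xi> * vector_derivative \<theta> (at t)) =
      - integral {0..T} (\<lambda>t. \<i> * (fourier_coeff (f t) \<xi> - symbol a2 a1 a0 \<xi> t * fourier_coeff (u t) \<xi>) * \<theta> t))"
    by blast
  also have "\<dots> \<longleftrightarrow> (\<forall>\<xi>. \<forall>t\<in>{0..T}. fourier_coeff (u t) \<xi> = fourier_coeff (u 0) \<xi> +
      integral {0..t} (\<lambda>s. \<i> * (fourier_coeff (f s) \<xi> - symbol a2 a1 a0 \<xi> s * fourier_coeff (u s) \<xi>)))"
    by (rule all_cong1, rule weak_derivative_iff[OF T cu cq])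
  also have "\<dots> \<longleftrightarrow> (\<forall>\<xi>. \<forall>t\<in>{0..T}. E \<xi> t * fourier_coeff (u t) \<xi> =
      fourier_coeff (u 0) \<xi> + \<i> * integral {0..t} (\<lambda>s. E \<xi> s * fourier_coeff (f s) \<xi>))"
    unfolding E_def propagator_def by (rule all_cong1, rule integrating_factor[OF T0 cs cf cu])
  finally show ?thesis
    unfolding solves_def using u by blast
qed

text \<open>The two curves may be continuous into Sobolev spaces of different index. They are
  compared through their coefficients, which the formula with the nowhere vanishing integrating
  factor determines.\<close>

lemma solves_unique:
  fixes u v f :: "real \<Rightarrow> 'n::finite functional"
  assumes T: "0 < T" and a: "continuous_on {0..T} a2" "\<And>j. continuous_on {0..T} (a1 j)" "continuous_on {0..T} a0"
    and f: "distr_curve T f"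
    and u: "solves T (spatial_op a2 a1 a0) f g u" and v: "solves T (spatial_op a2 a1 a0) f g v" and t: "t \<in> {0..T}"
  shows "u t = v t"
proof -
  obtain \<rho> \<sigma> where us: "continuous_into T (sobolev_topology \<rho>) u" and vs: "continuous_into T (sobolev_topology \<sigma>) v"
    using u v unfolding solves_def by blast
  have "propagator a2 a1 a0 \<xi> t * fourier_coeff (u t) \<xi> = propagator a2 a1 a0 \<xi> t * fourier_coeff (v t) \<xi>" for \<xi>
    using u[unfolded solves_iff_modes[OF T a us f]] v[unfolded solves_iff_modes[OF T a vs f]] t by simp
  then have "fourier_coeff (u t) \<xi> = fourier_coeff (v t) \<xi>" for \<xi> by (simp add: propagator_def)
  then show ?thesis
    using distr_curve_sobolev[OF us] distr_curve_sobolev[OF vs] t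
    by (intro distr_eqI) (auto simp: distr_curve_def)
qed

subsection \<open>Conjugation of the two operators\<close>

text \<open>The quotient is exp (i times the integral of q), where q is the difference of the
  symbols. Frequencies are real, so by \<open>Im\<close> the imaginary part of q is that of
  \<open>a0 - b0\<close>, and the quotient is at most exp (B T) for every frequency. Its time
  derivative gains the factor q, of size at most \<open>B * bracket \<xi> ^ 2\<close>. The two
  operators enter symmetrically, so the reciprocal quotient is covered too.\<close>

lemma lipschitz_multiplier_propagator:
  fixes a1 b1 :: "'n::finite \<Rightarrow> real \<Rightarrow> complex"
  assumes T: "0 \<le> T"
    and a: "continuous_on {0..T} a2" "\<And>j. continuous_on {0..T} (a1 j)" "continuous_on {0..T} a0"
    and b: "continuous_on {0..T} b2" "\<And>j. continuous_on {0..T} (b1 j)" "continuous_on {0..T} b0"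
    and Im: "\<And>t. Im (a2 t) = Im (b2 t)" "\<And>j t. Im (a1 j t) = Im (b1 j t)"
  shows "\<exists>L. lipschitz_multiplier T L (\<lambda>t \<xi>. propagator a2 a1 a0 \<xi> t / propagator b2 b1 b0 \<xi> t)"
proof -
  define q where "q \<xi> t = symbol a2 a1 a0 \<xi> t - symbol b2 b1 b0 \<xi> t" for \<xi> t
  have cq: "continuous_on {0..T} (q \<xi>)" for \<xi>
    unfolding q_def[abs_def] by (intro continuous_intros continuous_symbol a b)
  define \<beta> where "\<beta> t = norm (a2 t - b2 t) + (\<Sum>j\<in>UNIV. norm (a1 j t - b1 j t)) + norm (a0 t - b0 t)" for t
  have "continuous_on {0..T} \<beta>" unfolding \<beta>_def[abs_def] by (intro continuous_intros a b)
  then have "bounded (\<beta> ` {0..T})" by (intro compact_imp_bounded compact_continuous_image) auto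
  then obtain B where B: "B > 0" "\<And>t. t \<in> {0..T} \<Longrightarrow> \<bar>\<beta> t\<bar> \<le> B" by (auto simp: bounded_pos)
  have \<beta>: "\<beta> t \<le> B" if "t \<in> {0..T}" for t using B(2)[OF that] by simp
  have q: "norm (q \<xi> t) \<le> B * bracket \<xi> ^ 2" if "t \<in> {0..T}" for t \<xi>
  proof -
    have n2: "norm (\<Sum>j\<in>UNIV. (complex_of_int (\<xi> $ j))\<^sup>2) \<le> bracket \<xi> ^ 2"
    proof -
      have "(\<Sum>j\<in>UNIV. (complex_of_int (\<xi> $ j))\<^sup>2) = of_real ((norm (freq \<xi>))\<^sup>2)"
        unfolding power2_norm_eq_inner by (simp add: inner_vec_def power2_eq_square)
      then have "norm (\<Sum>j\<in>UNIV. (complex_of_int (\<xi> $ j))\<^sup>2) = (norm (freq \<xi>))\<^sup>2"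
        by (simp only: norm_of_real abs_power2)
      also have "\<dots> \<le> bracket \<xi> ^ 2" by (rule power_mono) (auto simp: bracket_def)
      finally show ?thesis .
    qed
    have n1: "norm (complex_of_int (\<xi> $ j)) \<le> bracket \<xi> ^ 2" for j
    proof -
      have "norm (complex_of_int (\<xi> $ j)) \<le> bracket \<xi>" using abs_nth_le_bracket[of \<xi> j] by simp
      also have "\<dots> \<le> bracket \<xi> ^ 2" using power_increasing[OF _ bracket_ge_1, of 1 2 \<xi>] by simp
      finally show ?thesis .
    qed
    have n0: "1 \<le> bracket \<xi> ^ 2" using one_le_power[OF bracket_ge_1] .
    have "q \<xi> t = (a2 t - b2 t) * (\<Sum>j\<in>UNIV. (of_int (\<xi> $ j))\<^sup>2) + (\<Sum>j\<in>UNIV. (a1 j t - b1 j t) * of_int (\<xi> $ j)) + (a0 t - b0 t)"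
      by (simp add: q_def symbol_def left_diff_distrib sum_subtractf)
    also have "norm \<dots> \<le> norm (a2 t - b2 t) * norm (\<Sum>j\<in>UNIV. (complex_of_int (\<xi> $ j))\<^sup>2) +
        (\<Sum>j\<in>UNIV. norm (a1 j t - b1 j t) * norm (complex_of_int (\<xi> $ j))) + norm (a0 t - b0 t)"
      by (intro norm_triangle_le add_mono sum_norm_le) (auto simp: norm_mult)
    also have "\<dots> \<le> norm (a2 t - b2 t) * bracket \<xi> ^ 2 + (\<Sum>j\<in>UNIV. norm (a1 j t - b1 j t) * bracket \<xi> ^ 2) +
        norm (a0 t - b0 t) * bracket \<xi> ^ 2"
      using n0 n1 n2 mult_left_mono[OF n0, of "norm (a0 t - b0 t)"] by (intro add_mono sum_mono mult_left_mono) auto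
    also have "\<dots> = \<beta> t * bracket \<xi> ^ 2" by (simp add: \<beta>_def distrib_right sum_distrib_right)
    also have "\<dots> \<le> B * bracket \<xi> ^ 2" by (intro mult_right_mono \<beta> that) auto
    finally show ?thesis .
  qed
  define m where "m t \<xi> = exp (\<i> * integral {0..t} (q \<xi>))" for t \<xi>
  have m_eq: "propagator a2 a1 a0 \<xi> t / propagator b2 b1 b0 \<xi> t = m t \<xi>" if t: "t \<in> {0..T}" for t \<xi>
  proof -
    have sub: "{0..t} \<subseteq> {0..T}" using t by auto
    have "integral {0..t} (q \<xi>) = integral {0..t} (symbol a2 a1 a0 \<xi>) - integral {0..t} (symbol b2 b1 b0 \<xi>)"
      unfolding q_def[abs_def]
      by (intro integral_diff integrable_continuous_real continuous_on_subset[OF continuous_symbol sub] a b)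
    then show ?thesis by (simp add: propagator_def m_def exp_diff right_diff_distrib)
  qed
  have mb: "norm (m t \<xi>) \<le> exp (B * T)" if t: "t \<in> {0..T}" for t \<xi>
  proof -
    have sub: "{0..t} \<subseteq> {0..T}" using t by auto
    have Imq: "Im (q \<xi> s) = Im (a0 s - b0 s)" for s
    proof -
      have "(\<Sum>j\<in>UNIV. (complex_of_int (\<xi> $ j))\<^sup>2) = of_real (\<Sum>j\<in>UNIV. (of_int (\<xi> $ j))\<^sup>2)" by simp
      then show ?thesis by (simp only: q_def symbol_def) (simp add: Im flip: of_int_power of_int_sum)
    qed
    have "Im (integral {0..t} (q \<xi>)) = integral {0..t} (\<lambda>s. Im (q \<xi> s))"
      using integral_linear[OF integrable_continuous_real[OF continuous_on_subset[OF cq sub]] bounded_linear_Im]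
      by (simp add: o_def)
    moreover have "norm (integral {0..t} (\<lambda>s. Im (q \<xi> s))) \<le> B * (t - 0)"
    proof (rule integral_bound)
      show "continuous_on {0..t} (\<lambda>s. Im (q \<xi> s))" by (intro continuous_intros continuous_on_subset[OF cq sub])
      fix s assume s: "s \<in> {0..t}"
      have "norm (Im (q \<xi> s)) \<le> norm (a0 s - b0 s)" unfolding Imq using abs_Im_le_cmod[of "a0 s - b0 s"] by simp
      also have "\<dots> \<le> \<beta> s" unfolding \<beta>_def by (simp add: sum_nonneg)
      also have "\<dots> \<le> B" using s sub by (intro \<beta>) auto
      finally show "norm (Im (q \<xi> s)) \<le> B" .
    qed (use t in auto)
    moreover have "B * (t - 0) \<le> B * T" using t B(1) by simp
    ultimately have "- Im (integral {0..t} (q \<xi>)) \<le> B * T" by simp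
    then show ?thesis by (simp add: m_def)
  qed
  have lip: "norm (m \<tau> \<xi> - m t \<xi>) \<le> (exp (B * T) * B * bracket \<xi> ^ 2) * norm (\<tau> - t)"
    if t: "t \<in> {0..T}" "\<tau> \<in> {0..T}" for t \<tau> \<xi>
  proof (rule differentiable_bound[of "{0..T}" "\<lambda>t. m t \<xi>" "\<lambda>s h. h *\<^sub>R (\<i> * q \<xi> s * m s \<xi>)"])
    fix s assume s: "s \<in> {0..T}"
    have "((\<lambda>t. \<i> * integral {0..t} (q \<xi>)) has_vector_derivative \<i> * q \<xi> s) (at s within {0..T})"
      by (intro derivative_intros integral_has_vector_derivative cq s)
    from field_vector_diff_chain_within[OF this, of exp "exp (\<i> * integral {0..s} (q \<xi>))"]
    show "((\<lambda>t. m t \<xi>) has_derivative (\<lambda>h. h *\<^sub>R (\<i> * q \<xi> s * m s \<xi>))) (at s within {0..T})"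
      unfolding has_vector_derivative_def[symmetric]
      by (simp add: m_def o_def mult_ac DERIV_subset[OF DERIV_exp])
    have "norm (\<i> * q \<xi> s * m s \<xi>) \<le> exp (B * T) * B * bracket \<xi> ^ 2"
      using mult_mono[OF q[OF s, of \<xi>] mb[OF s, of \<xi>]] B(1) by (simp add: norm_mult mult_ac)
    from mult_left_mono[OF this abs_ge_zero]
    show "onorm (\<lambda>h::real. h *\<^sub>R (\<i> * q \<xi> s * m s \<xi>)) \<le> exp (B * T) * B * bracket \<xi> ^ 2"
      by (intro onorm_le) (simp only: norm_scaleR real_norm_def mult.commute)
  qed (use t in auto)
  \<comment> \<open>B + 1 in place of B makes the constant at least exp (B T), so that it serves for
    the size as well as for the increments.\<close>
  have "lipschitz_multiplier T (exp (B * T) * (B + 1)) (\<lambda>t \<xi>. propagator a2 a1 a0 \<xi> t / propagator b2 b1 b0 \<xi> t)"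
    unfolding lipschitz_multiplier_def
  proof (intro conjI ballI allI)
    fix t and \<xi> :: "int ^ 'n" assume t: "t \<in> {0..T}"
    have "1 * 1 \<le> (B + 1) * bracket \<xi> ^ 2" using B(1) one_le_power[OF bracket_ge_1, of \<xi> 2] by (intro mult_mono) auto
    from mult_left_mono[OF this exp_ge_zero[of "B * T"]]
    have "exp (B * T) \<le> exp (B * T) * (B + 1) * bracket \<xi> ^ 2" by (simp only: mult_1_right mult.assoc)
    from order_trans[OF mb[OF t] this]
    show "norm (propagator a2 a1 a0 \<xi> t / propagator b2 b1 b0 \<xi> t) \<le> exp (B * T) * (B + 1) * bracket \<xi> ^ 2"
      unfolding m_eq[OF t] .
    fix \<tau> assume \<tau>: "\<tau> \<in> {0..T}"
    have "norm (m \<tau> \<xi> - m t \<xi>) \<le> (exp (B * T) * B * bracket \<xi> ^ 2) * \<bar>\<tau> - t\<bar>" using lip[OF t \<tau>] by simp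
    also have "\<dots> \<le> (exp (B * T) * (B + 1) * bracket \<xi> ^ 2) * \<bar>\<tau> - t\<bar>"
      using B(1) by (intro mult_right_mono mult_left_mono) auto
    finally show "norm (propagator a2 a1 a0 \<xi> \<tau> / propagator b2 b1 b0 \<xi> \<tau> - propagator a2 a1 a0 \<xi> t / propagator b2 b1 b0 \<xi> t)
        \<le> exp (B * T) * (B + 1) * \<bar>\<tau> - t\<bar> * bracket \<xi> ^ 2"
      unfolding m_eq[OF t] m_eq[OF \<tau>] by (simp add: mult_ac)
  qed
  then show ?thesis by blast
qed

text \<open>Write E_a and E_b for the two propagators. The curve E_a u / E_b multiplied by E_b is
  E_a u, and the source E_b f / E_a multiplied by E_a is E_b f, so the integrated equations of the
  two problems coincide mode by mode. Both propagators are 1 at time 0, hence the initial value is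
  unchanged.\<close>

lemma solves_conjugate:
  fixes u f :: "real \<Rightarrow> 'n::finite functional"
  assumes T: "0 < T"
    and a: "continuous_on {0..T} a2" "\<And>j. continuous_on {0..T} (a1 j)" "continuous_on {0..T} a0"
    and b: "continuous_on {0..T} b2" "\<And>j. continuous_on {0..T} (b1 j)" "continuous_on {0..T} b0"
    and f: "distr_curve T f" and f': "distr_curve T (\<lambda>t. multiplier (\<lambda>\<xi>. propagator b2 b1 b0 \<xi> t / propagator a2 a1 a0 \<xi> t) (f t))"
    and L: "lipschitz_multiplier T L (\<lambda>t \<xi>. propagator a2 a1 a0 \<xi> t / propagator b2 b1 b0 \<xi> t)"
    and u: "solves T (spatial_op a2 a1 a0) (\<lambda>t. multiplier (\<lambda>\<xi>. propagator b2 b1 b0 \<xi> t / propagator a2 a1 a0 \<xi> t) (f t)) g u"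
  shows "solves T (spatial_op b2 b1 b0) f g (\<lambda>t. multiplier (\<lambda>\<xi>. propagator a2 a1 a0 \<xi> t / propagator b2 b1 b0 \<xi> t) (u t))"
proof -
  have T0: "0 \<le> T" using T by simp
  obtain \<rho> where us: "continuous_into T (sobolev_topology \<rho>) u" using u unfolding solves_def by blast
  have vs: "continuous_into T (sobolev_topology (\<rho> - 2)) (\<lambda>t. multiplier (\<lambda>\<xi>. propagator a2 a1 a0 \<xi> t / propagator b2 b1 b0 \<xi> t) (u t))"
    by (rule continuous_into_sobolev_multiplier[OF us L T0])
  have neq: "propagator c2 c1 c0 \<xi> t \<noteq> 0" for c2 c0 \<xi> t and c1 :: "'n \<Rightarrow> real \<Rightarrow> complex" by (simp add: propagator_def)
  have p0: "propagator c2 c1 c0 \<xi> 0 = 1" for c2 c0 \<xi> and c1 :: "'n \<Rightarrow> real \<Rightarrow> complex" by (simp add: propagator_def)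
  note U = u[unfolded solves_iff_modes[OF T a us f']]
  have "multiplier (\<lambda>\<xi>. propagator a2 a1 a0 \<xi> 0 / propagator b2 b1 b0 \<xi> 0) (u 0) = u 0"
  proof (rule distr_eqI)
    show "multiplier (\<lambda>\<xi>. propagator a2 a1 a0 \<xi> 0 / propagator b2 b1 b0 \<xi> 0) (u 0) \<in> distributions"
      using T0 distr_curve_sobolev[OF vs] by (auto simp: distr_curve_def)
    show "u 0 \<in> distributions" using T0 distr_curve_sobolev[OF us] by (auto simp: distr_curve_def)
  qed (simp add: p0)
  moreover have "(\<lambda>s. propagator a2 a1 a0 \<xi> s * (propagator b2 b1 b0 \<xi> s / propagator a2 a1 a0 \<xi> s * fourier_coeff (f s) \<xi>)) =
      (\<lambda>s. propagator b2 b1 b0 \<xi> s * fourier_coeff (f s) \<xi>)" for \<xi>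
    using neq by auto
  ultimately show ?thesis
    unfolding solves_iff_modes[OF T b vs f] using U neq by (simp add: p0)
qed

text \<open>Abstract in the spaces, to treat all scales at once: data go from X' to X by one
  quotient, the solution returns from Y to Y' by the reciprocal one. The initial value is not
  transformed, so for it an inclusion is enough. Uniqueness comes from
  \<open>solves_unique\<close>.\<close>

lemma well_posed_conjugate:
  fixes X Y X' Y' :: "'n::finite functional topology"
  assumes T: "0 < T"
    and a: "continuous_on {0..T} a2" "\<And>j. continuous_on {0..T} (a1 j)" "continuous_on {0..T} a0"
    and b: "continuous_on {0..T} b2" "\<And>j. continuous_on {0..T} (b1 j)" "continuous_on {0..T} b0"
    and Im: "\<And>t. Im (a2 t) = Im (b2 t)" "\<And>j t. Im (a1 j t) = Im (b1 j t)"
    and sob: "\<And>f. continuous_into T X f \<Longrightarrow> \<exists>\<rho>. continuous_into T (sobolev_topology \<rho>) f"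
      "\<And>f. continuous_into T X' f \<Longrightarrow> \<exists>\<rho>. continuous_into T (sobolev_topology \<rho>) f"
    and X: "\<And>f L m. continuous_into T X' f \<Longrightarrow> lipschitz_multiplier T L m \<Longrightarrow> continuous_into T X (\<lambda>t. multiplier (m t) (f t))"
    and Y: "\<And>u L m. continuous_into T Y u \<Longrightarrow> lipschitz_multiplier T L m \<Longrightarrow> continuous_into T Y' (\<lambda>t. multiplier (m t) (u t))"
    and top: "topspace X' \<subseteq> topspace X"
    and wp: "well_posed T (spatial_op a2 a1 a0) X Y"
  shows "well_posed T (spatial_op b2 b1 b0) X' Y'"
  unfolding well_posed_def
proof (intro allI impI conjI)
  fix f g assume fg: "continuous_into T X' f \<and> g \<in> topspace X'"
  have T0: "0 \<le> T" using T by simp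
  obtain L where L: "lipschitz_multiplier T L (\<lambda>t \<xi>. propagator a2 a1 a0 \<xi> t / propagator b2 b1 b0 \<xi> t)"
    using lipschitz_multiplier_propagator[where ?a1.0 = a1 and ?b1.0 = b1, OF T0 a b Im] by blast
  obtain L' where L': "lipschitz_multiplier T L' (\<lambda>t \<xi>. propagator b2 b1 b0 \<xi> t / propagator a2 a1 a0 \<xi> t)"
    using lipschitz_multiplier_propagator[where ?a1.0 = b1 and ?b1.0 = a1, OF T0 b a Im[symmetric]] by blast
  let ?f = "\<lambda>t. multiplier (\<lambda>\<xi>. propagator b2 b1 b0 \<xi> t / propagator a2 a1 a0 \<xi> t) (f t)"
  have f': "continuous_into T X ?f" using X[OF _ L'] fg by blast
  have fc: "distr_curve T f" using sob(2) fg distr_curve_sobolev by blast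
  have fc': "distr_curve T ?f" using sob(1)[OF f'] distr_curve_sobolev by blast
  obtain u where u: "continuous_into T Y u" "solves T (spatial_op a2 a1 a0) ?f g u"
    using wp f' fg top unfolding well_posed_def by blast
  show "\<exists>u. continuous_into T Y' u \<and> solves T (spatial_op b2 b1 b0) f g u"
    using Y[OF u(1) L] solves_conjugate[OF T a b fc fc' L u(2)] by blast
  fix v w assume "continuous_into T Y' v \<and> solves T (spatial_op b2 b1 b0) f g v \<and>
      continuous_into T Y' w \<and> solves T (spatial_op b2 b1 b0) f g w"
  then show "\<forall>t\<in>{0..T}. v t = w t" using solves_unique[where ?a1.0 = b1, OF T b fc] by blast
qed

theorem theorem3p4:
  fixes T :: real
    and a2 a0 :: "real \<Rightarrow> complex"
    and a1 :: "'n::finite \<Rightarrow> real \<Rightarrow> complex"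
    and c2 :: "real \<Rightarrow> real"
    and c1 :: "'n \<Rightarrow> real \<Rightarrow> real"
    and A A' :: "real \<Rightarrow> 'n functional \<Rightarrow> 'n functional"
  assumes "T > 0"
    and "continuous_on {0..T} a2"
    and "\<And>j. continuous_on {0..T} (a1 j)"
    and "continuous_on {0..T} a0"
  defines "c2 \<equiv> \<lambda>t. Im (a2 t)"
    and "c1 \<equiv> \<lambda>j t. Im (a1 j t)"
  defines "A \<equiv> spatial_op a2 a1 a0"
    and "A' \<equiv> spatial_op (\<lambda>t. \<i> * of_real (c2 t)) (\<lambda>j t. \<i> * of_real (c1 j t)) (\<lambda>t. 0)"
  shows "(well_posed_smooth T A \<longleftrightarrow> well_posed_smooth T A') \<and>
         (\<forall>s\<ge>1. well_posed_gevrey T A s \<longleftrightarrow> well_posed_gevrey T A' s) \<and>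
         (\<forall>\<delta>\<ge>0. well_posed_sobolev T A \<delta> \<longrightarrow> well_posed_sobolev T A' (4 + \<delta>))"
proof -
  let ?b2 = "\<lambda>t. \<i> * of_real (c2 t)" and ?b1 = "\<lambda>j t. \<i> * of_real (c1 j t)" and ?b0 = "\<lambda>t. 0 :: complex"
  have T0: "0 \<le> T" using \<open>T > 0\<close> by simp
  note a = assms(2-4)
  have b: "continuous_on {0..T} ?b2" "\<And>j. continuous_on {0..T} (?b1 j)" "continuous_on {0..T} ?b0"
    unfolding c2_def c1_def by (intro continuous_intros a)+
  have Im: "Im (a2 t) = Im (?b2 t)" "Im (a1 j t) = Im (?b1 j t)" for t j by (simp_all add: c2_def c1_def)
  note AA' = well_posed_conjugate[where ?a1.0 = a1 and ?b1.0 = ?b1, OF \<open>T > 0\<close> a b Im, folded A_def A'_def]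
  note A'A = well_posed_conjugate[where ?a1.0 = ?b1 and ?b1.0 = a1, OF \<open>T > 0\<close> b a Im[symmetric], folded A_def A'_def]
  have sob_smooth: "\<exists>\<rho>. continuous_into T (sobolev_topology \<rho>) f"
    if "continuous_into T smooth_topology f" for f :: "real \<Rightarrow> 'n functional"
    using that unfolding continuous_into_smooth by blast
  note mult_smooth = continuous_into_smooth_multiplier[OF _ _ T0]
  have smooth: "well_posed_smooth T A \<longleftrightarrow> well_posed_smooth T A'"
    unfolding well_posed_smooth_def
  proof
    assume wp: "well_posed T A smooth_topology smooth_topology"
    show "well_posed T A' smooth_topology smooth_topology"
      by (rule AA'[OF _ _ _ _ order_refl wp]) (blast intro: sob_smooth mult_smooth)+
  next
    assume wp: "well_posed T A' smooth_topology smooth_topology"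
    show "well_posed T A smooth_topology smooth_topology"
      by (rule A'A[OF _ _ _ _ order_refl wp]) (blast intro: sob_smooth mult_smooth)+
  qed
  have gevrey: "well_posed_gevrey T A s \<longleftrightarrow> well_posed_gevrey T A' s" if "s \<ge> 1" for s :: real
  proof -
    have s: "0 \<le> s" using that by simp
    have sob: "\<exists>\<rho>. continuous_into T (sobolev_topology \<rho>) f"
      if "continuous_into T (gevrey_topology s) f" for f :: "real \<Rightarrow> 'n functional"
      using continuous_into_gevrey_sobolev[OF that s] by blast
    note mult = continuous_into_gevrey_multiplier[OF _ _ T0 s]
    show ?thesis
      unfolding well_posed_gevrey_def
    proof
      assume wp: "well_posed T A (gevrey_topology s) (gevrey_topology s)"
      show "well_posed T A' (gevrey_topology s) (gevrey_topology s)"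
        by (rule AA'[OF _ _ _ _ order_refl wp]) (blast intro: sob mult)+
    next
      assume wp: "well_posed T A' (gevrey_topology s) (gevrey_topology s)"
      show "well_posed T A (gevrey_topology s) (gevrey_topology s)"
        by (rule A'A[OF _ _ _ _ order_refl wp]) (blast intro: sob mult)+
    qed
  qed
  have "well_posed_sobolev T A' (4 + \<delta>)" if wp: "well_posed_sobolev T A \<delta>" for \<delta> :: real
    unfolding well_posed_sobolev_def A'_def
  proof
    fix r
    show "well_posed T (spatial_op ?b2 ?b1 ?b0) (sobolev_topology r) (sobolev_topology (r - (4 + \<delta>)))"
    proof (rule well_posed_conjugate[where ?a1.0 = a1 and ?b1.0 = ?b1, OF \<open>T > 0\<close> a b Im])
      \<comment> \<open>The index count: transforming the data lowers r to r - 2, solving gives r -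
        2 - \<delta>, and transforming back gives r - 4 - \<delta>.\<close>
      show "well_posed T (spatial_op a2 a1 a0) (sobolev_topology (r - 2)) (sobolev_topology (r - 2 - \<delta>))"
        using wp by (simp add: well_posed_sobolev_def A_def)
      show "topspace (sobolev_topology r) \<subseteq> topspace (sobolev_topology (r - 2) :: 'n functional topology)"
        using sobolev_embedding(1)[of _ r "r - 2"] by auto
      show "continuous_into T (sobolev_topology (r - 2)) (\<lambda>t. multiplier (m t) (f t))"
        if "continuous_into T (sobolev_topology r) f" "lipschitz_multiplier T L m"
        for f :: "real \<Rightarrow> 'n functional" and L m
        by (rule continuous_into_sobolev_multiplier[OF that T0])
      show "continuous_into T (sobolev_topology (r - (4 + \<delta>))) (\<lambda>t. multiplier (m t) (u t))"
        if "continuous_into T (sobolev_topology (r - 2 - \<delta>)) u" "lipschitz_multiplier T L m"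
        for u :: "real \<Rightarrow> 'n functional" and L m
        using continuous_into_sobolev_multiplier[OF that T0] by (simp add: algebra_simps)
    qed blast+
  qed
  with smooth gevrey show ?thesis by blast
qed

end
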